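(* Let $\Delta=(\Sigma,C,w)$ be a complete simplicial multi-fan in a lattice $N$ of rank $n$ with a prescribed set of edge vectors $\mathcal V=\{v_i\}_{i\in\Sigma^{(1)}}$, let $1\le k\le n$, and let $x\in H_T^{2k}(\Delta,\mathcal V)_{\mathbb{Q}}$. Then for any $\xi\in H_T^2(\Delta,\mathcal V)_{\mathbb{Q}}$, $$p_*(e^{\xi}x)=\sum_{J\in\Sigma^{(k)}}\mu(x,J)\,p_*(e^{\xi}x_J)\qquad\text{in } \mathrm{Rat}(G_{n-k+1}(N_{\mathbb{Q}}))_0,$$ where the left-hand side, a rational number, is regarded as a constant rational function.
   Context: Let $N$ be a lattice of rank $n$, $M=\mathrm{Hom}(N,\mathbb{Z})$, with pairing $\langle\ ,\ \rangle$; subscripts $\mathbb{Q},\mathbb{R}$ denote tensoring. Multi-fans. A simplicial multi-fan in $N$ is a triple $\Delta=(\Sigma,C,w)$, where $\Sigma=\bigsqcup_{k=0}^n\Sigma^{(k)}$ is a finite simplicial complex ($\Sigma^{(k)}$ is the set of simplices with $k$ vertices, $\Sigma^{(0)}=\{o\}$, $o=\emptyset$), $C$ assigns to each $J\in\Sigma^{(k)}$ a $k$-dimensional strongly convex rational polyhedral cone $C(J)$ in $N_{\mathbb{R}}$, and $w:\Sigma^{(n)}\to\mathbb{Z}$ is a map. It is required that $\Sigma^{(n)}\neq\emptyset$, every $J\in\Sigma$ is contained in some $I\in\Sigma^{(n)}$, if $J$ is a face of $I$ then $C(J)$ is a face of $C(I)$, and for each $I$ the map $C$ restricted to $\{J\in\Sigma\mid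 J\subset I\}$ is an isomorphism of ordered sets onto the set of faces of $C(I)$. ($C$ need not be injective on $\Sigma$.) For $K\in\Sigma$ let $N_K$ be the minimal primitive (saturated) sublattice of $N$ containing $N\cap C(K)$, $N^K=N/N_K$, $\Sigma_K=\{J\in\Sigma\mid K\subset J\}$ (graded by $|J|-|K|$), $C_K(J)$ the image of $C(J)$ in $N^K_{\mathbb{R}}$, and restrict $w$ to $\Sigma_K^{(n-|K|)}=\{I\in\Sigma^{(n)}\mid I\supset K\}$; the projected multi-fan is $\Delta_K=(\Sigma_K,C_K,w)$ in $N^K$. A vector of the ambient space is generic if it lies on no linear subspace spanned by a cone of the multi-fan of less than full dimension. $\Delta$ is pre-complete if $d_v=\sum_{v\in C(I)}w(I)$ is independent of the generic vector $v$; it is complete if $\Delta_K$ is pre-complete for every $K\in\Sigma$. Edge vectors. For each $i\in\Sigma^{(1)}$ a nonzero vector $v_i\in N\cap C(i)$ (not necessarily primitive) is fixed; $\mathcal V=\{v_i\}$. $N_{J,\mathcal V}$ is the sublattice generated by $\{v_j\}_{j\in J}$, $H_{J,\mathcal V}=N_J/N_{J,\mathcal V}$, and $\{u_j^J\}_{j\in J}$ is the basis of $N_{J,\mathcal V}^*$ dual to $\{v_j\}_{j\in J}$. For $I\in\Sigma^{(n)}$, the $u_i^I$ are regarded as elements of $M_{\mathbb{Q}}$. Equivariant cohomology. $H_T^*(pt)$ is the symmetric algebra of $M$, with $M=H_T^2(pt)$ in degree 2. $H_T^*(\Delta,\mathcal V)$ is the Stanley–Reisner ring $\mathbb{Z}[x_i\mid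 i\in\Sigma^{(1)}]/(\prod_{i\in K}x_i\mid K\notin\Sigma)$, $\deg x_i=2$, made an $H_T^*(pt)$-algebra via $u\mapsto\sum_i\langle u,v_i\rangle x_i$ for $u\in M$. Put $x_J=\prod_{j\in J}x_j$. For $I\in\Sigma^{(n)}$, $\iota_I^*:H_T^*(\Delta,\mathcal V)_{\mathbb{Q}}\to H_T^*(pt)_{\mathbb{Q}}$ is the ring homomorphism with $\iota_I^*(x_i)=u_i^I$ for $i\in I$, $\iota_I^*(x_i)=0$ for $i\notin I$. Define $$\pi_*(x)=\sum_{I\in\Sigma^{(n)}}\frac{w(I)\,\iota_I^*(x)}{|H_{I,\mathcal V}|\prod_{i\in I}u_i^I};$$ for complete $\Delta$ it takes values in $H_T^*(pt)_{\mathbb{Q}}$, lowering degree by $2n$. $p_*:H_T^*(\Delta,\mathcal V)_{\mathbb{Q}}\to\mathbb{Q}$ is $\pi_*$ followed by projection to $H_T^0(pt)_{\mathbb{Q}}=\mathbb{Q}$; it extends to power series such as $e^\xi x$ (only the component of degree $2n$ contributes). The functions $\mu(x,J)$. For $J\in\Sigma^{(k)}$ let $M_J\subset M$ be the annihilator of $N_J$, choose an orientation of $M_J$, and put $\omega_J=u_1\wedge\cdots\wedge u_{n-k}\in\bigwedge^{n-k}M$ for an oriented basis of $M_J$. Define $f^J(x_i)=\iota_I^*(x_i)\wedge\omega_J\in\bigwedge^{n-k+1}M_{\mathbb{Q}}$, where $I\in\Sigma^{(n)}$ is any simplex containing $J$ (independent of $I$), and extend to a ring homomorphism $f^J:H_T^*(\Delta,\mathcal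 V)_{\mathbb{Q}}\to S^*(\bigwedge^{n-k+1}M_{\mathbb{Q}})$ to the symmetric algebra. For $x$ of degree $2k$, $f^J(x)/f^J(x_J)$ is homogeneous of degree $0$, independent of orientation, and is viewed as a rational function of degree $0$ on $\mathbb{P}(\bigwedge^{n-k+1}N_{\mathbb{Q}})$. Let $\mathrm{Rat}(G_{n-k+1}(N_{\mathbb{Q}}))_0$ be the field of rational functions (of degree $0$) on the Grassmannian $G_{n-k+1}(N_{\mathbb{Q}})$ of $(n-k+1)$-planes in $N_{\mathbb{Q}}$ and $\nu:G_{n-k+1}(N_{\mathbb{Q}})\to\mathbb{P}(\bigwedge^{n-k+1}N_{\mathbb{Q}})$ the Plücker embedding. Then $\mu(x,J)=\nu^*\big(f^J(x)/f^J(x_J)\big)$. *)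

theory Defs
  imports
    "HOL-Analysis.Analysis"
    "HOL-Algebra.QuotRing"
    "HOL-Library.Poly_Mapping"
    "HOL-Computational_Algebra.Computational_Algebra"
begin

section \<open>Polynomials with rational coefficients\<close>

text \<open>
  Monomials are finitely supported exponent functions.  The variable type must be linearly
  ordered only where a fraction field is formed (this is what the \<open>idom\<close> instance asks for).
\<close>

type_synonym 'v qpoly = "('v \<Rightarrow>\<^sub>0 nat) \<Rightarrow>\<^sub>0 rat"

definition qconst :: "rat \<Rightarrow> 'v qpoly" where
  "qconst c = Poly_Mapping.single 0 c"

definition qvar :: "'v \<Rightarrow> 'v qpoly" where
  "qvar i = Poly_Mapping.single (Poly_Mapping.single i 1) 1"

definition qvars :: "'v qpoly \<Rightarrow> 'v set" where
  "qvars p = (\<Union>m\<in>Poly_Mapping.keys p. Poly_Mapping.keys m)"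

definition homogeneous :: "nat \<Rightarrow> 'v qpoly \<Rightarrow> bool" where
  "homogeneous d p \<longleftrightarrow>
     (\<forall>m\<in>Poly_Mapping.keys p. (\<Sum>i\<in>Poly_Mapping.keys m. Poly_Mapping.lookup m i) = d)"

text \<open>The \<open>\<rat>\<close>-algebra homomorphism sending each variable \<open>i\<close> to \<open>g i\<close>.\<close>

definition qsubst :: "('v \<Rightarrow> 'w qpoly) \<Rightarrow> 'v qpoly \<Rightarrow> 'w qpoly" where
  "qsubst g p =
     (\<Sum>m\<in>Poly_Mapping.keys p. qconst (Poly_Mapping.lookup p m) *
        (\<Prod>i\<in>Poly_Mapping.keys m. g i ^ Poly_Mapping.lookup m i))"

definition qpoly_ring :: "'v set \<Rightarrow> 'v qpoly ring" where
  "qpoly_ring V = \<lparr>carrier = {p. qvars p \<subseteq> V}, monoid.mult = (*), one = 1, zero = 0, add = (+)\<rparr>"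


section \<open>Lattices\<close>

text \<open>
  A basis of the lattice \<open>N\<close> of rank \<open>n = CARD('n)\<close> is fixed, so \<open>N\<close> is \<open>int ^ 'n\<close>, and the scalar
  extensions of \<open>N\<close> are \<open>rat ^ 'n\<close> and \<open>real ^ 'n\<close>.  The dual lattice \<open>M\<close> and its rational extension
  are written in dual coordinates, again as \<open>int ^ 'n\<close> and \<open>rat ^ 'n\<close>.
\<close>

definition of_int_vec :: "int ^ 'n \<Rightarrow> 'a::ring_1 ^ 'n" where
  "of_int_vec x = (\<chi> i. of_int (x $ i))"

definition pairing :: "'a::comm_ring_1 ^ 'n \<Rightarrow> 'a ^ 'n \<Rightarrow> 'a" where
  "pairing u y = (\<Sum>i\<in>UNIV. u $ i * y $ i)"

definition primitive_sublattice :: "(int ^ 'n) set \<Rightarrow> bool" where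
  "primitive_sublattice L \<longleftrightarrow>
     0 \<in> L \<and> (\<forall>x\<in>L. \<forall>y\<in>L. x - y \<in> L) \<and> (\<forall>m x. m \<noteq> 0 \<and> m *s x \<in> L \<longrightarrow> x \<in> L)"

definition lattice_basis :: "(int ^ 'n) list \<Rightarrow> (int ^ 'n) set \<Rightarrow> bool" where
  "lattice_basis us L \<longleftrightarrow>
     bij_betw (\<lambda>c. \<Sum>a<length us. c a *s us ! a) ({..<length us} \<rightarrow>\<^sub>E UNIV) L"


section \<open>Multi-fans\<close>

definition rational_cone :: "(real ^ 'n) set \<Rightarrow> bool" where
  "rational_cone S \<longleftrightarrow> (\<exists>G. finite G \<and> S = convex_cone hull (of_int_vec ` G))"

definition strongly_convex :: "(real ^ 'n) set \<Rightarrow> bool" where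
  "strongly_convex S \<longleftrightarrow> (\<forall>x. x \<in> S \<and> - x \<in> S \<longrightarrow> x = 0)"

text \<open>The library relation \<open>face_of\<close> also counts the empty set as a face.\<close>

definition cone_faces :: "(real ^ 'n) set \<Rightarrow> (real ^ 'n) set set" where
  "cone_faces S = {F. F face_of S \<and> F \<noteq> {}}"

text \<open>Simplices are finite sets of vertices; a vertex \<open>i\<close> corresponds to the simplex \<open>{i}\<close>.\<close>

record ('v, 'n) multi_fan_data =
  simplices :: "'v set set"
  cone_of :: "'v set \<Rightarrow> (real ^ 'n) set"
  weight :: "'v set \<Rightarrow> int"

definition simplices_card :: "('v, 'n::finite) multi_fan_data \<Rightarrow> nat \<Rightarrow> 'v set set" where
  "simplices_card \<Delta> k = {J \<in> simplices \<Delta>. card J = k}"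

definition vertices :: "('v, 'n::finite) multi_fan_data \<Rightarrow> 'v set" where
  "vertices \<Delta> = {i. {i} \<in> simplices \<Delta>}"

definition simplicial_multi_fan :: "('v, 'n::finite) multi_fan_data \<Rightarrow> bool" where
  "simplicial_multi_fan \<Delta> \<longleftrightarrow>
     finite (simplices \<Delta>) \<and> {} \<in> simplices \<Delta> \<and>
     (\<forall>J\<in>simplices \<Delta>. finite J \<and> card J \<le> CARD('n) \<and> (\<forall>J'\<subseteq>J. J' \<in> simplices \<Delta>)) \<and>
     (\<forall>J\<in>simplices \<Delta>. rational_cone (cone_of \<Delta> J) \<and> strongly_convex (cone_of \<Delta> J) \<and>
        dim (cone_of \<Delta> J) = card J) \<and>
     simplices_card \<Delta> CARD('n) \<noteq> {} \<and>
     (\<forall>J\<in>simplices \<Delta>. \<exists>I\<in>simplices_card \<Delta> CARD('n). J \<subseteq> I) \<and>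
     (\<forall>I\<in>simplices \<Delta>. \<forall>J\<subseteq>I. cone_of \<Delta> J \<in> cone_faces (cone_of \<Delta> I)) \<and>
     (\<forall>I\<in>simplices \<Delta>.
        bij_betw (cone_of \<Delta>) {J \<in> simplices \<Delta>. J \<subseteq> I} (cone_faces (cone_of \<Delta> I)) \<and>
        (\<forall>J\<subseteq>I. \<forall>J'\<subseteq>I. cone_of \<Delta> J \<subseteq> cone_of \<Delta> J' \<longleftrightarrow> J \<subseteq> J'))"

definition sublattice_of :: "('v, 'n::finite) multi_fan_data \<Rightarrow> 'v set \<Rightarrow> (int ^ 'n) set" where
  "sublattice_of \<Delta> K =
     \<Inter>{L. primitive_sublattice L \<and> {x. of_int_vec x \<in> cone_of \<Delta> K} \<subseteq> L}"

text \<open>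
  The projection from \<open>N\<^sub>\<real>\<close> to the ambient space of the projected multi-fan \<open>\<Delta>\<^sub>K\<close>, which is the
  quotient of \<open>N\<^sub>\<real>\<close> by the real span of \<open>N\<^sub>K\<close>; its elements are cosets.
\<close>

definition proj_vec ::
  "('v, 'n::finite) multi_fan_data \<Rightarrow> 'v set \<Rightarrow> real ^ 'n \<Rightarrow> (real ^ 'n) set" where
  "proj_vec \<Delta> K y = (+) y ` span (of_int_vec ` sublattice_of \<Delta> K)"

definition proj_cone ::
  "('v, 'n::finite) multi_fan_data \<Rightarrow> 'v set \<Rightarrow> 'v set \<Rightarrow> (real ^ 'n) set set" where
  "proj_cone \<Delta> K J = proj_vec \<Delta> K ` cone_of \<Delta> J"

text \<open>
  Genericity with respect to \<open>\<Delta>\<^sub>K\<close>: the linear span of the projected cone is the image of the span of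
  the cone, and its dimension \<open>card J - card K\<close> is less than full iff \<open>card J < n\<close>.
\<close>

definition proj_generic ::
  "('v, 'n::finite) multi_fan_data \<Rightarrow> 'v set \<Rightarrow> (real ^ 'n) set \<Rightarrow> bool" where
  "proj_generic \<Delta> K q \<longleftrightarrow> q \<in> range (proj_vec \<Delta> K) \<and>
     (\<forall>J\<in>simplices \<Delta>. K \<subseteq> J \<and> card J < CARD('n) \<longrightarrow> q \<notin> proj_vec \<Delta> K ` span (cone_of \<Delta> J))"

definition proj_degree ::
  "('v, 'n::finite) multi_fan_data \<Rightarrow> 'v set \<Rightarrow> (real ^ 'n) set \<Rightarrow> int" where
  "proj_degree \<Delta> K q =
     (\<Sum>I | I \<in> simplices_card \<Delta> CARD('n) \<and> K \<subseteq> I \<and> q \<in> proj_cone \<Delta> K I. weight \<Delta> I)"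

definition proj_pre_complete :: "('v, 'n::finite) multi_fan_data \<Rightarrow> 'v set \<Rightarrow> bool" where
  "proj_pre_complete \<Delta> K \<longleftrightarrow>
     (\<forall>q q'. proj_generic \<Delta> K q \<and> proj_generic \<Delta> K q' \<longrightarrow> proj_degree \<Delta> K q = proj_degree \<Delta> K q')"

definition complete_multi_fan :: "('v, 'n::finite) multi_fan_data \<Rightarrow> bool" where
  "complete_multi_fan \<Delta> \<longleftrightarrow>
     simplicial_multi_fan \<Delta> \<and> (\<forall>K\<in>simplices \<Delta>. proj_pre_complete \<Delta> K)"

definition edge_vectors :: "('v, 'n::finite) multi_fan_data \<Rightarrow> ('v \<Rightarrow> int ^ 'n) \<Rightarrow> bool" where
  "edge_vectors \<Delta> v \<longleftrightarrow> (\<forall>i\<in>vertices \<Delta>. v i \<noteq> 0 \<and> of_int_vec (v i) \<in> cone_of \<Delta> {i})"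

definition edge_sublattice :: "('v \<Rightarrow> int ^ 'n) \<Rightarrow> 'v set \<Rightarrow> (int ^ 'n) set" where
  "edge_sublattice v J = {\<Sum>j\<in>J. c j *s v j | c. True}"

text \<open>The order of \<open>H\<close> for \<open>J\<close>, the quotient of \<open>N\<^sub>J\<close> by the lattice generated by the edge vectors of \<open>J\<close>.\<close>

definition H_order ::
  "('v, 'n::finite) multi_fan_data \<Rightarrow> ('v \<Rightarrow> int ^ 'n) \<Rightarrow> 'v set \<Rightarrow> nat" where
  "H_order \<Delta> v J =
     card (sublattice_of \<Delta> J //
       {(x, y). x \<in> sublattice_of \<Delta> J \<and> y \<in> sublattice_of \<Delta> J \<and> x - y \<in> edge_sublattice v J})"

text \<open>The element \<open>u\<^sub>i\<^sup>I\<close> of \<open>M\<^sub>\<rat>\<close>; meant for \<open>I\<close> with \<open>n\<close> vertices, where it is unique.\<close>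

definition dual_vec :: "('v \<Rightarrow> int ^ 'n) \<Rightarrow> 'v set \<Rightarrow> 'v \<Rightarrow> rat ^ 'n" where
  "dual_vec v I i = (THE u. \<forall>j\<in>I. pairing u (of_int_vec (v j)) = (if j = i then 1 else 0))"


section \<open>Equivariant cohomology\<close>

definition SR_ideal :: "('v, 'n::finite) multi_fan_data \<Rightarrow> 'v qpoly set" where
  "SR_ideal \<Delta> = genideal (qpoly_ring (vertices \<Delta>))
     {\<Prod>i\<in>K. qvar i | K. K \<subseteq> vertices \<Delta> \<and> K \<notin> simplices \<Delta>}"

text \<open>
  The rational equivariant cohomology of \<open>(\<Delta>, V)\<close>, that is, the Stanley-Reisner ring with rational
  coefficients.  Its elements are cosets of polynomials.
\<close>

definition HT :: "('v, 'n::finite) multi_fan_data \<Rightarrow> 'v qpoly set ring" where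
  "HT \<Delta> = qpoly_ring (vertices \<Delta>) Quot SR_ideal \<Delta>"

definition HT_class :: "('v, 'n::finite) multi_fan_data \<Rightarrow> 'v qpoly \<Rightarrow> 'v qpoly set" where
  "HT_class \<Delta> p = SR_ideal \<Delta> +>\<^bsub>qpoly_ring (vertices \<Delta>)\<^esub> p"

text \<open>The part of cohomological degree \<open>2 * d\<close>.\<close>

definition HT_even :: "('v, 'n::finite) multi_fan_data \<Rightarrow> nat \<Rightarrow> 'v qpoly set set" where
  "HT_even \<Delta> d = {HT_class \<Delta> p | p. qvars p \<subseteq> vertices \<Delta> \<and> homogeneous d p}"

definition x_face :: "('v, 'n::finite) multi_fan_data \<Rightarrow> 'v set \<Rightarrow> 'v qpoly set" where
  "x_face \<Delta> J = HT_class \<Delta> (\<Prod>j\<in>J. qvar j)"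

text \<open>
  The rational symmetric algebra of \<open>M\<close> is the polynomial ring \<open>'n qpoly\<close> on the dual basis;
  \<open>lin_form\<close> is the inclusion of \<open>M\<^sub>\<rat>\<close> as the part of polynomial degree one.
\<close>

definition lin_form :: "rat ^ 'n \<Rightarrow> 'n::finite qpoly" where
  "lin_form u = (\<Sum>j\<in>UNIV. qconst (u $ j) * qvar j)"

definition iota_gen :: "('v \<Rightarrow> int ^ 'n) \<Rightarrow> 'v set \<Rightarrow> 'v \<Rightarrow> rat ^ 'n" where
  "iota_gen v I i = (if i \<in> I then dual_vec v I i else 0)"

text \<open>
  A homomorphism on the Stanley-Reisner ring is given by its values on the variables.  The induced
  substitution is constant on each coset (it kills the Stanley-Reisner ideal), and \<open>the_elem\<close>
  returns that constant.
\<close>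

definition iota :: "('v \<Rightarrow> int ^ 'n) \<Rightarrow> 'v set \<Rightarrow> 'v qpoly set \<Rightarrow> 'n::finite qpoly" where
  "iota v I x = the_elem (qsubst (\<lambda>i. lin_form (iota_gen v I i)) ` x)"

definition pi_push ::
  "('v, 'n::{finite,linorder}) multi_fan_data \<Rightarrow> ('v \<Rightarrow> (int, 'n) vec) \<Rightarrow> 'v qpoly set \<Rightarrow> 'n qpoly fract"
  where
  "pi_push \<Delta> v x =
     (\<Sum>I\<in>simplices_card \<Delta> CARD('n).
        of_int (weight \<Delta> I) * to_fract (iota v I x) /
        (of_nat (H_order \<Delta> v I) * to_fract (\<Prod>i\<in>I. lin_form (dual_vec v I i))))"

text \<open>For complete \<open>\<Delta>\<close> the value of \<open>pi_push\<close> is a polynomial; \<open>p_push\<close> is its constant term.\<close>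

definition p_push ::
  "('v, 'n::{finite,linorder}) multi_fan_data \<Rightarrow> ('v \<Rightarrow> (int, 'n) vec) \<Rightarrow> 'v qpoly set \<Rightarrow> rat" where
  "p_push \<Delta> v x = Poly_Mapping.lookup (THE f. to_fract f = pi_push \<Delta> v x) 0"

text \<open>
  The value of the extension of \<open>p_push\<close> to power series at \<open>e\<^sup>\<xi> x\<close>, where \<open>\<xi>\<close> has degree 2.  The terms
  \<open>\<xi>\<^sup>m x / m!\<close> with \<open>m > n\<close> have no component of degree \<open>2n\<close>, the only one that contributes.
\<close>

definition p_push_exp ::
  "('v, 'n::{finite,linorder}) multi_fan_data \<Rightarrow> ('v \<Rightarrow> (int, 'n) vec) \<Rightarrow>
     'v qpoly set \<Rightarrow> 'v qpoly set \<Rightarrow> rat" where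
  "p_push_exp \<Delta> v \<xi> x =
     (\<Sum>m\<le>CARD('n). p_push \<Delta> v ((\<xi> [^]\<^bsub>HT \<Delta>\<^esub> m) \<otimes>\<^bsub>HT \<Delta>\<^esub> x) / fact m)"


section \<open>Exterior powers and the Grassmannian\<close>

text \<open>The determinant of the matrix \<open>(A a b)\<close> with \<open>a, b < r\<close>; here the size \<open>r\<close> varies.\<close>

definition det_size :: "nat \<Rightarrow> (nat \<Rightarrow> nat \<Rightarrow> 'a::comm_ring_1) \<Rightarrow> 'a" where
  "det_size r A = (\<Sum>p | p permutes {..<r}. of_int (sign p) * (\<Prod>a<r. A a (p a)))"

text \<open>
  The \<open>r\<close>-th exterior power of \<open>M\<^sub>\<rat>\<close> has as basis the wedge products of coordinate vectors
  \<open>e\<^sub>s\<^sub>1 \<and> \<dots> \<and> e\<^sub>s\<^sub>r\<close> with \<open>s\<^sub>1 < \<dots> < s\<^sub>r\<close>, indexed by the sets \<open>S\<close> of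
  size \<open>r\<close>.  Its symmetric algebra is the polynomial ring in these basis elements, which are the
  homogeneous coordinates on the projective space of the exterior power of \<open>N\<^sub>\<rat>\<close>.
\<close>

definition wedge :: "(rat, 'n) vec list \<Rightarrow> 'n::{finite,linorder} set qpoly" where
  "wedge us = (\<Sum>S | card S = length us.
     qconst (det_size (length us) (\<lambda>a b. us ! a $ (sorted_list_of_set S ! b))) * qvar S)"

definition annihilator :: "(int ^ 'n) set \<Rightarrow> (int ^ 'n) set" where
  "annihilator L = {u. \<forall>y\<in>L. pairing u y = 0}"

text \<open>
  The choices of a basis (hence of an orientation) of \<open>M\<^sub>J\<close> and of a maximal simplex containing \<open>J\<close>
  are arbitrary: another basis multiplies all values of \<open>f_gen\<close> by the same sign, which cancels in
  \<open>mu\<close>, and \<open>f_gen\<close> does not depend on the maximal simplex.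
\<close>

definition omega_basis :: "('v, 'n::finite) multi_fan_data \<Rightarrow> 'v set \<Rightarrow> (int ^ 'n) list" where
  "omega_basis \<Delta> J = (SOME us. lattice_basis us (annihilator (sublattice_of \<Delta> J)))"

definition top_simplex :: "('v, 'n::finite) multi_fan_data \<Rightarrow> 'v set \<Rightarrow> 'v set" where
  "top_simplex \<Delta> J = (SOME I. I \<in> simplices_card \<Delta> CARD('n) \<and> J \<subseteq> I)"

definition f_gen ::
  "('v, 'n::{finite,linorder}) multi_fan_data \<Rightarrow> ('v \<Rightarrow> (int, 'n) vec) \<Rightarrow> 'v set \<Rightarrow> 'v \<Rightarrow> 'n set qpoly"
  where
  "f_gen \<Delta> v J i =
     wedge (iota_gen v (top_simplex \<Delta> J) i # map of_int_vec (omega_basis \<Delta> J))"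

definition f_hom ::
  "('v, 'n::{finite,linorder}) multi_fan_data \<Rightarrow> ('v \<Rightarrow> (int, 'n) vec) \<Rightarrow> 'v set \<Rightarrow>
     'v qpoly set \<Rightarrow> 'n set qpoly" where
  "f_hom \<Delta> v J x = the_elem (qsubst (f_gen \<Delta> v J) ` x)"

text \<open>
  The entries of a generic matrix with columns indexed by \<open>'n\<close>.  (The product type is avoided
  because its library order is not linear.)
\<close>

datatype 'n entry = Entry nat 'n

instantiation entry :: (linorder) linorder
begin

fun less_eq_entry :: "'a entry \<Rightarrow> 'a entry \<Rightarrow> bool" where
  "Entry a i \<le> Entry b j \<longleftrightarrow> a < b \<or> a = b \<and> i \<le> j"

definition less_entry :: "'a entry \<Rightarrow> 'a entry \<Rightarrow> bool" where
  "(x :: 'a entry) < y \<longleftrightarrow> x \<le> y \<and> \<not> y \<le> x"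

instance
proof
  fix x y z :: "'a entry"
  show "x < y \<longleftrightarrow> x \<le> y \<and> \<not> y \<le> x" by (rule less_entry_def)
  show "x \<le> x" by (cases x) simp
  show "x \<le> z" if "x \<le> y" "y \<le> z" using that by (cases x; cases y; cases z) auto
  show "x = y" if "x \<le> y" "y \<le> x" using that by (cases x; cases y) auto
  show "x \<le> y \<or> y \<le> x" by (cases x; cases y) auto
qed

end

text \<open>
  Pullback along the Pluecker embedding.  An \<open>r\<close>-plane in \<open>N\<^sub>\<rat>\<close> is the row space of an \<open>r\<close> by \<open>n\<close>
  matrix of rank \<open>r\<close>, and its homogeneous coordinate with index \<open>S\<close> is the minor on the columns
  \<open>S\<close>.  Taking the generic matrix, the kernel of \<open>plucker r\<close> is the homogeneous ideal of the
  Grassmannian, so that the image is its homogeneous coordinate ring.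
\<close>

definition plucker :: "nat \<Rightarrow> 'n::{finite,linorder} set qpoly \<Rightarrow> 'n entry qpoly" where
  "plucker r = qsubst (\<lambda>S. det_size r (\<lambda>a b. qvar (Entry a (sorted_list_of_set S ! b))))"

text \<open>
  The field of rational functions of degree 0 on the Grassmannian of \<open>r\<close>-planes: fractions of
  elements of the homogeneous coordinate ring of the same degree.
\<close>

definition Rat_Grassmannian :: "nat \<Rightarrow> 'n::{finite,linorder} entry qpoly fract set" where
  "Rat_Grassmannian r =
     {to_fract (plucker r F) / to_fract (plucker r G) | F G d.
        qvars F \<subseteq> {S. card S = r} \<and> qvars G \<subseteq> {S. card S = r} \<and>
        homogeneous d F \<and> homogeneous d G \<and> plucker r G \<noteq> 0}"

definition rat_const :: "rat \<Rightarrow> 'n::{finite,linorder} entry qpoly fract" where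
  "rat_const c = to_fract (qconst c)"

definition mu ::
  "('v, 'n::{finite,linorder}) multi_fan_data \<Rightarrow> ('v \<Rightarrow> (int, 'n) vec) \<Rightarrow> 'v qpoly set \<Rightarrow> 'v set \<Rightarrow>
     'n entry qpoly fract" where
  "mu \<Delta> v x J =
     (let r = CARD('n) - card J + 1
      in to_fract (plucker r (f_hom \<Delta> v J x)) / to_fract (plucker r (f_hom \<Delta> v J (x_face \<Delta> J))))"

end

theory Submission
  imports Defs
begin

text \<open>
  Put \<open>r = n - k + 1\<close> and let \<open>F\<close> be the field of rational functions in the entries of the generic
  matrix with \<open>r\<close> rows.  The rows span the generic \<open>r\<close>-plane \<open>E\<close> in \<open>F\<^sup>n\<close>.  For a simplex \<open>J\<close> with \<open>k\<close>
  vertices \<open>E\<close> meets the span of \<open>N\<^sub>J\<close> in a line, and by the Cauchy-Binet formula \<open>f_gen\<close>, pulled back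
  to the Grassmannian, evaluates \<open>u\<^sub>i\<^sup>I\<close> at a generator \<open>a\<^sub>J\<close> of this line.  So \<open>f_hom\<close> becomes the
  evaluation of polynomials at the point \<open>x\<^sub>i = \<langle>u\<^sub>i\<^sup>I, a\<^sub>J\<rangle>\<close>, called \<open>face_value\<close> below, and \<open>mu\<close> is
  the quotient of two values.  This evaluation kills the linear relations that come from forms
  vanishing on \<open>E\<close>, because \<open>a\<^sub>J\<close> lies in \<open>E\<close>; it kills \<open>x\<^sub>i\<close> for \<open>i\<close> outside \<open>J\<close>, because \<open>a\<^sub>J\<close> lies
  in the span of \<open>N\<^sub>J\<close>; and it does not kill \<open>x\<^sub>J\<close>, because \<open>E\<close> is generic.

  The functional \<open>x \<mapsto> p\<^sub>*(e\<^sup>\<xi> x)\<close> kills the linear relation of every \<open>u\<close> in \<open>M\<close> times anything: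
  \<open>\<pi>\<^sub>*\<close> is linear over the symmetric algebra of \<open>M\<close> and takes polynomial values, so the result is the
  constant term of \<open>u\<close> times a polynomial.  Hence the difference of the two sides of the theorem is
  an \<open>F\<close>-valued functional of \<open>x\<close> that vanishes on monomials whose support is not a simplex, on all
  \<open>x\<^sub>J\<close>, and on multiples of the linear relations of forms vanishing on \<open>E\<close>.  Such a functional is zero
  in degree \<open>k\<close> (\<open>monomials_vanish\<close>): if the support \<open>K\<close> of a monomial of degree \<open>k\<close> has fewer than \<open>k\<close>
  elements, some \<open>i\<close> has exponent at least 2; by general position a form vanishing on \<open>E\<close> has the
  value 1 at \<open>v\<^sub>i\<close> and 0 at the other edge vectors of \<open>K\<close>; its linear relation trades one factor \<open>x\<^sub>i\<close>
  for variables outside \<open>K\<close> and so enlarges the support.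

  Completeness of the multi-fan makes \<open>\<pi>\<^sub>*\<close> take polynomial values (\<open>pi_push_polynomial\<close>).  The
  denominators are products of linear forms, which are prime elements, so it is enough to exclude a
  pole along each form \<open>g\<close>.  The maximal simplices whose terms have such a pole are grouped by the
  simplex \<open>K\<close> of their \<open>n - 1\<close> vertices on the hyperplane \<open>g = 0\<close>.  Modulo \<open>g\<close> the terms of one group
  have equal numerators and equal remaining denominators.  Since \<open>|H\<^sub>I|\<close> is proportional to \<open>|g(v\<^sub>i)|\<close>
  (\<open>H_order_facet\<close>), where \<open>i\<close> is the vertex of \<open>I\<close> off the hyperplane, the residues are proportional
  to \<open>w(I)\<close> times the sign of \<open>g(v\<^sub>i)\<close>, and completeness of \<open>\<Delta>\<^sub>K\<close> says that these sum to zero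
  (\<open>facet_balance\<close>).
\<close>

section \<open>Substitution in polynomials\<close>

abbreviation keys :: "('a \<Rightarrow>\<^sub>0 'b::zero) \<Rightarrow> 'a set" where
  "keys \<equiv> Poly_Mapping.keys"

abbreviation lookup :: "('a \<Rightarrow>\<^sub>0 'b::zero) \<Rightarrow> 'a \<Rightarrow> 'b" where
  "lookup \<equiv> Poly_Mapping.lookup"

abbreviation xmono :: "('v \<Rightarrow>\<^sub>0 nat) \<Rightarrow> 'v qpoly" where
  "xmono m \<equiv> Poly_Mapping.single m 1"

lemma qconst_hom:
  "qconst 0 = 0" "qconst 1 = 1" "qconst (a + b) = qconst a + qconst b"
  "qconst (a * b) = qconst a * qconst b" "qconst (- a) = - qconst a"
  "qconst (a - b) = qconst a - qconst b"
  by (simp_all add: qconst_def single_add mult_single single_uminus single_diff)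

lemma qconst_eq_0_iff: "qconst c = 0 \<longleftrightarrow> c = 0"
  by (metis lookup_single_eq lookup_zero qconst_def qconst_hom(1))

lemma qconst_sum: "qconst (\<Sum>a\<in>A. f a) = (\<Sum>a\<in>A. qconst (f a))"
  by (induction A rule: infinite_finite_induct) (simp_all add: qconst_hom)

lemma qconst_prod: "qconst (\<Prod>a\<in>A. f a) = (\<Prod>a\<in>A. qconst (f a))"
  by (induction A rule: infinite_finite_induct) (simp_all add: qconst_hom)

lemma qconst_of_int: "qconst (of_int c) = of_int c"
  by (simp add: qconst_def)

lemma qvar_eq_xmono: "qvar i = xmono (Poly_Mapping.single i 1)"
  by (simp add: qvar_def)

lemma xmono_add: "xmono (m + m') = xmono m * xmono m'"
  by (simp add: mult_single)

lemma qpoly_expand: "p = (\<Sum>m\<in>keys p. qconst (lookup p m) * xmono m)"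
proof (rule poly_mapping_eqI)
  fix k
  have "lookup (\<Sum>m\<in>keys p. qconst (lookup p m) * xmono m) k
    = (\<Sum>m\<in>keys p. if m = k then lookup p m else 0)"
    by (auto simp: lookup_sum qconst_def mult_single lookup_single when_def intro!: sum.cong)
  also have "\<dots> = lookup p k"
    by (simp add: sum.delta in_keys_iff)
  finally show "lookup p k =
    lookup (\<Sum>m\<in>keys p. qconst (lookup p m) * xmono m) k" ..
qed

lemma keys_add_nat:
  fixes m m' :: "'v \<Rightarrow>\<^sub>0 nat"
  shows "keys (m + m') = keys m \<union> keys m'"
  by (auto simp: in_keys_iff lookup_add)

lemma xmono_eq_prod: "xmono m = (\<Prod>i\<in>keys m. qvar i ^ lookup m i)"
proof (induction m rule: update_induct)
  case const
  show ?case by simp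
next
  case (update m a b)
  have p: "qvar i ^ e = xmono (Poly_Mapping.single i e)" for i :: 'a and e
    by (induction e) (simp_all add: qvar_def mult_single single_add[symmetric])
  have k: "keys (Poly_Mapping.update a b m) = insert a (keys m)"
    using update by (auto simp: in_keys_iff lookup_update split: if_splits)
  have e: "Poly_Mapping.update a b m = Poly_Mapping.single a b + m"
    using update by (intro poly_mapping_eqI) (auto simp: lookup_update lookup_add lookup_single in_keys_iff)
  have "xmono (Poly_Mapping.update a b m) = qvar a ^ b * xmono m"
    unfolding e xmono_add p ..
  also have "xmono m = (\<Prod>i\<in>keys m. qvar i ^ lookup (Poly_Mapping.update a b m) i)"
    unfolding update.IH using update by (intro prod.cong) (auto simp: lookup_update)
  also have "qvar a ^ b * \<dots> = (\<Prod>i\<in>insert a (keys m). qvar i ^ lookup (Poly_Mapping.update a b m) i)"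
    using update by (simp add: lookup_update)
  finally show ?case unfolding k .
qed

lemma qsubst_eq_sum:
  assumes "finite A" "keys p \<subseteq> A"
  shows "qsubst g p = (\<Sum>m\<in>A. qconst (lookup p m) *
    (\<Prod>i\<in>keys m. g i ^ lookup m i))"
  unfolding qsubst_def using assms
  by (intro sum.mono_neutral_left) (auto simp: in_keys_iff qconst_hom)

lemma qsubst_0 [simp]: "qsubst g 0 = 0"
  by (simp add: qsubst_def)

lemma qsubst_add [simp]: "qsubst g (p + q) = qsubst g p + qsubst g q"
proof -
  let ?A = "keys p \<union> keys q"
  have "keys (p + q) \<subseteq> ?A" by (rule keys_add)
  then show ?thesis
    by (simp add: qsubst_eq_sum[of ?A] lookup_add qconst_hom distrib_right sum.distrib)
qed

lemma qsubst_sum [simp]: "qsubst g (\<Sum>a\<in>A. f a) = (\<Sum>a\<in>A. qsubst g (f a))"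
  by (induction A rule: infinite_finite_induct) simp_all

lemma qsubst_cmono: "qsubst g (qconst c * xmono m) =
    qconst c * (\<Prod>i\<in>keys m. g i ^ lookup m i)"
  by (cases "c = 0") (simp_all add: qsubst_def qconst_def mult_single)

lemma monomial_value_add:
  fixes g :: "'v \<Rightarrow> 'w qpoly"
  shows "(\<Prod>i\<in>keys (m + m'). g i ^ lookup (m + m') i) =
    (\<Prod>i\<in>keys m. g i ^ lookup m i) *
    (\<Prod>i\<in>keys m'. g i ^ lookup m' i)"
proof -
  let ?A = "keys m \<union> keys m'"
  have "(\<Prod>i\<in>keys n. g i ^ lookup n i) = (\<Prod>i\<in>?A. g i ^ lookup n i)"
    if "keys n \<subseteq> ?A" for n
    using that by (intro prod.mono_neutral_left) (auto simp: in_keys_iff)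
  then show ?thesis
    by (simp add: keys_add_nat lookup_add power_add prod.distrib)
qed

lemma qsubst_mult [simp]: "qsubst g (p * q) = qsubst g p * qsubst g q"
proof -
  let ?c = "\<lambda>p m. qconst (lookup p m) * xmono m"
  have cm: "qsubst g (?c p m * ?c q m') = qsubst g (?c p m) * qsubst g (?c q m')" for m m'
  proof -
    have e: "?c p m * ?c q m' =
      qconst (lookup p m * lookup q m') * xmono (m + m')"
      by (simp add: xmono_add qconst_hom mult_ac)
    show ?thesis
      unfolding e unfolding qsubst_cmono monomial_value_add unfolding qconst_hom by (simp only: mult_ac)
  qed
  have "qsubst g (p * q) = qsubst g ((\<Sum>m\<in>keys p. ?c p m) * (\<Sum>m\<in>keys q. ?c q m))"
    by (simp only: qpoly_expand[symmetric])
  also have "\<dots> = (\<Sum>m\<in>keys p. qsubst g (?c p m)) * (\<Sum>m\<in>keys q. qsubst g (?c q m))"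
    by (simp only: sum_product qsubst_sum cm)
  also have "\<dots> = qsubst g p * qsubst g q"
    by (simp only: qsubst_sum[symmetric] qpoly_expand[symmetric])
  finally show ?thesis .
qed

lemma qsubst_qconst [simp]: "qsubst g (qconst c) = qconst c"
  using qsubst_cmono[of g c 0] by simp

lemma qsubst_1 [simp]: "qsubst g 1 = 1"
  using qsubst_qconst[of g 1] by (simp add: qconst_hom)

lemma qsubst_qvar [simp]: "qsubst g (qvar i) = g i"
  using qsubst_cmono[of g 1 "Poly_Mapping.single i 1"] by (simp add: qconst_hom qvar_def)

lemma qsubst_uminus [simp]: "qsubst g (- p) = - qsubst g p"
  using qsubst_add[of g p "- p"] by (metis add.inverse_unique add.right_inverse qsubst_0)

lemma qsubst_diff [simp]: "qsubst g (p - q) = qsubst g p - qsubst g q"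
  using qsubst_add[of g p "- q"] by simp

lemma qsubst_power [simp]: "qsubst g (p ^ e) = qsubst g p ^ e"
  by (induction e) simp_all

lemma qsubst_prod [simp]: "qsubst g (\<Prod>a\<in>A. f a) = (\<Prod>a\<in>A. qsubst g (f a))"
  by (induction A rule: infinite_finite_induct) simp_all

lemma qsubst_of_int [simp]: "qsubst g (of_int c) = of_int c"
  by (metis qconst_of_int qsubst_qconst)

text \<open>
  Only variables of \<open>p\<close> have to be treated, because the monomials of \<open>p\<close> are products of these.
\<close>

lemma qpoly_induct [case_names const var add mult]:
  assumes c: "\<And>c. P (qconst c)" and v: "\<And>i. i \<in> qvars p \<Longrightarrow> P (qvar i)"
    and a: "\<And>p q. P p \<Longrightarrow> P q \<Longrightarrow> P (p + q)" and m: "\<And>p q. P p \<Longrightarrow> P q \<Longrightarrow> P (p * q)"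
  shows "P p"
proof -
  have S: "P (\<Sum>a\<in>A. f a)" if "\<And>a. a \<in> A \<Longrightarrow> P (f a)" for A :: "('a \<Rightarrow>\<^sub>0 nat) set" and f
    using that c[of 0] a by (induction A rule: infinite_finite_induct) (auto simp: qconst_hom)
  have E: "P (q ^ e)" if "P q" for q e
    using that c[of 1] m by (induction e) (auto simp: qconst_hom)
  have R: "P (\<Prod>a\<in>A. f a)" if "\<And>a. a \<in> A \<Longrightarrow> P (f a)" for A :: "'a set" and f
    using that c[of 1] m by (induction A rule: infinite_finite_induct) (auto simp: qconst_hom)
  have "P (\<Sum>m\<in>keys p. qconst (lookup p m) * xmono m)"
    unfolding xmono_eq_prod by (intro S m c R E v) (auto simp: qvars_def)
  then show ?thesis by (simp only: qpoly_expand[symmetric])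
qed

lemma qvars_hom:
  "qvars (qconst c) = {}" "qvars (qvar i) = {i}" "qvars 0 = {}" "qvars 1 = {}" "qvars (- p) = qvars p"
  "qvars (p + q) \<subseteq> qvars p \<union> qvars q" "qvars (p * q) \<subseteq> qvars p \<union> qvars q"
proof -
  show "qvars (p + q) \<subseteq> qvars p \<union> qvars q"
    using keys_add[of p q] unfolding qvars_def by blast
  show "qvars (p * q) \<subseteq> qvars p \<union> qvars q"
  proof
    fix i assume "i \<in> qvars (p * q)"
    then obtain m where m: "m \<in> keys (p * q)" "i \<in> keys m"
      by (auto simp: qvars_def)
    then obtain a b where "m = a + b" "a \<in> keys p" "b \<in> keys q"
      using keys_mult[of p q] by auto
    then show "i \<in> qvars p \<union> qvars q"
      using m(2) by (auto simp: qvars_def keys_add_nat)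
  qed
qed (auto simp: qvars_def qconst_def qvar_def in_keys_iff)

lemma qvars_sum: "(\<And>a. a \<in> A \<Longrightarrow> qvars (f a) \<subseteq> V) \<Longrightarrow> qvars (\<Sum>a\<in>A. f a) \<subseteq> V"
  by (induction A rule: infinite_finite_induct) (use qvars_hom(6) in \<open>fastforce simp: qvars_hom\<close>)+

lemma qvars_prod: "(\<And>a. a \<in> A \<Longrightarrow> qvars (f a) \<subseteq> V) \<Longrightarrow> qvars (\<Prod>a\<in>A. f a) \<subseteq> V"
  by (induction A rule: infinite_finite_induct) (use qvars_hom(7) in \<open>fastforce simp: qvars_hom\<close>)+

lemma qvars_power: "qvars p \<subseteq> V \<Longrightarrow> qvars (p ^ e) \<subseteq> V"
  by (induction e) (use qvars_hom(7) in \<open>fastforce simp: qvars_hom\<close>)+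

lemma qvars_mult: "qvars p \<subseteq> V \<Longrightarrow> qvars q \<subseteq> V \<Longrightarrow> qvars (p * q) \<subseteq> V"
  using qvars_hom(7) by fast

lemma qvars_add: "qvars p \<subseteq> V \<Longrightarrow> qvars q \<subseteq> V \<Longrightarrow> qvars (p + q) \<subseteq> V"
  using qvars_hom(6) by fast

lemma qvars_xmono: "qvars (xmono m) = keys m"
  by (simp add: qvars_def)

lemma qvars_qsubst:
  assumes "\<And>i. i \<in> qvars p \<Longrightarrow> qvars (g i) \<subseteq> V"
  shows "qvars (qsubst g p) \<subseteq> V"
  unfolding qsubst_def
  by (intro qvars_sum qvars_mult qvars_prod qvars_power assms) (auto simp: qvars_def qconst_def)

subsection \<open>Homogeneity\<close>

abbreviation mdeg :: "('v \<Rightarrow>\<^sub>0 nat) \<Rightarrow> nat" where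
  "mdeg m \<equiv> \<Sum>i\<in>keys m. lookup m i"

lemma mdeg_add: "mdeg (m + m') = mdeg m + mdeg m'"
proof -
  let ?A = "keys m \<union> keys m'"
  have "mdeg n = (\<Sum>i\<in>?A. lookup n i)" if "keys n \<subseteq> ?A" for n
    using that by (intro sum.mono_neutral_left) (auto simp: in_keys_iff)
  then show ?thesis
    by (simp add: keys_add_nat lookup_add sum.distrib)
qed

lemma homogeneous_qconst: "homogeneous 0 (qconst c)"
  by (auto simp: homogeneous_def qconst_def)

lemma homogeneous_qvar: "homogeneous 1 (qvar i)"
  by (auto simp: homogeneous_def qvar_def)

lemma homogeneous_add: "homogeneous d p \<Longrightarrow> homogeneous d q \<Longrightarrow> homogeneous d (p + q)"
  using keys_add[of p q] unfolding homogeneous_def by blast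

lemma homogeneous_sum: "(\<And>a. a \<in> A \<Longrightarrow> homogeneous d (f a)) \<Longrightarrow> homogeneous d (\<Sum>a\<in>A. f a)"
  by (induction A rule: infinite_finite_induct) (auto simp: homogeneous_add, (simp add: homogeneous_def)+)

lemma homogeneous_mult: "homogeneous d p \<Longrightarrow> homogeneous e q \<Longrightarrow> homogeneous (d + e) (p * q)"
  unfolding homogeneous_def
proof
  fix m assume h: "\<forall>m\<in>keys p. mdeg m = d" "\<forall>m\<in>keys q. mdeg m = e"
    and "m \<in> keys (p * q)"
  then obtain a b where "m = a + b" "a \<in> keys p" "b \<in> keys q"
    using keys_mult[of p q] by auto
  then show "mdeg m = d + e"
    using h by (simp add: mdeg_add)
qed

lemma homogeneous_power: "homogeneous d p \<Longrightarrow> homogeneous (e * d) (p ^ e)"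
proof (induction e)
  case (Suc e)
  then show ?case using homogeneous_mult[of d p "e * d" "p ^ e"] by simp
qed (simp add: homogeneous_def)

lemma homogeneous_prod:
  "(\<And>a. a \<in> A \<Longrightarrow> homogeneous (d a) (f a)) \<Longrightarrow> homogeneous (\<Sum>a\<in>A. d a) (\<Prod>a\<in>A. f a)"
proof (induction A rule: infinite_finite_induct)
  case (insert a A)
  then show ?case using homogeneous_mult[of "d a" "f a" "sum d A" "prod f A"] by simp
qed (simp_all add: homogeneous_def)

lemma homogeneous_qsubst:
  assumes "homogeneous d p" and "\<And>i. homogeneous 1 (g i)"
  shows "homogeneous d (qsubst g p)"
  unfolding qsubst_def
proof (rule homogeneous_sum)
  fix m assume "m \<in> keys p"
  then have d: "mdeg m = d" using assms(1) by (simp add: homogeneous_def)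
  have "homogeneous (mdeg m) (\<Prod>i\<in>keys m. g i ^ lookup m i)"
    by (intro homogeneous_prod) (use homogeneous_power[OF assms(2)] in simp)
  then show "homogeneous d (qconst (lookup p m) *
      (\<Prod>i\<in>keys m. g i ^ lookup m i))"
    using homogeneous_mult[OF homogeneous_qconst] d by fastforce
qed

section \<open>The Stanley-Reisner ring\<close>

lemma qpoly_ring_simps:
  "carrier (qpoly_ring V) = {p. qvars p \<subseteq> V}" "mult (qpoly_ring V) = (*)" "one (qpoly_ring V) = 1"
  "zero (qpoly_ring V) = 0" "add (qpoly_ring V) = (+)"
  by (simp_all add: qpoly_ring_def)

lemma qpoly_cring: "cring (qpoly_ring V)"
proof (rule cringI)
  show "abelian_group (qpoly_ring V)"
  proof (rule abelian_groupI)
    fix x assume "x \<in> carrier (qpoly_ring V)"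
    then show "\<exists>y\<in>carrier (qpoly_ring V). y \<oplus>\<^bsub>qpoly_ring V\<^esub> x = \<zero>\<^bsub>qpoly_ring V\<^esub>"
      by (intro bexI[of _ "- x"]) (auto simp: qpoly_ring_simps qvars_hom)
  qed (auto simp: qpoly_ring_simps qvars_hom add_ac dest: qvars_add)
  show "Group.comm_monoid (qpoly_ring V)"
    by (rule comm_monoidI) (auto simp: qpoly_ring_simps qvars_hom mult_ac dest: qvars_mult)
qed (auto simp: qpoly_ring_simps distrib_right)

lemma a_minus_qpoly_ring:
  assumes "qvars q \<subseteq> V" shows "a_inv (qpoly_ring V) q = - q"
proof -
  interpret cring "qpoly_ring V" by (rule qpoly_cring)
  show ?thesis
    by (rule minus_equality) (use assms in \<open>auto simp: qpoly_ring_simps qvars_hom\<close>)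
qed

lemma qvars_prod_qvar: "K \<subseteq> V \<Longrightarrow> qvars (\<Prod>i\<in>K. qvar i) \<subseteq> V"
  by (rule qvars_prod) (auto simp: qvars_hom)

lemma SR_ideal_ideal: "ideal (SR_ideal \<Delta>) (qpoly_ring (vertices \<Delta>))"
proof -
  interpret cring "qpoly_ring (vertices \<Delta>)" by (rule qpoly_cring)
  show ?thesis unfolding SR_ideal_def
    by (rule genideal_ideal) (auto simp: qpoly_ring_simps dest: subsetD[OF qvars_prod_qvar])
qed

text \<open>
  The condition for the substitution \<open>x\<^sub>i \<mapsto> g i\<close> to descend to the Stanley-Reisner ring.
\<close>

definition kills_nonfaces :: "('v, 'n::finite) multi_fan_data \<Rightarrow> ('v \<Rightarrow> 'w qpoly) \<Rightarrow> bool" where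
  "kills_nonfaces \<Delta> g \<longleftrightarrow>
    (\<forall>K. K \<subseteq> vertices \<Delta> \<and> K \<notin> simplices \<Delta> \<longrightarrow> (\<Prod>i\<in>K. g i) = 0)"

text \<open>
  The polynomials killed by the substitution form an ideal, and it contains the generators.
\<close>

lemma qsubst_SR_ideal:
  assumes "kills_nonfaces \<Delta> g" and "p \<in> SR_ideal \<Delta>"
  shows "qsubst g p = 0"
proof -
  let ?V = "vertices \<Delta>"
  interpret cring "qpoly_ring ?V" by (rule qpoly_cring)
  let ?Z = "{p. qvars p \<subseteq> ?V \<and> qsubst g p = 0}"
  have "ideal ?Z (qpoly_ring ?V)"
  proof (rule idealI)
    show "ring (qpoly_ring ?V)" by (rule ring_axioms)
    show "subgroup ?Z (add_monoid (qpoly_ring ?V))"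
    proof (rule group.subgroupI)
      show "Group.group (add_monoid (qpoly_ring ?V))" by (rule a_group)
      show "?Z \<subseteq> carrier (add_monoid (qpoly_ring ?V))" by (auto simp: qpoly_ring_simps)
      have "0 \<in> ?Z" by (simp add: qvars_hom)
      then show "?Z \<noteq> {}" by blast
    next
      fix a assume "a \<in> ?Z"
      then have a: "qvars a \<subseteq> ?V" "qsubst g a = 0" by auto
      have "m_inv (add_monoid (qpoly_ring ?V)) a = - a"
        using a_minus_qpoly_ring[OF a(1)] by (simp add: a_inv_def)
      then show "m_inv (add_monoid (qpoly_ring ?V)) a \<in> ?Z" using a by (simp add: qvars_hom)
    next
      fix a b assume "a \<in> ?Z" "b \<in> ?Z"
      then show "a \<otimes>\<^bsub>add_monoid (qpoly_ring ?V)\<^esub> b \<in> ?Z"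
        by (auto simp: qpoly_ring_simps dest: subsetD[OF qvars_add])
    qed
  next
    fix a x assume "a \<in> ?Z" "x \<in> carrier (qpoly_ring ?V)"
    then show "x \<otimes>\<^bsub>qpoly_ring ?V\<^esub> a \<in> ?Z" "a \<otimes>\<^bsub>qpoly_ring ?V\<^esub> x \<in> ?Z"
      by (auto simp: qpoly_ring_simps dest: subsetD[OF qvars_mult])
  qed
  moreover have "{\<Prod>i\<in>K. qvar i | K. K \<subseteq> ?V \<and> K \<notin> simplices \<Delta>} \<subseteq> ?Z"
    using assms(1) qvars_prod_qvar by (force simp: kills_nonfaces_def)
  ultimately have "SR_ideal \<Delta> \<subseteq> ?Z"
    unfolding SR_ideal_def by (rule genideal_minimal)
  then show ?thesis using assms(2) by auto
qed

lemma HT_class_eq: "HT_class \<Delta> p = {s + p | s. s \<in> SR_ideal \<Delta>}"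
  by (auto simp: HT_class_def a_r_coset_def r_coset_def qpoly_ring_simps)

lemma zero_in_SR_ideal: "0 \<in> SR_ideal \<Delta>"
proof -
  interpret ideal "SR_ideal \<Delta>" "qpoly_ring (vertices \<Delta>)" by (rule SR_ideal_ideal)
  show ?thesis using additive_subgroup.zero_closed[OF is_additive_subgroup] by (simp add: qpoly_ring_simps)
qed

text \<open>
  Both \<open>iota\<close> and \<open>f_hom\<close> are of this form, so this is the rule that computes them on classes.
\<close>

lemma the_elem_qsubst_HT_class:
  assumes "kills_nonfaces \<Delta> g"
  shows "the_elem (qsubst g ` HT_class \<Delta> p) = qsubst g p"
proof -
  have "qsubst g ` HT_class \<Delta> p = {qsubst g p}"
    using zero_in_SR_ideal qsubst_SR_ideal[OF assms] unfolding HT_class_eq by (force intro!: image_eqI)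
  then show ?thesis by simp
qed

lemma HT_class_mult:
  assumes "qvars p \<subseteq> vertices \<Delta>" "qvars q \<subseteq> vertices \<Delta>"
  shows "HT_class \<Delta> p \<otimes>\<^bsub>HT \<Delta>\<^esub> HT_class \<Delta> q = HT_class \<Delta> (p * q)"
proof -
  interpret ideal "SR_ideal \<Delta>" "qpoly_ring (vertices \<Delta>)" by (rule SR_ideal_ideal)
  show ?thesis
    using rcoset_mult_add[of p q] assms
    by (simp add: HT_def FactRing_def HT_class_def qpoly_ring_simps)
qed

lemma HT_class_power:
  assumes "qvars q \<subseteq> vertices \<Delta>"
  shows "HT_class \<Delta> q [^]\<^bsub>HT \<Delta>\<^esub> (m::nat) = HT_class \<Delta> (q ^ m)"
proof -
  interpret ideal "SR_ideal \<Delta>" "qpoly_ring (vertices \<Delta>)" by (rule SR_ideal_ideal)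
  interpret H: ring "HT \<Delta>" unfolding HT_def by (rule quotient_is_ring)
  show ?thesis
  proof (induction m)
    case 0
    show ?case by (simp add: HT_def FactRing_def HT_class_def qpoly_ring_simps)
  next
    case (Suc m)
    then show ?case
      using HT_class_mult[OF qvars_power[OF assms] assms] by (simp add: mult.commute)
  qed
qed

section \<open>Linear forms as prime elements, and poles along them\<close>

lemma lin_form_hom:
  "lin_form 0 = 0" "lin_form (u + w) = lin_form u + lin_form w"
  "lin_form (u - w) = lin_form u - lin_form w" "lin_form (c *s u) = qconst c * lin_form u"
  by (simp_all add: lin_form_def qconst_hom distrib_right left_diff_distrib sum.distrib
      sum_subtractf sum_distrib_left mult.assoc)

lemma lin_form_sum: "lin_form (\<Sum>a\<in>A. f a) = (\<Sum>a\<in>A. lin_form (f a))"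
  by (induction A rule: infinite_finite_induct) (simp_all add: lin_form_hom)

lemma lin_form_eq_0_iff: "lin_form u = 0 \<longleftrightarrow> u = 0"
proof
  assume "lin_form u = 0"
  then have "lookup (lin_form u) (Poly_Mapping.single i 1) = 0" for i by simp
  moreover have "lookup (lin_form u) (Poly_Mapping.single i 1) = u $ i" for i
  proof -
    have "lookup (lin_form u) (Poly_Mapping.single i 1) = (\<Sum>j\<in>UNIV. if j = i then u $ j else 0)"
      unfolding lin_form_def lookup_sum
      by (intro sum.cong)
        (auto simp: qconst_def qvar_def mult_single lookup_single when_def
              dest: arg_cong[where f = "\<lambda>m. lookup m i"])
    then show ?thesis by simp
  qed
  ultimately show "u = 0" by (simp add: vec_eq_iff)
qed (simp add: lin_form_hom)

lemma dvd_mult_diff: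
  fixes a b c d e :: "'a::comm_ring_1"
  assumes "e dvd a - b" "e dvd c - d"
  shows "e dvd a * c - b * d"
proof -
  have "a * c - b * d = (a - b) * c + b * (c - d)" by (simp add: algebra_simps)
  then show ?thesis using assms by simp
qed

text \<open>
  Congruence modulo \<open>e\<close> is compatible with the ring operations, so it is enough to compare variables.
\<close>

lemma qsubst_dvd_diff:
  assumes "\<And>i. i \<in> qvars p \<Longrightarrow> e dvd g i - g' i"
  shows "e dvd qsubst g p - qsubst g' p"
proof (induction p rule: qpoly_induct)
  case (add p q)
  then have "e dvd (qsubst g p - qsubst g' p) + (qsubst g q - qsubst g' q)" by (rule dvd_add)
  then show ?case by (simp add: algebra_simps)
qed (auto intro: dvd_mult_diff simp: assms)

lemma qsubst_qvar_id [simp]: "qsubst qvar p = p"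
  by (induction p rule: qpoly_induct) simp_all

lemma pairing_simps:
  "pairing (u + w) y = pairing u y + pairing w y" "pairing (u - w) y = pairing u y - pairing w y"
  "pairing (c *s u) y = c * pairing u y" "pairing 0 y = 0" "pairing u 0 = 0"
  "pairing u (y + z) = pairing u y + pairing u z" "pairing u (y - z) = pairing u y - pairing u z"
  "pairing u (c *s y) = c * pairing u y"
  by (simp_all add: pairing_def algebra_simps sum.distrib sum_subtractf sum_distrib_left)

lemma pairing_sum:
  "pairing (\<Sum>a\<in>A. f a) y = (\<Sum>a\<in>A. pairing (f a) y)"
  "pairing u (\<Sum>a\<in>A. f a) = (\<Sum>a\<in>A. pairing u (f a))"
  by (induction A rule: infinite_finite_induct) (simp_all add: pairing_simps)

text \<open>
  If \<open>pairing g e = 1\<close>, this extends the projection \<open>u \<mapsto> u - \<langle>u, e\<rangle> g\<close> of \<open>M\<^sub>\<rat>\<close>, whose kernel is spanned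
  by \<open>g\<close>; it is the quotient map modulo the linear form \<open>g\<close>, realized inside the same ring.
\<close>

definition reduce_along :: "rat ^ 'n \<Rightarrow> rat ^ 'n \<Rightarrow> 'n qpoly \<Rightarrow> 'n::finite qpoly" where
  "reduce_along g e = qsubst (\<lambda>j. qvar j - qconst (e $ j) * lin_form g)"

lemma reduce_along_lin_form: "reduce_along g e (lin_form u) = lin_form (u - pairing u e *s g)"
  by (simp add: reduce_along_def lin_form_def[of u] lin_form_hom pairing_def qconst_sum
      qconst_hom right_diff_distrib sum_subtractf sum_distrib_left sum_distrib_right mult_ac)

text \<open>
  Reduction changes each variable by a multiple of \<open>g\<close>, so a polynomial is congruent to its reduction.
\<close>

lemma dvd_iff_reduce_along:
  assumes "pairing g e = 1"
  shows "lin_form g dvd p \<longleftrightarrow> reduce_along g e p = 0"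
proof
  assume "lin_form g dvd p"
  then obtain q where "p = lin_form g * q" by (rule dvdE)
  then have "reduce_along g e p = reduce_along g e (lin_form g) * reduce_along g e q"
    by (simp add: reduce_along_def)
  then show "reduce_along g e p = 0"
    by (simp add: reduce_along_lin_form assms lin_form_hom)
next
  assume z: "reduce_along g e p = 0"
  have "lin_form g dvd qsubst qvar p - reduce_along g e p"
    unfolding reduce_along_def by (rule qsubst_dvd_diff) simp
  then show "lin_form g dvd p" using z by simp
qed

lemma exists_pairing_1:
  fixes g :: "rat ^ 'n::finite"
  assumes "g \<noteq> 0" obtains e where "pairing g e = 1"
proof -
  obtain j where j: "g $ j \<noteq> 0" using assms by (auto simp: vec_eq_iff)
  have "pairing g (\<chi> i. if i = j then 1 / g $ j else 0) = 1"
    using j by (simp add: pairing_def if_distrib cong: if_cong)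
  then show ?thesis by (rule that)
qed

text \<open>
  The multiples of the linear form are the kernel of a ring homomorphism into an integral domain.
\<close>

lemma prime_elem_lin_form:
  fixes g :: "rat ^ 'n::{finite,linorder}"
  assumes "g \<noteq> 0" shows "prime_elem (lin_form g)"
proof -
  obtain e where e: "pairing g e = 1" using exists_pairing_1[OF assms] .
  note d = dvd_iff_reduce_along[OF e]
  show ?thesis
    unfolding prime_elem_def
  proof (intro conjI allI impI)
    show "lin_form g \<noteq> 0" using assms by (simp add: lin_form_eq_0_iff)
    show "\<not> lin_form g dvd 1" by (simp add: d) (simp add: reduce_along_def)
    show "lin_form g dvd a \<or> lin_form g dvd b" if "lin_form g dvd a * b" for a b
    proof -
      have "reduce_along g e a * reduce_along g e b = 0"
        using that by (simp add: d reduce_along_def)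
      then show ?thesis by (simp add: d)
    qed
  qed
qed

lemma lin_form_dvd_lin_form:
  fixes g :: "rat ^ 'n::finite"
  assumes "g \<noteq> 0"
  shows "lin_form g dvd lin_form u \<longleftrightarrow> (\<exists>c. u = c *s g)"
proof
  obtain e where e: "pairing g e = 1" using exists_pairing_1[OF assms] .
  assume "lin_form g dvd lin_form u"
  then have "u = pairing u e *s g"
    by (simp add: dvd_iff_reduce_along[OF e] reduce_along_lin_form lin_form_eq_0_iff)
  then show "\<exists>c. u = c *s g" ..
qed (auto simp: lin_form_hom)

lemma to_fract_prod [simp]: "to_fract (\<Prod>a\<in>A. f a) = (\<Prod>a\<in>A. to_fract (f a))"
  by (induction A rule: infinite_finite_induct) simp_all

lemma to_fract_of_int [simp]: "to_fract (of_int c) = of_int c"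
proof -
  have "to_fract (of_nat m :: 'a) = of_nat m" for m by (induction m) simp_all
  then show ?thesis by (cases c) (simp_all del: of_nat_Suc)
qed

text \<open>
  Membership in the local ring at \<open>\<pi>\<close>: for prime \<open>\<pi>\<close>, the fraction has no pole along \<open>\<pi>\<close>.
\<close>

definition regular_at :: "'a::idom \<Rightarrow> 'a fract \<Rightarrow> bool" where
  "regular_at \<pi> f \<longleftrightarrow> (\<exists>a s. \<not> \<pi> dvd s \<and> f * to_fract s = to_fract a)"

lemma regular_at_divide:
  assumes "\<not> \<pi> dvd s" shows "regular_at \<pi> (to_fract a / to_fract s)"
  unfolding regular_at_def using assms by (intro exI[of _ a] exI[of _ s]) auto

lemma regular_at_to_fract:
  assumes "prime_elem \<pi>" shows "regular_at \<pi> (to_fract a)"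
  using regular_at_divide[of \<pi> 1 a] assms by (simp add: prime_elem_def)

lemma regular_at_add:
  assumes "prime_elem \<pi>" "regular_at \<pi> f" "regular_at \<pi> h"
  shows "regular_at \<pi> (f + h)"
proof -
  obtain a s b t where *: "\<not> \<pi> dvd s" "f * to_fract s = to_fract a"
    "\<not> \<pi> dvd t" "h * to_fract t = to_fract b"
    using assms(2,3) unfolding regular_at_def by blast
  have "(f + h) * to_fract (s * t) = (f * to_fract s) * to_fract t + (h * to_fract t) * to_fract s"
    by (simp add: algebra_simps)
  also have "\<dots> = to_fract (a * t + b * s)" by (simp add: *)
  finally show ?thesis
    unfolding regular_at_def using * prime_elem_dvd_mult_iff[OF assms(1)] by blast
qed

lemma regular_at_mult:
  assumes "prime_elem \<pi>" "regular_at \<pi> f" "regular_at \<pi> h"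
  shows "regular_at \<pi> (f * h)"
proof -
  obtain a s b t where *: "\<not> \<pi> dvd s" "f * to_fract s = to_fract a"
    "\<not> \<pi> dvd t" "h * to_fract t = to_fract b"
    using assms(2,3) unfolding regular_at_def by blast
  have "(f * h) * to_fract (s * t) = (f * to_fract s) * (h * to_fract t)"
    by (simp add: algebra_simps)
  also have "\<dots> = to_fract (a * b)" by (simp add: *)
  finally show ?thesis
    unfolding regular_at_def using * prime_elem_dvd_mult_iff[OF assms(1)] by blast
qed

lemma regular_at_sum:
  assumes "prime_elem \<pi>" "\<And>a. a \<in> A \<Longrightarrow> regular_at \<pi> (f a)"
  shows "regular_at \<pi> (\<Sum>a\<in>A. f a)"
  using assms(2) regular_at_to_fract[OF assms(1), of 0]
  by (induction A rule: infinite_finite_induct) (simp_all add: regular_at_add[OF assms(1)])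

text \<open>
  The factors of the denominator are cancelled one by one.  If \<open>f D = a\<close> where \<open>D\<close> is divisible by the
  prime \<open>\<pi>\<close>, and \<open>f s = b\<close> with \<open>s\<close> not divisible by \<open>\<pi>\<close>, then \<open>a s = b D\<close> shows that \<open>\<pi>\<close> divides \<open>a\<close>.
  The same prime may occur for several indices.
\<close>

lemma regular_at_all_imp_polynomial:
  assumes "finite G" "\<And>g. g \<in> G \<Longrightarrow> prime_elem (\<pi> g)" "\<And>g. g \<in> G \<Longrightarrow> regular_at (\<pi> g) f"
    and "f * to_fract (\<Prod>g\<in>G. \<pi> g) = to_fract a"
  shows "\<exists>b. f = to_fract b"
  using assms
proof (induction G arbitrary: a rule: finite_induct)
  case (insert g G)
  obtain b s where *: "\<not> \<pi> g dvd s" "f * to_fract s = to_fract b"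
    using insert.prems(2)[of g] unfolding regular_at_def by blast
  have p: "prime_elem (\<pi> g)" and z: "\<pi> g \<noteq> 0" using insert.prems(1)[of g] by auto
  have "to_fract (a * s) = (f * to_fract s) * to_fract (\<Prod>g\<in>insert g G. \<pi> g)"
    using insert.prems(3) by (simp add: mult_ac)
  also have "\<dots> = to_fract (\<pi> g * (b * (\<Prod>g\<in>G. \<pi> g)))"
    using insert.hyps by (simp add: * mult_ac)
  finally have "\<pi> g dvd a * s" by (simp only: to_fract_eq_iff) simp
  then have "\<pi> g dvd a" using * prime_elem_dvd_mult_iff[OF p] by blast
  then obtain c where c: "a = \<pi> g * c" by (rule dvdE)
  have "to_fract (\<pi> g) * (f * to_fract (\<Prod>g\<in>G. \<pi> g)) = to_fract (\<pi> g) * to_fract c"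
    using insert.prems(3) insert.hyps by (simp add: c mult_ac)
  then have "f * to_fract (\<Prod>g\<in>G. \<pi> g) = to_fract c" using z by simp
  then show ?case using insert.IH insert.prems by blast
qed simp

text \<open>
  All fractions \<open>a i / b i\<close> have the same value modulo \<open>\<pi>\<close>.  Subtracting one fixed fraction from each
  of them leaves multiples of \<open>\<pi>\<close>, and what was subtracted adds up to zero because the coefficients
  do.
\<close>

lemma regular_at_residue_cancel:
  fixes \<pi> :: "'a::idom" and c :: "'i \<Rightarrow> int"
  assumes p: "prime_elem \<pi>" and "finite A" and c: "(\<Sum>i\<in>A. c i) = 0"
    and a: "\<And>i j. i \<in> A \<Longrightarrow> j \<in> A \<Longrightarrow> \<pi> dvd a i - a j"
    and b: "\<And>i j. i \<in> A \<Longrightarrow> j \<in> A \<Longrightarrow> \<pi> dvd b i - b j"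
    and nb: "\<And>i. i \<in> A \<Longrightarrow> \<not> \<pi> dvd b i"
  shows "regular_at \<pi> (\<Sum>i\<in>A. of_int (c i) * (to_fract (a i) / to_fract (b i)) / to_fract \<pi>)"
proof (cases "A = {}")
  case True
  then show ?thesis using regular_at_to_fract[OF p, of 0] by simp
next
  case False
  then obtain z where z: "z \<in> A" by blast
  have nz: "to_fract \<pi> \<noteq> 0" using p by auto
  have "\<exists>e. a i * b z - a z * b i = \<pi> * e" if "i \<in> A" for i
  proof -
    have "\<pi> dvd a i * b z - a z * b i"
      using a[OF that z] b[OF z that] by (rule dvd_mult_diff)
    then show ?thesis by (auto elim: dvdE)
  qed
  then obtain e where e: "\<And>i. i \<in> A \<Longrightarrow> a i * b z - a z * b i = \<pi> * e i" by metis
  have bz: "to_fract (b i) \<noteq> 0" if "i \<in> A" for i using nb[OF that] by auto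
  have q: "of_int (c i) * (to_fract (a i) / to_fract (b i)) / to_fract \<pi> =
      of_int (c i) * (to_fract (a z) / to_fract (b z) / to_fract \<pi>) +
      to_fract (of_int (c i)) * (to_fract (e i) / to_fract (b i * b z))" if "i \<in> A" for i
  proof -
    have "to_fract (a i) * to_fract (b z) = to_fract \<pi> * to_fract (e i) + to_fract (a z) * to_fract (b i)"
      using arg_cong[OF e[OF that], of to_fract] by (simp add: algebra_simps)
    then have "to_fract (a i) / to_fract (b i) / to_fract \<pi> =
      to_fract (a z) / to_fract (b z) / to_fract \<pi> + to_fract (e i) / to_fract (b i * b z)"
      using nz bz[OF that] bz[OF z] by (simp add: field_simps)
    then show ?thesis
      by (metis (no_types, lifting) distrib_left times_divide_eq_right to_fract_of_int)
  qed
  \<comment> \<open>the summand splits into the fixed fraction and a regular remainder\<close>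
  let ?X = "to_fract (a z) / to_fract (b z) / to_fract \<pi>"
  let ?R = "\<lambda>i. to_fract (of_int (c i)) * (to_fract (e i) / to_fract (b i * b z))"
  have "(\<Sum>i\<in>A. of_int (c i) * (to_fract (a i) / to_fract (b i)) / to_fract \<pi>) =
      (\<Sum>i\<in>A. of_int (c i) * ?X + ?R i)"
    by (rule sum.cong[OF refl q])
  also have "\<dots> = of_int (\<Sum>i\<in>A. c i) * ?X + (\<Sum>i\<in>A. ?R i)"
    by (simp only: sum.distrib sum_distrib_right of_int_sum)
  also have "\<dots> = (\<Sum>i\<in>A. to_fract (of_int (c i)) * (to_fract (e i) / to_fract (b i * b z)))"
    by (simp only: c of_int_0 mult_zero_left add_0)
  also have "regular_at \<pi> \<dots>"
    using nb z prime_elem_dvd_mult_iff[OF p]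
    by (intro regular_at_sum[OF p] regular_at_mult[OF p] regular_at_to_fract[OF p] regular_at_divide) blast
  finally show ?thesis .
qed

section \<open>Lattices: index and bases\<close>

lemma int_subgroup_principal:
  fixes D :: "int set"
  assumes "0 \<in> D" and diff: "\<And>x y. x \<in> D \<Longrightarrow> y \<in> D \<Longrightarrow> x - y \<in> D"
  obtains d where "d \<in> D" "\<And>x. x \<in> D \<Longrightarrow> d dvd x"
proof (cases "D = {0}")
  case True
  then show ?thesis using that by simp
next
  case False
  have neg: "- x \<in> D" if "x \<in> D" for x using diff[OF assms(1) that] by simp
  have add: "x + y \<in> D" if "x \<in> D" "y \<in> D" for x y using diff[OF that(1) neg[OF that(2)]] by simp
  have mul: "k * x \<in> D" if "x \<in> D" for k x
  proof (induction k rule: int_induct[of _ 0])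
    case (step1 i)
    then show ?case using add[OF _ that] by (simp add: distrib_right)
  next
    case (step2 i)
    then show ?case using diff[OF _ that] by (simp add: left_diff_distrib)
  qed (simp add: assms)
  obtain x where "x \<in> D" "x \<noteq> 0" using False assms(1) by blast
  then have ex: "\<exists>m. m > 0 \<and> int m \<in> D"
    using neg[of x] by (intro exI[of _ "nat \<bar>x\<bar>"]) (auto simp: abs_if)
  define m where "m = (LEAST m. m > 0 \<and> int m \<in> D)"
  have m: "m > 0" "int m \<in> D" using LeastI_ex[OF ex] by (auto simp: m_def)
  have "int m dvd x" if "x \<in> D" for x
  proof (rule ccontr)
    assume "\<not> int m dvd x"
    then have "x mod int m \<noteq> 0" by (simp add: dvd_eq_mod_eq_0)
    moreover have "x mod int m \<in> D"
      using diff[OF that mul[OF m(2), of "x div int m"]] by (simp add: minus_div_mult_eq_mod)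
    moreover have "0 \<le> x mod int m" "x mod int m < int m" using m(1) by simp_all
    ultimately have "nat (x mod int m) > 0 \<and> int (nat (x mod int m)) \<in> D" "nat (x mod int m) < m"
      by auto
    then show False using not_less_Least[of "nat (x mod int m)" "\<lambda>m. m > 0 \<and> int m \<in> D"]
      unfolding m_def[symmetric] by blast
  qed
  then show ?thesis using that m(2) by blast
qed

lemma edge_sublattice_insert:
  assumes "finite K" "i \<notin> K"
  shows "edge_sublattice v (insert i K) = {x + k *s v i | x k. x \<in> edge_sublattice v K}"
proof (intro equalityI subsetI)
  fix y assume "y \<in> edge_sublattice v (insert i K)"
  then obtain c where "y = (\<Sum>j\<in>K. c j *s v j) + c i *s v i"
    using assms by (auto simp: edge_sublattice_def add.commute)
  then show "y \<in> {x + k *s v i | x k. x \<in> edge_sublattice v K}"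
    by (auto simp: edge_sublattice_def)
next
  fix y assume "y \<in> {x + k *s v i | x k. x \<in> edge_sublattice v K}"
  then obtain c k where y: "y = (\<Sum>j\<in>K. c j *s v j) + k *s v i"
    by (auto simp: edge_sublattice_def)
  have "(\<Sum>j\<in>K. (c(i := k)) j *s v j) = (\<Sum>j\<in>K. c j *s v j)"
    using assms by (intro sum.cong) auto
  then have "y = (\<Sum>j\<in>insert i K. (c(i := k)) j *s v j)"
    using y assms by (simp add: add.commute)
  then show "y \<in> edge_sublattice v (insert i K)" unfolding edge_sublattice_def by blast
qed

lemma edge_sublattice_subgroup:
  "0 \<in> edge_sublattice v K"
  "x \<in> edge_sublattice v K \<Longrightarrow> y \<in> edge_sublattice v K \<Longrightarrow> x - y \<in> edge_sublattice v K"
proof -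
  show "0 \<in> edge_sublattice v K"
    unfolding edge_sublattice_def by (intro CollectI exI[of _ "\<lambda>_. 0"]) simp
next
  assume "x \<in> edge_sublattice v K" "y \<in> edge_sublattice v K"
  then obtain c d where "x = (\<Sum>j\<in>K. c j *s v j)" "y = (\<Sum>j\<in>K. d j *s v j)"
    by (auto simp: edge_sublattice_def)
  then show "x - y \<in> edge_sublattice v K"
    unfolding edge_sublattice_def
    by (intro CollectI exI[of _ "\<lambda>j. c j - d j"]) (simp add: sum_subtractf vector_sub_rdistrib)
qed

lemma equiv_mod_edge_sublattice:
  "equiv A {(x, y). x \<in> A \<and> y \<in> A \<and> x - y \<in> edge_sublattice v K}" (is "equiv A ?R")
proof (rule equivI)
  have neg: "y - x \<in> edge_sublattice v K" if "x - y \<in> edge_sublattice v K" for x y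
    using edge_sublattice_subgroup(2)[OF edge_sublattice_subgroup(1) that] by simp
  show "sym ?R" by (auto simp: sym_def neg)
  show "trans ?R"
  proof (rule transI, clarify)
    fix x y z assume "x - y \<in> edge_sublattice v K" "y - z \<in> edge_sublattice v K"
    then have "(x - y) - (z - y) \<in> edge_sublattice v K"
      using edge_sublattice_subgroup(2) neg by blast
    then show "x - z \<in> edge_sublattice v K" by simp
  qed
qed (auto simp: refl_on_def edge_sublattice_subgroup)

text \<open>
  A class modulo the larger lattice is determined by the value \<open>f y\<close> modulo \<open>f (v i)\<close> and by the class,
  modulo the smaller lattice, of \<open>y\<close> moved into the kernel of \<open>f\<close> by multiples of \<open>v i\<close> and \<open>e\<close>.  The
  formula also holds when the quotient of the kernel is infinite, both sides being \<open>0\<close> then.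
\<close>

lemma card_quotient_edge_sublattice_insert:
  fixes v :: "'v \<Rightarrow> int ^ 'n::finite" and f :: "int ^ 'n \<Rightarrow> int"
  assumes K: "finite K" "i \<notin> K"
    and f_diff: "\<And>x y. f (x - y) = f x - f y" and f_scale: "\<And>k x. f (k *s x) = k * f x"
    and fK: "\<And>j. j \<in> K \<Longrightarrow> f (v j) = 0" and fi: "f (v i) \<noteq> 0" and e: "f e = 1"
  shows "card (UNIV // {(x, y). x \<in> UNIV \<and> y \<in> UNIV \<and> x - y \<in> edge_sublattice v (insert i K)}) =
    card ({x. f x = 0} // {(x, y). x \<in> {x. f x = 0} \<and> y \<in> {x. f x = 0} \<and> x - y \<in> edge_sublattice v K})
      * nat \<bar>f (v i)\<bar>" (is "card (UNIV // ?R) = card (?N // ?S) * _")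
proof -
  let ?L = "edge_sublattice v K" and ?L' = "edge_sublattice v (insert i K)"
  let ?c = "\<bar>f (v i)\<bar>"
  have f0: "f 0 = 0" using f_diff[of 0 0] by simp
  have f_add: "f (x + y) = f x + f y" for x y
    using f_diff[of x "0 - y"] f_diff[of 0 y] f0 by simp
  have fL: "f x = 0" if "x \<in> ?L" for x
  proof -
    obtain c where "x = (\<Sum>j\<in>K. c j *s v j)" using \<open>x \<in> ?L\<close> by (auto simp: edge_sublattice_def)
    moreover have "f (\<Sum>j\<in>T. c j *s v j) = 0" if "T \<subseteq> K" for T
      using finite_subset[OF that K(1)] that
      by (induction T rule: finite_induct) (auto simp: f0 f_add f_scale fK)
    ultimately show ?thesis by blast
  qed
  have L': "x \<in> ?L' \<longleftrightarrow> (\<exists>k. x - k *s v i \<in> ?L)" for x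
  proof
    assume "x \<in> ?L'"
    then obtain y k where "x = y + k *s v i" "y \<in> ?L"
      unfolding edge_sublattice_insert[OF K] by blast
    then show "\<exists>k. x - k *s v i \<in> ?L" by (intro exI[of _ k]) simp
  next
    assume "\<exists>k. x - k *s v i \<in> ?L"
    then obtain k where "x - k *s v i \<in> ?L" ..
    moreover have "x = (x - k *s v i) + k *s v i" by simp
    ultimately show "x \<in> ?L'" unfolding edge_sublattice_insert[OF K] by blast
  qed
  have eqR: "equiv UNIV ?R" by (rule equiv_mod_edge_sublattice)
  have sR: "sym ?R" using eqR by (rule equivE)
  have eqS: "equiv ?N ?S" by (rule equiv_mod_edge_sublattice)
  define \<phi> where "\<phi> = (\<lambda>(C, s). ?R `` ((\<lambda>z. z + s *s e) ` C))"
  have \<phi>: "\<phi> (?S `` {z}, s) = ?R `` {z + s *s e}" if z: "z \<in> ?N" for z s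
  proof -
    have "?R `` {z' + s *s e} = ?R `` {z + s *s e}" if "z' \<in> ?S `` {z}" for z'
    proof (rule equiv_class_eq[OF eqR])
      have "z - z' \<in> ?L" using that by auto
      then have "(z + s *s e) - (z' + s *s e) \<in> ?L'" unfolding L' by (intro exI[of _ 0]) simp
      then have "(z + s *s e, z' + s *s e) \<in> ?R" by simp
      then show "(z' + s *s e, z + s *s e) \<in> ?R" by (rule symD[OF sR])
    qed
    moreover have "z \<in> ?S `` {z}" using z by (simp add: edge_sublattice_subgroup)
    ultimately show ?thesis unfolding \<phi>_def by blast
  qed
  have "bij_betw \<phi> ((?N // ?S) \<times> {0..<?c}) (UNIV // ?R)"
  proof (rule bij_betwI')
    fix P Q assume P: "P \<in> (?N // ?S) \<times> {0..<?c}" and Q: "Q \<in> (?N // ?S) \<times> {0..<?c}"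
    obtain z s where P': "P = (?S `` {z}, s)" "f z = 0" "0 \<le> s" "s < ?c"
      using P by (auto elim!: quotientE)
    obtain z' s' where Q': "Q = (?S `` {z'}, s')" "f z' = 0" "0 \<le> s'" "s' < ?c"
      using Q by (auto elim!: quotientE)
    show "(\<phi> P = \<phi> Q) = (P = Q)"
    proof
      assume "\<phi> P = \<phi> Q"
      then have "?R `` {z + s *s e} = ?R `` {z' + s' *s e}" using \<phi> P' Q' by simp
      then have "(z + s *s e, z' + s' *s e) \<in> ?R" using eq_equiv_class[OF _ eqR] by blast
      then obtain k where k: "(z + s *s e) - (z' + s' *s e) - k *s v i \<in> ?L" using L' by auto
      have "f ((z + s *s e) - (z' + s' *s e) - k *s v i) = 0" using fL[OF k] .
      then have s: "s - s' = k * f (v i)" using P' Q' e by (simp add: f_diff f_add f_scale)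
      then have "f (v i) dvd s - s'" by simp
      then have "s = s'" using P'(3,4) Q'(3,4) zdvd_imp_le[of ?c "\<bar>s - s'\<bar>"] by force
      then have "k = 0" using s fi by simp
      then have "z - z' \<in> ?L" using k \<open>s = s'\<close> by simp
      then have "?S `` {z} = ?S `` {z'}" using P' Q' by (intro equiv_class_eq[OF eqS]) auto
      then show "P = Q" using P' Q' \<open>s = s'\<close> by simp
    qed simp
  next
    fix P assume "P \<in> (?N // ?S) \<times> {0..<?c}"
    then obtain z s where P': "P = (?S `` {z}, s)" "f z = 0" by (auto elim!: quotientE)
    then have "\<phi> P = ?R `` {z + s *s e}" using \<phi>[of z s] by simp
    then show "\<phi> P \<in> UNIV // ?R" using quotientI[of "z + s *s e" UNIV ?R] by simp
  next
    fix C assume "C \<in> UNIV // ?R"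
    then obtain y where y: "C = ?R `` {y}" by (auto elim!: quotientE)
    define s where "s = f y mod ?c"
    obtain q where q: "f y = q * f (v i) + s"
    proof -
      have "f y = f y div ?c * ?c + s" by (simp add: s_def)
      also have "f y div ?c * ?c = (f y div ?c * sgn (f (v i))) * f (v i)"
        by (simp add: abs_sgn[of "f (v i)"] mult_ac del: sgn_mult_self_eq)
      finally show ?thesis by (rule that)
    qed
    define z where "z = y - q *s v i - s *s e"
    have z: "z \<in> ?N" using q by (simp add: z_def f_diff f_scale e)
    have s: "s \<in> {0..<?c}" using fi by (simp add: s_def)
    have "y - (z + s *s e) \<in> ?L'"
      unfolding L' by (intro exI[of _ q]) (simp add: z_def edge_sublattice_subgroup)
    then have "C = ?R `` {z + s *s e}" unfolding y by (intro equiv_class_eq[OF eqR]) auto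
    then have "C = \<phi> (?S `` {z}, s)" using \<phi>[OF z] by simp
    moreover have "(?S `` {z}, s) \<in> (?N // ?S) \<times> {0..<?c}"
      using quotientI[OF z, of ?S] s by (intro SigmaI)
    ultimately show "\<exists>P\<in>(?N // ?S) \<times> {0..<?c}. C = \<phi> P" by blast
  qed
  then have "card ((?N // ?S) \<times> {0..<?c}) = card (UNIV // ?R)" by (rule bij_betw_same_card)
  then show ?thesis by (simp add: card_cartesian_product)
qed

subsection \<open>Bases\<close>

lemma subgroup_int_scale:
  fixes L :: "(int ^ 'n) set"
  assumes "0 \<in> L" and diff: "\<And>x y. x \<in> L \<Longrightarrow> y \<in> L \<Longrightarrow> x - y \<in> L" and "x \<in> L"
  shows "k *s x \<in> L"
proof (induction k rule: int_induct[of _ 0])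
  case (step1 i)
  have "i *s x - (0 - x) \<in> L" using step1 assms by blast
  then show ?case by (simp add: vector_sadd_rdistrib)
next
  case (step2 i)
  then show ?case using diff[OF _ assms(3)] by (simp add: vector_sub_rdistrib)
qed (simp add: assms)

lemma subgroup_int_sum:
  fixes L :: "(int ^ 'n) set"
  assumes "0 \<in> L" and diff: "\<And>x y. x \<in> L \<Longrightarrow> y \<in> L \<Longrightarrow> x - y \<in> L" and "\<And>a. a \<in> A \<Longrightarrow> f a \<in> L"
  shows "(\<Sum>a\<in>A. f a) \<in> L"
  using assms(3)
proof (induction A rule: infinite_finite_induct)
  case (insert a A)
  then have "f a - (0 - (\<Sum>a\<in>A. f a)) \<in> L" using assms(1) diff by blast
  then show ?case using insert by simp
qed (simp_all add: assms)

lemma lattice_basisI: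
  assumes span: "L = {\<Sum>a<length us. c a *s us ! a | c. True}"
    and ind: "\<And>c. (\<Sum>a<length us. c a *s us ! a) = 0 \<Longrightarrow> \<forall>a<length us. c a = 0"
  shows "lattice_basis us L"
  unfolding lattice_basis_def
proof (rule bij_betwI')
  let ?n = "length us"
  fix c d :: "nat \<Rightarrow> int"
  assume c: "c \<in> {..<?n} \<rightarrow>\<^sub>E UNIV" and d: "d \<in> {..<?n} \<rightarrow>\<^sub>E UNIV"
  show "((\<Sum>a<?n. c a *s us ! a) = (\<Sum>a<?n. d a *s us ! a)) = (c = d)"
  proof
    assume "(\<Sum>a<?n. c a *s us ! a) = (\<Sum>a<?n. d a *s us ! a)"
    then have "(\<Sum>a<?n. (c a - d a) *s us ! a) = 0"
      by (simp add: vector_sub_rdistrib sum_subtractf)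
    then have "\<forall>a<?n. c a = d a" using ind[of "\<lambda>a. c a - d a"] by simp
    then show "c = d" using c d by (intro PiE_ext) auto
  qed simp
next
  fix x assume "x \<in> L"
  then obtain c where x: "x = (\<Sum>a<length us. c a *s us ! a)" unfolding span by blast
  show "\<exists>c\<in>{..<length us} \<rightarrow>\<^sub>E UNIV. x = (\<Sum>a<length us. c a *s us ! a)"
    by (rule bexI[of _ "restrict c {..<length us}"]) (auto simp: x)
qed (auto simp: span)

lemma lattice_basisD:
  assumes "lattice_basis us L"
  shows "x \<in> L \<Longrightarrow> \<exists>c. x = (\<Sum>a<length us. c a *s us ! a)"
    and "a < length us \<Longrightarrow> us ! a \<in> L"
    and "(\<Sum>a<length us. c a *s us ! a) = 0 \<Longrightarrow> a < length us \<Longrightarrow> c a = 0"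
proof -
  let ?n = "length us" and ?f = "\<lambda>c :: nat \<Rightarrow> int. \<Sum>a<length us. c a *s us ! a"
  have b: "bij_betw ?f ({..<?n} \<rightarrow>\<^sub>E UNIV) L" using assms by (simp add: lattice_basis_def)
  show "x \<in> L \<Longrightarrow> \<exists>c. x = ?f c" using b by (auto simp: bij_betw_def)
  have r: "?f (restrict c {..<?n}) = ?f c" for c by simp
  have m: "?f g \<in> L" if "g \<in> {..<?n} \<rightarrow>\<^sub>E UNIV" for g using bij_betw_apply[OF b that] .
  show "us ! a \<in> L" if "a < ?n"
  proof -
    have "?f (restrict (\<lambda>b. if b = a then 1 else 0) {..<?n}) = (\<Sum>b<?n. if b = a then us ! b else 0)"
      unfolding r by (intro sum.cong) auto
    also have "\<dots> = us ! a" using that by simp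
    finally show ?thesis using m[of "restrict (\<lambda>b. if b = a then 1 else 0) {..<?n}"]
      by (simp only: restrict_PiE_iff) simp
  qed
  show "c a = 0" if "?f c = 0" "a < ?n"
  proof -
    have "?f (restrict c {..<?n}) = ?f (restrict (\<lambda>_. 0) {..<?n})" unfolding r using that by simp
    then have "restrict c {..<?n} = restrict (\<lambda>_. 0) {..<?n}"
      by (rule inj_onD[OF bij_betw_imp_inj_on[OF b]]) (simp_all only: restrict_PiE_iff, simp_all)
    then show ?thesis using that(2) by (metis lessThan_iff restrict_apply')
  qed
qed

text \<open>
  Induction on the set of coordinates that may be nonzero.  If the \<open>t\<close>-th coordinate of \<open>x0\<close> generates
  the group of all \<open>t\<close>-th coordinates, then \<open>x0\<close> together with a basis of the subgroup \<open>x\<^sub>t = 0\<close> is a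
  basis.
\<close>

lemma lattice_basis_exists:
  fixes L :: "(int ^ 'n::finite) set"
  assumes "0 \<in> L" and "\<And>x y. x \<in> L \<Longrightarrow> y \<in> L \<Longrightarrow> x - y \<in> L"
  shows "\<exists>us. lattice_basis us L"
proof -
  let ?B = "\<lambda>us L. L = {\<Sum>a<length us. c a *s us ! a | c. True} \<and>
    (\<forall>c. (\<Sum>a<length us. c a *s us ! a) = 0 \<longrightarrow> (\<forall>a<length us. c a = 0))"
  have "\<exists>us. ?B us L"
    if "finite T" "0 \<in> L" "\<And>x y. x \<in> L \<Longrightarrow> y \<in> L \<Longrightarrow> x - y \<in> L" "\<And>x i. x \<in> L \<Longrightarrow> i \<notin> T \<Longrightarrow> x $ i = 0"
    for T :: "'n set" and L :: "(int ^ 'n) set"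
    using that
  proof (induction T arbitrary: L rule: finite_induct)
    case empty
    then have "L = {0}" by (auto simp: vec_eq_iff)
    then show ?case by (intro exI[of _ "[]"]) simp
  next
    case (insert t T)
    note L0 = insert.prems(1) and Ld = insert.prems(2)
    have "0 \<in> (\<lambda>x. x $ t) ` L" using L0 by force
    moreover have "x - y \<in> (\<lambda>x. x $ t) ` L" if "x \<in> (\<lambda>x. x $ t) ` L" "y \<in> (\<lambda>x. x $ t) ` L" for x y
      using that Ld by (force simp: image_iff)
    ultimately obtain d where "d \<in> (\<lambda>x. x $ t) ` L" and dd: "\<And>x. x \<in> (\<lambda>x. x $ t) ` L \<Longrightarrow> d dvd x"
      using int_subgroup_principal by metis
    then obtain x0 where x0: "x0 \<in> L" "x0 $ t = d" by blast
    define L' where "L' = {x \<in> L. x $ t = 0}"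
    have "\<exists>us. ?B us L'"
    proof (rule insert.IH)
      show "x $ i = 0" if "x \<in> L'" "i \<notin> T" for x :: "int ^ 'n" and i
        using that insert.prems(3)[of x i] by (cases "i = t") (auto simp: L'_def)
    qed (use insert.prems in \<open>auto simp: L'_def\<close>)
    then obtain us where us: "L' = {\<Sum>a<length us. c a *s us ! a | c. True}"
      and ind: "\<And>c. (\<Sum>a<length us. c a *s us ! a) = 0 \<Longrightarrow> \<forall>a<length us. c a = 0" by blast
    show ?case
    proof (cases "d = 0")
      case True
      then have "L' = L" using dd by (auto simp: L'_def)
      then show ?thesis using \<open>\<exists>us. ?B us L'\<close> by simp
    next
      case False
      have S: "(\<Sum>a<length (x0 # us). c a *s (x0 # us) ! a) = c 0 *s x0 + (\<Sum>a<length us. c (Suc a) *s us ! a)" for c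
        by (simp add: sum.lessThan_Suc_shift del: sum.lessThan_Suc)
      have coord: "(\<Sum>a<length us. c a *s us ! a) $ t = 0" for c
        using us unfolding L'_def by blast
      have "L = {\<Sum>a<length (x0 # us). c a *s (x0 # us) ! a | c. True}"
      proof (intro equalityI subsetI)
        fix x assume x: "x \<in> L"
        then obtain k where k: "x $ t = d * k" using dd by (force elim: dvdE)
        have "x - k *s x0 \<in> L'"
          using x x0 k Ld subgroup_int_scale[OF L0 Ld x0(1)] by (simp add: L'_def)
        then obtain c where "x - k *s x0 = (\<Sum>a<length us. c a *s us ! a)" unfolding us by blast
        then have "x = k *s x0 + (\<Sum>a<length us. c a *s us ! a)" by (simp add: algebra_simps)
        then have "x = (\<Sum>a<length (x0 # us). (case_nat k c) a *s (x0 # us) ! a)" unfolding S by simp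
        then show "x \<in> {\<Sum>a<length (x0 # us). c a *s (x0 # us) ! a | c. True}" by blast
      next
        fix x assume "x \<in> {\<Sum>a<length (x0 # us). c a *s (x0 # us) ! a | c. True}"
        then obtain c where x: "x = c 0 *s x0 + (\<Sum>a<length us. c (Suc a) *s us ! a)"
          unfolding S by blast
        have "(\<Sum>a<length us. c (Suc a) *s us ! a) \<in> L'"
          unfolding us by (intro CollectI exI[of _ "\<lambda>a. c (Suc a)"]) simp
        then have s: "(\<Sum>a<length us. c (Suc a) *s us ! a) \<in> L" by (simp add: L'_def)
        have "c 0 *s x0 - (0 - (\<Sum>a<length us. c (Suc a) *s us ! a)) \<in> L"
          by (intro Ld L0 s subgroup_int_scale[OF L0 Ld x0(1)])
        then show "x \<in> L" by (simp add: x)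
      qed
      moreover have "\<forall>a<length (x0 # us). c a = 0"
        if "(\<Sum>a<length (x0 # us). c a *s (x0 # us) ! a) = 0" for c
      proof -
        have z: "c 0 *s x0 + (\<Sum>a<length us. c (Suc a) *s us ! a) = 0" using that unfolding S .
        then have "(c 0 *s x0 + (\<Sum>a<length us. c (Suc a) *s us ! a)) $ t = 0" by simp
        then have c0: "c 0 = 0" using x0 False coord[of "\<lambda>a. c (Suc a)"] by simp
        then have "\<forall>a<length us. c (Suc a) = 0" using z ind[of "\<lambda>a. c (Suc a)"] by simp
        then show ?thesis using c0 by (auto simp: less_Suc_eq_0_disj)
      qed
      ultimately show ?thesis by blast
    qed
  qed
  from this[of UNIV L] obtain us where "?B us L" using assms by auto
  then show ?thesis using lattice_basisI by blast
qed

section \<open>Geometry of the cones\<close>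

lemma span_convex_cone:
  assumes C: "convex_cone C" and "x \<in> span C"
  obtains a b where "a \<in> C" "b \<in> C" "x = a - b"
proof -
  let ?D = "{a - b | a b. a \<in> C \<and> b \<in> C}"
  have 0: "0 \<in> C" using convex_cone_contains_0[OF C] .
  have "subspace ?D"
  proof (rule subspaceI)
    show "0 \<in> ?D" using 0 by force
  next
    fix x y assume "x \<in> ?D" "y \<in> ?D"
    then obtain a b a' b' where *: "x = a - b" "y = a' - b'" "a \<in> C" "b \<in> C" "a' \<in> C" "b' \<in> C" by blast
    have "x + y = (a + a') - (b + b')" using * by simp
    then show "x + y \<in> ?D" using * convex_cone_add[OF C] by blast
  next
    fix c and x assume "x \<in> ?D"
    then obtain a b where *: "x = a - b" "a \<in> C" "b \<in> C" by blast
    show "c *\<^sub>R x \<in> ?D"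
    proof (cases "c \<ge> 0")
      case True
      have "c *\<^sub>R x = c *\<^sub>R a - c *\<^sub>R b" using * by (simp add: scaleR_diff_right)
      then show ?thesis using * True convex_cone_scaleR[OF C] by blast
    next
      case False
      have "c *\<^sub>R x = (- c) *\<^sub>R b - (- c) *\<^sub>R a" using * by (simp add: scaleR_diff_right)
      then show ?thesis using * False convex_cone_scaleR[OF C, of "- c" a] convex_cone_scaleR[OF C, of "- c" b] by auto
    qed
  qed
  moreover have "C \<subseteq> ?D" using 0 by force
  ultimately have "span C \<subseteq> ?D" by (rule span_minimal[rotated])
  then show ?thesis using assms(2) that by blast
qed

lemma of_int_vec_hom:
  "of_int_vec 0 = 0" "of_int_vec (x + y) = of_int_vec x + of_int_vec y"
  "of_int_vec (x - y) = of_int_vec x - of_int_vec y" "of_int_vec (k *s x) = of_int k *s of_int_vec x"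
  by (simp_all add: of_int_vec_def vec_eq_iff)

lemma of_int_vec_sum: "of_int_vec (\<Sum>a\<in>A. f a) = (\<Sum>a\<in>A. of_int_vec (f a))"
  by (induction A rule: infinite_finite_induct) (simp_all add: of_int_vec_hom)

lemma of_int_vec_eq_iff [simp]:
  "(of_int_vec x :: 'a::ring_char_0 ^ 'n) = of_int_vec y \<longleftrightarrow> x = y"
  by (simp add: of_int_vec_def vec_eq_iff)

lemma pairing_of_int_vec: "pairing (of_int_vec u) (of_int_vec y) = of_int (pairing u y)"
  by (simp add: pairing_def of_int_vec_def)

lemma det_of_int_vec: "det (\<chi> a. of_int_vec (A a)) = of_int (det (\<chi> a. A a))"
  by (simp add: det_def of_int_vec_def)

lemma pairing_eq_inner: "pairing u y = u \<bullet> (y :: real ^ 'n)"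
  by (simp add: pairing_def inner_vec_def)

lemma common_denominator:
  fixes f :: "'a \<Rightarrow> rat"
  assumes "finite A"
  obtains m :: int where "m > 0" "\<And>a. a \<in> A \<Longrightarrow> \<exists>k::int. of_int m * f a = of_int k"
proof -
  have "\<exists>m::int. m > 0 \<and> (\<forall>a\<in>A. \<exists>k::int. of_int m * f a = of_int k)"
    using assms
  proof (induction A rule: finite_induct)
    case empty
    show ?case by (intro exI[of _ 1]) simp
  next
    case (insert a A)
    then obtain m where m: "m > 0" "\<forall>a\<in>A. \<exists>k::int. of_int m * f a = of_int k" by blast
    obtain p q where pq: "f a = of_int p / of_int q" "q > 0"
      by (metis prod.exhaust quotient_of_denom_pos quotient_of_div)
    have "\<exists>k::int. of_int (m * q) * f b = of_int k" if "b \<in> insert a A" for b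
    proof (cases "b = a")
      case True
      then show ?thesis using pq by (intro exI[of _ "m * p"]) simp
    next
      case False
      then have "b \<in> A" using that by simp
      then obtain k :: int where "of_int m * f b = of_int k" using bspec[OF m(2)] by blast
      then show ?thesis by (intro exI[of _ "q * k"]) (simp add: mult_ac)
    qed
    then show ?case using m pq by (intro exI[of _ "m * q"]) auto
  qed
  then show ?thesis using that by blast
qed

locale multi_fan_with_edges =
  fixes \<Delta> :: "('v, 'n::{finite,linorder}) multi_fan_data" and v :: "'v \<Rightarrow> (int, 'n) vec"
  assumes fan: "simplicial_multi_fan \<Delta>" and edges: "edge_vectors \<Delta> v"
begin

abbreviation "top_simplices \<equiv> simplices_card \<Delta> CARD('n)"
abbreviation edge :: "'v \<Rightarrow> (real, 'n) vec" where "edge i \<equiv> of_int_vec (v i)"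

lemma finite_simplices: "finite (simplices \<Delta>)"
  and simplex_finite: "J \<in> simplices \<Delta> \<Longrightarrow> finite J"
  and simplex_subset: "J \<in> simplices \<Delta> \<Longrightarrow> J' \<subseteq> J \<Longrightarrow> J' \<in> simplices \<Delta>"
  and simplex_in_top: "J \<in> simplices \<Delta> \<Longrightarrow> \<exists>I\<in>top_simplices. J \<subseteq> I"
  and dim_cone: "J \<in> simplices \<Delta> \<Longrightarrow> dim (cone_of \<Delta> J) = card J"
  and cone_face: "J \<in> simplices \<Delta> \<Longrightarrow> J' \<subseteq> J \<Longrightarrow> cone_of \<Delta> J' face_of cone_of \<Delta> J"
  and cone_subset_iff: "J \<in> simplices \<Delta> \<Longrightarrow> A \<subseteq> J \<Longrightarrow> B \<subseteq> J \<Longrightarrow> cone_of \<Delta> A \<subseteq> cone_of \<Delta> B \<longleftrightarrow> A \<subseteq> B"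
  and cone_pointed: "J \<in> simplices \<Delta> \<Longrightarrow> x \<in> cone_of \<Delta> J \<Longrightarrow> - x \<in> cone_of \<Delta> J \<Longrightarrow> x = 0"
proof -
  note f = fan[unfolded simplicial_multi_fan_def]
  show "finite (simplices \<Delta>)" using f by simp
  show "finite J" "J' \<subseteq> J \<Longrightarrow> J' \<in> simplices \<Delta>"
    "\<exists>I\<in>top_simplices. J \<subseteq> I" "dim (cone_of \<Delta> J) = card J"
    if "J \<in> simplices \<Delta>" using f that by simp_all
  show "J' \<subseteq> J \<Longrightarrow> cone_of \<Delta> J' face_of cone_of \<Delta> J" if "J \<in> simplices \<Delta>"
    using f that by (simp add: cone_faces_def)
  show "A \<subseteq> J \<Longrightarrow> B \<subseteq> J \<Longrightarrow> cone_of \<Delta> A \<subseteq> cone_of \<Delta> B \<longleftrightarrow> A \<subseteq> B" if "J \<in> simplices \<Delta>"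
    using f that by simp
  show "x \<in> cone_of \<Delta> J \<Longrightarrow> - x \<in> cone_of \<Delta> J \<Longrightarrow> x = 0" if "J \<in> simplices \<Delta>"
    using f that by (simp add: strongly_convex_def)
qed

lemma top_simplexD: "I \<in> top_simplices \<Longrightarrow> I \<in> simplices \<Delta>" "I \<in> top_simplices \<Longrightarrow> card I = CARD('n)"
  by (simp_all add: simplices_card_def)

lemma simplex_vertices: "J \<in> simplices \<Delta> \<Longrightarrow> J \<subseteq> vertices \<Delta>"
  using simplex_subset by (auto simp: vertices_def)

lemma finite_vertices: "finite (vertices \<Delta>)"
proof -
  have "vertices \<Delta> \<subseteq> \<Union> (simplices \<Delta>)" by (auto simp: vertices_def)
  then show ?thesis using finite_simplices simplex_finite by (meson finite_Union finite_subset)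
qed

lemma convex_cone_cone: "J \<in> simplices \<Delta> \<Longrightarrow> convex_cone (cone_of \<Delta> J)"
  using fan convex_cone_convex_cone_hull unfolding simplicial_multi_fan_def rational_cone_def by metis

lemma cone_mono: "J \<in> simplices \<Delta> \<Longrightarrow> J' \<subseteq> J \<Longrightarrow> cone_of \<Delta> J' \<subseteq> cone_of \<Delta> J"
  using cone_face face_of_imp_subset by blast

lemma edge_in_cone: "J \<in> simplices \<Delta> \<Longrightarrow> i \<in> J \<Longrightarrow> edge i \<in> cone_of \<Delta> J"
  using edges simplex_vertices cone_mono[of J "{i}"] unfolding edge_vectors_def by blast

lemma edge_nonzero: "i \<in> vertices \<Delta> \<Longrightarrow> v i \<noteq> 0"
  using edges by (simp add: edge_vectors_def)

text \<open>The midpoint of \<open>x\<close> and \<open>y\<close> lies in the face.\<close>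

lemma face_summand:
  assumes J: "J \<in> simplices \<Delta>" "J' \<subseteq> J" and x: "x \<in> cone_of \<Delta> J" and y: "y \<in> cone_of \<Delta> J"
    and xy: "x + y \<in> cone_of \<Delta> J'"
  shows "x \<in> cone_of \<Delta> J'"
proof -
  have h: "(1/2) *\<^sub>R (x + y) \<in> cone_of \<Delta> J'"
    using convex_cone_scaleR[OF convex_cone_cone[OF simplex_subset[OF J]] _ xy] by simp
  show ?thesis
  proof (cases "x = y")
    case True
    then have "(1/2) *\<^sub>R (x + y) = x" by (simp add: scaleR_2[symmetric])
    then show ?thesis using h by simp
  next
    case False
    have "(1/2) *\<^sub>R (x + y) \<in> open_segment x y"
      unfolding in_segment using False by (intro conjI exI[of _ "1/2"]) (auto simp: scaleR_add_right)
    then show ?thesis using face_ofD[OF cone_face[OF J] _ x y h] by blast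
  qed
qed

text \<open>
  If \<open>edge i\<close> were the difference of two points of \<open>C(J)\<close>, the face property would put \<open>edge i\<close>, and with
  it the ray \<open>C({i})\<close>, into \<open>C(J)\<close>; but inclusions of cones come from inclusions of simplices.
\<close>

lemma edge_notin_span_cone:
  assumes I: "insert i J \<in> simplices \<Delta>" and "i \<notin> J"
  shows "edge i \<notin> span (cone_of \<Delta> J)"
proof
  have J: "J \<in> simplices \<Delta>" using simplex_subset[OF I] by blast
  have i: "{i} \<in> simplices \<Delta>" using simplex_subset[OF I] by blast
  assume "edge i \<in> span (cone_of \<Delta> J)"
  then obtain a b where ab: "a \<in> cone_of \<Delta> J" "b \<in> cone_of \<Delta> J" "edge i = a - b"
    using span_convex_cone[OF convex_cone_cone[OF J]] by blast
  have "edge i \<in> cone_of \<Delta> J"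
  proof (rule face_summand[OF I])
    show "b \<in> cone_of \<Delta> (insert i J)" using ab cone_mono[OF I, of J] by blast
    show "edge i + b \<in> cone_of \<Delta> J" using ab by simp
  qed (use edge_in_cone[OF I] in auto)
  moreover have "\<exists>t. t \<ge> 0 \<and> x = t *\<^sub>R edge i" if x: "x \<in> cone_of \<Delta> {i}" for x
  proof -
    have e: "edge i \<in> cone_of \<Delta> {i}" using edge_in_cone[OF i] by simp
    have nz: "edge i \<noteq> 0" using edge_nonzero[of i] i of_int_vec_eq_iff[of "v i" 0]
      unfolding of_int_vec_hom by (simp add: vertices_def)
    have "cone_of \<Delta> {i} \<subseteq> span {edge i}"
      using card_eq_dim[of "{edge i}" "cone_of \<Delta> {i}"] dim_cone[OF i] e nz by simp
    then obtain t where t: "x = t *\<^sub>R edge i" using x by (auto simp: span_singleton)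
    have "t \<ge> 0"
    proof (rule ccontr)
      assume neg: "\<not> t \<ge> 0"
      have "(- t) *\<^sub>R edge i \<in> cone_of \<Delta> {i}"
        using convex_cone_scaleR[OF convex_cone_cone[OF i], of "- t", OF _ e] neg by simp
      then have "x = 0" using cone_pointed[OF i x] t by simp
      then show False using t nz neg by simp
    qed
    then show ?thesis using t by blast
  qed
  ultimately have "x \<in> cone_of \<Delta> J" if "x \<in> cone_of \<Delta> {i}" for x
    using convex_cone_scaleR[OF convex_cone_cone[OF J]] that by metis
  then have "cone_of \<Delta> {i} \<subseteq> cone_of \<Delta> J" ..
  then have "{i} \<subseteq> J" using cone_subset_iff[OF I, of "{i}" J] by auto
  then show False using assms by simp
qed

text \<open>
  Vertices are added one at a time.  Independence is preserved by \<open>edge_notin_span_cone\<close>, and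
  independent vectors in \<open>C(J)\<close> span because \<open>C(J)\<close> has dimension \<open>card J\<close>.
\<close>

lemma edges_basis_of_cone:
  assumes "J \<in> simplices \<Delta>"
  shows "inj_on edge J \<and> independent (edge ` J) \<and> span (edge ` J) = span (cone_of \<Delta> J)"
proof -
  have "finite J" using assms simplex_finite by blast
  then show ?thesis using assms
  proof (induction J rule: finite_induct)
    case empty
    then have "cone_of \<Delta> {} \<subseteq> {0}" using dim_cone by (metis card.empty dim_eq_0)
    then have "span (cone_of \<Delta> {}) \<subseteq> {0}" using span_mono[of "cone_of \<Delta> {}" "{0}"] by simp
    then have "span (cone_of \<Delta> {}) = {0}" using span_0 by blast
    then show ?case by (simp add: independent_empty)
  next
    case (insert i J)
    have J: "J \<in> simplices \<Delta>" using simplex_subset[OF insert.prems] by blast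
    note IH = insert.IH[OF J]
    have n: "edge i \<notin> span (edge ` J)"
      using edge_notin_span_cone[OF insert.prems insert.hyps(2)] IH by simp
    then have n': "edge i \<notin> edge ` J" using span_base[of "edge i" "edge ` J"] by metis
    have ind: "independent (edge ` insert i J)"
      unfolding image_insert independent_insert using IH n by (auto simp only: if_not_P[OF n'])
    have inj: "inj_on edge (insert i J)"
      unfolding inj_on_insert using IH n' by blast
    have sub: "edge ` insert i J \<subseteq> cone_of \<Delta> (insert i J)" using edge_in_cone[OF insert.prems] by blast
    have "card (edge ` insert i J) = dim (cone_of \<Delta> (insert i J))"
      using dim_cone[OF insert.prems] card_image[OF inj] by simp
    then have "cone_of \<Delta> (insert i J) \<subseteq> span (edge ` insert i J)"
      using card_eq_dim[OF sub] insert.hyps ind by simp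
    then have "span (edge ` insert i J) = span (cone_of \<Delta> (insert i J))"
      using sub by (metis span_mono span_span subset_antisym)
    then show ?case using ind inj by blast
  qed
qed

text \<open>
  This integer determinant is what carries the independence of the edge vectors from the reals to the
  rationals and to fields of rational functions.
\<close>

lemma top_simplex_enumeration:
  assumes I: "I \<in> top_simplices"
  obtains b where "bij_betw b (UNIV :: 'n set) I" "det (\<chi> a. v (b a)) \<noteq> 0"
proof -
  have fin: "finite I" and card: "card I = CARD('n)" using I simplex_finite top_simplexD by auto
  obtain b where b: "bij_betw b (UNIV :: 'n set) I"
    using finite_same_card_bij[of "UNIV :: 'n set" I] fin card by auto
  have B: "inj_on edge I" "independent (edge ` I)"
    using edges_basis_of_cone[OF top_simplexD(1)[OF I]] by auto
  have inj: "inj (\<lambda>a. edge (b a))"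
    using comp_inj_on[of b UNIV edge] b B(1) by (simp add: bij_betw_def o_def)
  have im: "range (\<lambda>a. edge (b a)) = edge ` I" using b by (auto simp: bij_betw_def)
  let ?A = "\<chi> a. edge (b a)"
  have "\<exists>B. ?A ** B = mat 1"
    unfolding matrix_right_invertible_independent_rows
  proof (intro allI impI)
    fix c and a assume z: "(\<Sum>i\<in>UNIV. c i *s row i ?A) = 0"
    have "(\<Sum>x\<in>edge ` I. c (inv_into UNIV (\<lambda>a. edge (b a)) x) *\<^sub>R x) = 0"
      using z unfolding im[symmetric]
      by (subst sum.reindex[OF inj]) (simp add: row_def inv_f_f[OF inj] scalar_mult_eq_scaleR)
    then have "\<forall>x\<in>edge ` I. c (inv_into UNIV (\<lambda>a. edge (b a)) x) = 0"
      using B(2) fin dependent_finite[of "edge ` I"] by auto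
    then show "c a = 0" unfolding im[symmetric] using inv_f_f[OF inj] by force
  qed
  then have "invertible ?A" by (simp add: invertible_right_inverse)
  then have "det ?A \<noteq> 0" by (simp add: invertible_det_nz)
  then have "det (\<chi> a. v (b a)) \<noteq> 0" unfolding det_of_int_vec by simp
  then show ?thesis using that b by blast
qed

lemma pairing_zero_imp_zero:
  fixes w :: "(rat, 'n) vec"
  assumes I: "I \<in> top_simplices" and "\<And>j. j \<in> I \<Longrightarrow> pairing w (of_int_vec (v j)) = 0"
  shows "w = 0"
proof -
  obtain b where b: "bij_betw b (UNIV :: 'n set) I" "det (\<chi> a. v (b a)) \<noteq> 0"
    using top_simplex_enumeration[OF I] .
  let ?A = "\<chi> a. of_int_vec (v (b a)) :: ((rat, 'n) vec, 'n) vec"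
  have "det ?A \<noteq> 0" using b(2) by (simp add: det_of_int_vec)
  then obtain B where B: "B ** ?A = mat 1"
    by (metis invertible_det_nz invertible_left_inverse)
  have "?A *v w = 0"
    using assms(2) b(1) by (auto simp: vec_eq_iff matrix_vector_mult_def pairing_def mult.commute bij_betw_def)
  then have "B *v (?A *v w) = 0" by simp
  then show ?thesis by (simp add: matrix_vector_mul_assoc B)
qed

lemma pairing_dual_vec:
  assumes I: "I \<in> top_simplices" and i: "i \<in> I" and j: "j \<in> I"
  shows "pairing (dual_vec v I i) (of_int_vec (v j)) = (if j = i then 1 else 0)"
proof -
  obtain b where b: "bij_betw b (UNIV :: 'n set) I" "det (\<chi> a. v (b a)) \<noteq> 0"
    using top_simplex_enumeration[OF I] .
  let ?A = "\<chi> a. of_int_vec (v (b a)) :: ((rat, 'n) vec, 'n) vec"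
  have "det ?A \<noteq> 0" using b(2) by (simp add: det_of_int_vec)
  then obtain B where B: "?A ** B = mat 1"
    by (metis invertible_det_nz invertible_right_inverse)
  obtain t where t: "i = b t" using b i by (auto simp: bij_betw_def)
  define u where "u = B *v axis t 1"
  have "?A *v u = axis t 1" by (simp add: u_def matrix_vector_mul_assoc B)
  then have "pairing u (of_int_vec (v (b a))) = (if b a = i then 1 else 0)" for a
  proof -
    have "pairing u (of_int_vec (v (b a))) = (?A *v u) $ a"
      by (simp add: pairing_def matrix_vector_mult_def mult.commute)
    also have "\<dots> = (if a = t then 1 else 0)" by (simp add: \<open>?A *v u = axis t 1\<close> axis_def)
    also have "a = t \<longleftrightarrow> b a = i" using b t by (auto simp: bij_betw_def inj_def)
    finally show ?thesis .
  qed
  then have u: "\<forall>j\<in>I. pairing u (of_int_vec (v j)) = (if j = i then 1 else 0)"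
    using b(1) by (auto simp: bij_betw_def)
  have "dual_vec v I i = u" unfolding dual_vec_def
  proof (rule the_equality)
    show "\<forall>j\<in>I. pairing u (of_int_vec (v j)) = (if j = i then 1 else 0)" by (rule u)
  next
    fix w :: "(rat, 'n) vec"
    assume w: "\<forall>j\<in>I. pairing w (of_int_vec (v j)) = (if j = i then 1 else 0)"
    have "w - u = 0"
      by (rule pairing_zero_imp_zero[OF I]) (use u w in \<open>simp add: pairing_def left_diff_distrib sum_subtractf\<close>)
    then show "w = u" by simp
  qed
  then show ?thesis using u j by blast
qed

end

section \<open>Facets and the balancing condition\<close>

context multi_fan_with_edges
begin

lemma dual_vec_expansion:
  assumes I: "I \<in> top_simplices"
  shows "u = (\<Sum>i\<in>I. pairing u (of_int_vec (v i)) *s dual_vec v I i)"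
proof -
  have fin: "finite I" using I simplex_finite top_simplexD by auto
  have "u - (\<Sum>i\<in>I. pairing u (of_int_vec (v i)) *s dual_vec v I i) = 0"
  proof (rule pairing_zero_imp_zero[OF I])
    fix j assume j: "j \<in> I"
    have "(\<Sum>i\<in>I. pairing u (of_int_vec (v i)) * pairing (dual_vec v I i) (of_int_vec (v j))) =
      (\<Sum>i\<in>I. if j = i then pairing u (of_int_vec (v i)) else 0)"
      by (intro sum.cong refl) (simp add: pairing_dual_vec[OF I _ j])
    also have "\<dots> = pairing u (of_int_vec (v j))" using j fin by simp
    finally show "pairing (u - (\<Sum>i\<in>I. pairing u (of_int_vec (v i)) *s dual_vec v I i)) (of_int_vec (v j)) = 0"
      by (simp add: pairing_simps pairing_sum)
  qed
  then show ?thesis by simp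
qed

text \<open>
  The matrix of the dual vectors is inverse to the matrix of the edge vectors.  Written in coordinates,
  this remains usable over extension fields.
\<close>

lemma dual_vec_coordinates:
  assumes I: "I \<in> top_simplices"
  shows "(\<Sum>i\<in>I. of_int (vec_nth (v i) t) * vec_nth (dual_vec v I i) s) = (if s = t then 1 else 0)"
proof -
  have "pairing (axis t 1) y = vec_nth y t" for y :: "(rat, 'n) vec"
    by (simp add: pairing_def axis_def if_distrib[of "\<lambda>x. x * _"] cong: if_cong)
  then have "axis t 1 = (\<Sum>i\<in>I. vec_nth (of_int_vec (v i) :: (rat, 'n) vec) t *s dual_vec v I i)"
    using dual_vec_expansion[OF I, of "axis t 1"] by simp
  then have "vec_nth (axis t 1) s = vec_nth (\<Sum>i\<in>I. vec_nth (of_int_vec (v i) :: (rat, 'n) vec) t *s dual_vec v I i) s"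
    by (rule arg_cong)
  then show ?thesis by (auto simp: axis_def of_int_vec_def)
qed

lemma edge_expansion:
  assumes I: "I \<in> top_simplices"
  shows "y = (\<Sum>i\<in>I. pairing (dual_vec v I i) y *s of_int_vec (v i))"
proof -
  have "(\<Sum>i\<in>I. pairing (dual_vec v I i) y * of_int (vec_nth (v i) t)) = vec_nth y t" for t
  proof -
    have "(\<Sum>i\<in>I. pairing (dual_vec v I i) y * of_int (vec_nth (v i) t)) =
      (\<Sum>s\<in>UNIV. vec_nth y s * (\<Sum>i\<in>I. of_int (vec_nth (v i) t) * vec_nth (dual_vec v I i) s))"
      unfolding pairing_def sum_distrib_left sum_distrib_right by (subst sum.swap) (simp add: mult_ac)
    also have "\<dots> = (\<Sum>s\<in>UNIV. if s = t then vec_nth y s else 0)"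
      by (intro sum.cong) (auto simp: dual_vec_coordinates[OF I])
    finally show ?thesis by simp
  qed
  then show ?thesis by (simp add: vec_eq_iff of_int_vec_def)
qed

text \<open>
  A multiple of any lattice vector is an integral combination of edge vectors, and \<open>N\<^sub>I\<close> is primitive.
\<close>

lemma sublattice_of_top:
  assumes I: "I \<in> top_simplices" shows "sublattice_of \<Delta> I = UNIV"
proof -
  have fin: "finite I" using I simplex_finite top_simplexD by auto
  have "x \<in> L" if L: "primitive_sublattice L" "{x. of_int_vec x \<in> cone_of \<Delta> I} \<subseteq> L" for x L
  proof -
    have L0: "0 \<in> L" and Ld: "\<And>x y. x \<in> L \<Longrightarrow> y \<in> L \<Longrightarrow> x - y \<in> L"
      and Lp: "\<And>m x. m \<noteq> 0 \<Longrightarrow> m *s x \<in> L \<Longrightarrow> x \<in> L"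
      using L(1) by (auto simp: primitive_sublattice_def)
    obtain m :: int where m: "m > 0"
      "\<And>i. i \<in> I \<Longrightarrow> \<exists>k::int. of_int m * pairing (dual_vec v I i) (of_int_vec x) = of_int k"
      using common_denominator[OF fin, of "\<lambda>i. pairing (dual_vec v I i) (of_int_vec x)"] by metis
    then obtain k :: "'v \<Rightarrow> int" where k: "\<And>i. i \<in> I \<Longrightarrow>
      of_int m * pairing (dual_vec v I i) (of_int_vec x) = of_int (k i)" by metis
    have "of_int m *s (of_int_vec x :: (rat, 'n) vec) =
      of_int m *s (\<Sum>i\<in>I. pairing (dual_vec v I i) (of_int_vec x) *s of_int_vec (v i))"
      using edge_expansion[OF I, of "of_int_vec x"] by simp
    also have "\<dots> = (\<Sum>i\<in>I. of_int (k i) *s of_int_vec (v i))"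
      unfolding vec.scale_sum_right using k by (intro sum.cong refl) simp
    finally have "(of_int_vec (m *s x) :: (rat, 'n) vec) = of_int_vec (\<Sum>i\<in>I. k i *s v i)"
      by (simp add: of_int_vec_hom of_int_vec_sum)
    then have "m *s x = (\<Sum>i\<in>I. k i *s v i)" by (simp only: of_int_vec_eq_iff)
    moreover have "v i \<in> L" if "i \<in> I" for i
      using edge_in_cone[OF top_simplexD(1)[OF I] that] by (intro subsetD[OF L(2)] CollectI)
    then have "(\<Sum>i\<in>I. k i *s v i) \<in> L"
      by (intro subgroup_int_sum[OF L0 Ld] subgroup_int_scale[OF L0 Ld])
    ultimately show "x \<in> L" using Lp m(1) by (metis less_irrefl)
  qed
  then show ?thesis unfolding sublattice_of_def by blast
qed

lemma pairing_zero_on_span: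
  assumes "\<And>x. x \<in> S \<Longrightarrow> pairing u x = 0" and "y \<in> span S"
  shows "pairing u (y :: (real, 'n) vec) = 0"
proof -
  have "subspace {y :: (real, 'n) vec. pairing u y = 0}"
    by (rule subspaceI) (simp_all add: pairing_eq_inner inner_right_distrib)
  then have "span S \<subseteq> {y. pairing u y = 0}" using assms(1) by (intro span_minimal) auto
  then show ?thesis using assms(2) by blast
qed

lemma pairing_zero_on_cone_span:
  assumes K: "K \<in> simplices \<Delta>" and g: "\<And>j. j \<in> K \<Longrightarrow> pairing g (v j) = 0"
    and y: "y \<in> span (cone_of \<Delta> K)"
  shows "pairing (of_int_vec g) y = (0::real)"
proof (rule pairing_zero_on_span)
  show "y \<in> span (edge ` K)" using edges_basis_of_cone[OF K] y by simp
  show "pairing (of_int_vec g) x = 0" if "x \<in> edge ` K" for x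
    using that g by (auto simp: pairing_of_int_vec)
qed

text \<open>
  The kernel of \<open>u\<close> is a primitive sublattice, so it contains \<open>N\<^sub>K\<close> as soon as it contains the lattice
  points of \<open>C(K)\<close>; these are real combinations of the edge vectors.
\<close>

lemma annihilator_sublattice_of:
  assumes K: "K \<in> simplices \<Delta>"
  shows "annihilator (sublattice_of \<Delta> K) = {u. \<forall>j\<in>K. pairing u (v j) = 0}"
proof (intro equalityI subsetI)
  fix u assume u: "u \<in> annihilator (sublattice_of \<Delta> K)"
  have "v j \<in> sublattice_of \<Delta> K" if "j \<in> K" for j
    using edge_in_cone[OF K that] unfolding sublattice_of_def by blast
  then show "u \<in> {u. \<forall>j\<in>K. pairing u (v j) = 0}" using u by (auto simp: annihilator_def)
next
  fix u assume "u \<in> {u. \<forall>j\<in>K. pairing u (v j) = 0}"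
  then have u: "\<And>j. j \<in> K \<Longrightarrow> pairing u (v j) = 0" by blast
  have "primitive_sublattice {y. pairing u y = 0}"
    by (auto simp: primitive_sublattice_def pairing_simps)
  moreover have "{x. of_int_vec x \<in> cone_of \<Delta> K} \<subseteq> {y. pairing u y = 0}"
  proof clarify
    fix x assume "(of_int_vec x :: (real, 'n) vec) \<in> cone_of \<Delta> K"
    then have "pairing (of_int_vec u) (of_int_vec x :: (real, 'n) vec) = 0"
      using pairing_zero_on_cone_span[OF K u] span_base by blast
    then show "pairing u x = 0" by (simp add: pairing_of_int_vec)
  qed
  ultimately have "sublattice_of \<Delta> K \<subseteq> {y. pairing u y = 0}" unfolding sublattice_of_def by blast
  then show "u \<in> annihilator (sublattice_of \<Delta> K)" by (auto simp: annihilator_def)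
qed

lemma pairing_int_nonzero:
  assumes I: "I \<in> top_simplices" and "g \<noteq> 0"
  obtains i where "i \<in> I" "pairing g (v i) \<noteq> 0"
proof -
  have "(of_int_vec g :: (rat, 'n) vec) \<noteq> of_int_vec 0" using assms(2) by (subst of_int_vec_eq_iff)
  then obtain i where "i \<in> I" "pairing (of_int_vec g) (of_int_vec (v i)) \<noteq> (0::rat)"
    using pairing_zero_imp_zero[OF I] unfolding of_int_vec_hom by blast
  then show ?thesis using that by (simp add: pairing_of_int_vec)
qed

lemma facet_cases:
  assumes K: "Suc (card K) = CARD('n)" "K \<subseteq> I" and I: "I \<in> top_simplices"
  obtains i where "I = insert i K" "i \<notin> K"
proof -
  have fin: "finite I" using I simplex_finite top_simplexD by auto
  then have "card (I - K) = 1"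
    using K card_Diff_subset[of K I] top_simplexD(2)[OF I] finite_subset by fastforce
  then obtain i where "I - K = {i}" by (auto simp: card_1_singleton_iff)
  then show ?thesis using that[of i] K(2) by blast
qed

lemma facet_pairing_nonzero:
  assumes "insert i K \<in> top_simplices" "g \<noteq> 0" "\<And>j. j \<in> K \<Longrightarrow> pairing g (v j) = 0"
  shows "pairing g (v i) \<noteq> 0"
  using pairing_int_nonzero[OF assms(1,2)] assms(3) by blast

text \<open>
  If \<open>d\<close> generates the image of \<open>g\<close>, then \<open>g\<close> divided by \<open>d\<close> maps \<open>H\<^sub>I\<close> onto a cyclic group of order
  \<open>|g(v\<^sub>i) / d|\<close>, with kernel the quotient of the kernel of \<open>g\<close> by the edge vectors of \<open>K\<close>, in which \<open>i\<close>
  does not occur.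
\<close>

lemma H_order_facet:
  assumes K: "finite K" and g: "g \<noteq> 0" "\<And>j. j \<in> K \<Longrightarrow> pairing g (v j) = 0"
  obtains h :: rat where "\<And>i. i \<notin> K \<Longrightarrow> insert i K \<in> top_simplices \<Longrightarrow>
    of_nat (H_order \<Delta> v (insert i K)) = h * of_int \<bar>pairing g (v i)\<bar>"
proof -
  have "0 \<in> range (pairing g)" by (rule range_eqI[of _ _ 0]) (simp add: pairing_simps)
  moreover have "x - y \<in> range (pairing g)" if "x \<in> range (pairing g)" "y \<in> range (pairing g)" for x y
    using that by (auto simp: pairing_simps(7)[symmetric])
  ultimately obtain d where d: "d \<in> range (pairing g)" "\<And>x. x \<in> range (pairing g) \<Longrightarrow> d dvd x"
    using int_subgroup_principal[of "range (pairing g)"] by metis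
  obtain t where t: "vec_nth g t \<noteq> 0" using g(1) by (auto simp: vec_eq_iff)
  have "pairing g (axis t 1) = vec_nth g t"
    by (simp add: pairing_def axis_def if_distrib[of "\<lambda>x. _ * x"] cong: if_cong)
  then have d0: "d \<noteq> 0" using t d(2)[OF rangeI[of "pairing g" "axis t 1"]] by auto
  obtain e where e: "pairing g e = d" using d(1) by auto
  \<comment> \<open>\<open>f\<close> is onto the integers\<close>
  define f where "f x = pairing g x div d" for x
  have f: "pairing g x = f x * d" for x using d(2)[of "pairing g x"] by (simp add: f_def)
  have f_diff: "f (x - y) = f x - f y" for x y
    using f[of "x - y"] f[of x] f[of y] d0 by (simp add: pairing_simps left_diff_distrib[symmetric])
  have f_scale: "f (k *s x) = k * f x" for k x
    using f[of "k *s x"] f[of x] d0 by (simp add: pairing_simps mult.assoc[symmetric])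
  have fe: "f e = 1" using f[of e] e d0 by simp
  have fK: "f (v j) = 0" if "j \<in> K" for j using f[of "v j"] g(2)[OF that] d0 by simp
  let ?h = "card ({x. f x = 0} //
    {(x, y). x \<in> {x. f x = 0} \<and> y \<in> {x. f x = 0} \<and> x - y \<in> edge_sublattice v K})"
  have "of_nat (H_order \<Delta> v (insert i K)) = (of_nat ?h / of_int \<bar>d\<bar> :: rat) * of_int \<bar>pairing g (v i)\<bar>"
    if i: "i \<notin> K" "insert i K \<in> top_simplices" for i
  proof -
    have fi: "f (v i) \<noteq> 0" using facet_pairing_nonzero[OF i(2) g] f[of "v i"] by auto
    have "H_order \<Delta> v (insert i K) = ?h * nat \<bar>f (v i)\<bar>"
      unfolding H_order_def sublattice_of_top[OF i(2)]
      by (rule card_quotient_edge_sublattice_insert[where f = f and e = e and v = v and K = K and i = i, OF K i(1) f_diff f_scale fK fi fe])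
    moreover have "(of_nat (nat \<bar>f (v i)\<bar>) :: rat) = of_int \<bar>pairing g (v i)\<bar> / of_int \<bar>d\<bar>"
      using d0 by (simp add: f abs_mult)
    ultimately show ?thesis by simp
  qed
  then show ?thesis by (rule that)
qed

lemma proj_vec_eq_iff:
  assumes K: "K \<in> simplices \<Delta>"
  shows "proj_vec \<Delta> K y = proj_vec \<Delta> K z \<longleftrightarrow> y - z \<in> span (of_int_vec ` sublattice_of \<Delta> K)"
    (is "_ \<longleftrightarrow> _ \<in> ?S")
proof
  assume "proj_vec \<Delta> K y = proj_vec \<Delta> K z"
  moreover have "y \<in> proj_vec \<Delta> K y" using span_0 by (force simp: proj_vec_def)
  ultimately obtain s where "y = z + s" "s \<in> ?S" by (auto simp: proj_vec_def)
  then show "y - z \<in> ?S" by simp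
next
  have sub: "proj_vec \<Delta> K a \<subseteq> proj_vec \<Delta> K b" if "a - b \<in> ?S" for a b
  proof
    fix x assume "x \<in> proj_vec \<Delta> K a"
    then obtain s where s: "x = a + s" "s \<in> ?S" by (auto simp: proj_vec_def)
    have "x = b + ((a - b) + s)" using s by simp
    then show "x \<in> proj_vec \<Delta> K b" unfolding proj_vec_def using span_add[OF that s(2)] by blast
  qed
  assume "y - z \<in> ?S"
  moreover from this have "z - y \<in> ?S" using span_neg by fastforce
  ultimately show "proj_vec \<Delta> K y = proj_vec \<Delta> K z" using sub by blast
qed

lemma span_edges_top:
  assumes I: "I \<in> top_simplices" shows "span (edge ` I) = UNIV"
proof -
  have fin: "finite I" using I simplex_finite top_simplexD by auto
  note B = edges_basis_of_cone[OF top_simplexD(1)[OF I]]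
  have "UNIV \<subseteq> span (edge ` I)"
    using card_eq_dim[of "edge ` I" "UNIV :: (real, 'n) vec set"] B fin
      top_simplexD(2)[OF I] card_image[of edge I] by simp
  then show ?thesis by blast
qed

text \<open>
  The span of \<open>C(K)\<close> is the hyperplane \<open>g = 0\<close>, so \<open>\<Delta>\<^sub>K\<close> lives on a line with coordinate \<open>g\<close> and the
  projection of \<open>C(I)\<close> is the half line on the side of the vertex of \<open>I\<close> off \<open>K\<close>.  The sum of \<open>g\<close> over
  the vertices of \<open>I\<close> is its value at that vertex, written as an expression in \<open>I\<close> alone.
\<close>

lemma proj_degree_facet:
  assumes K: "K \<in> simplices \<Delta>" "Suc (card K) = CARD('n)"
    and g: "g \<noteq> 0" "\<And>j. j \<in> K \<Longrightarrow> pairing g (v j) = 0"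
    and y: "pairing (of_int_vec g) y > (0::real)"
  shows "proj_generic \<Delta> K (proj_vec \<Delta> K y)"
    and "proj_degree \<Delta> K (proj_vec \<Delta> K y) =
      (\<Sum>I | I \<in> top_simplices \<and> K \<subseteq> I \<and> (\<Sum>i\<in>I. pairing g (v i)) > 0. weight \<Delta> I)"
proof -
  let ?S = "span (of_int_vec ` sublattice_of \<Delta> K) :: (real, 'n) vec set"
  let ?p = "\<lambda>y. pairing (of_int_vec g) y :: real"
  have p_add: "?p (a + b) = ?p a + ?p b" and p_scale: "?p (c *\<^sub>R a) = c * ?p a"
    and p_diff: "?p (a - b) = ?p a - ?p b" for a b c
    by (simp_all add: pairing_eq_inner inner_right_distrib inner_diff_right)
  have gS: "?p s = 0" if "s \<in> ?S" for s
  proof (rule pairing_zero_on_span[OF _ that])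
    fix x :: "(real, 'n) vec" assume "x \<in> of_int_vec ` sublattice_of \<Delta> K"
    moreover have "g \<in> annihilator (sublattice_of \<Delta> K)" using annihilator_sublattice_of[OF K(1)] g by blast
    ultimately show "?p x = 0" by (auto simp: annihilator_def pairing_of_int_vec)
  qed
  show "proj_generic \<Delta> K (proj_vec \<Delta> K y)"
    unfolding proj_generic_def
  proof (intro conjI ballI impI rangeI)
    fix J assume J: "J \<in> simplices \<Delta>" "K \<subseteq> J \<and> card J < CARD('n)"
    then have "J = K" using K simplex_finite[OF J(1)] by (metis card_seteq less_Suc_eq_le)
    show "proj_vec \<Delta> K y \<notin> proj_vec \<Delta> K ` span (cone_of \<Delta> J)"
    proof
      assume "proj_vec \<Delta> K y \<in> proj_vec \<Delta> K ` span (cone_of \<Delta> J)"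
      then obtain z where z: "z \<in> span (cone_of \<Delta> K)" "proj_vec \<Delta> K y = proj_vec \<Delta> K z"
        using \<open>J = K\<close> by blast
      have "?p z = 0" using pairing_zero_on_cone_span[OF K(1) g(2) z(1)] .
      moreover have "?p (y - z) = 0" using gS z(2) proj_vec_eq_iff[OF K(1)] by blast
      ultimately show False using y by (simp add: p_diff)
    qed
  qed
  have "proj_vec \<Delta> K y \<in> proj_cone \<Delta> K I \<longleftrightarrow> (\<Sum>i\<in>I. pairing g (v i)) > 0"
    if I: "I \<in> top_simplices" "K \<subseteq> I" for I
  proof -
    obtain i where i: "I = insert i K" "i \<notin> K" using facet_cases[OF K(2) I(2,1)] .
    have Is: "I \<in> simplices \<Delta>" using I top_simplexD by blast
    have sum: "(\<Sum>i\<in>I. pairing g (v i)) = pairing g (v i)"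
      using i g(2) simplex_finite[OF K(1)] by simp
    have gi: "pairing g (v i) \<noteq> 0" using facet_pairing_nonzero[OF _ g, of i] I i by simp
    have pe: "?p (edge i) = of_int (pairing g (v i))" by (simp add: pairing_of_int_vec)
    have ei: "edge i \<in> cone_of \<Delta> I" using edge_in_cone[OF Is] i by blast
    have mem: "proj_vec \<Delta> K y \<in> proj_cone \<Delta> K I \<longleftrightarrow> (\<exists>z\<in>cone_of \<Delta> I. y - z \<in> ?S)"
      unfolding proj_cone_def using proj_vec_eq_iff[OF K(1)] by blast
    have kerg: "w \<in> span (edge ` K)" if w: "?p w = 0" for w
    proof -
      have "w \<in> span (insert (edge i) (edge ` K))" using span_edges_top[OF I(1)] i by simp
      then obtain k where k: "w - k *\<^sub>R edge i \<in> span (edge ` K)" by (auto simp: span_insert)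
      then have "?p (w - k *\<^sub>R edge i) = 0"
        using pairing_zero_on_cone_span[OF K(1) g(2)] edges_basis_of_cone[OF K(1)] by blast
      then have "k = 0" using w gi by (simp add: p_diff p_scale pe)
      then show ?thesis using k by simp
    qed
    show ?thesis unfolding mem sum
    proof
      assume pos: "pairing g (v i) > 0"
      define t where "t = ?p y / of_int (pairing g (v i))"
      have "t \<ge> 0" using y pos by (simp add: t_def)
      then have "t *\<^sub>R edge i \<in> cone_of \<Delta> I" using convex_cone_scaleR[OF convex_cone_cone[OF Is] _ ei] by blast
      moreover have "y - t *\<^sub>R edge i \<in> span (edge ` K)"
        using gi by (intro kerg) (simp add: p_diff p_scale pe t_def)
      moreover have "edge ` K \<subseteq> of_int_vec ` sublattice_of \<Delta> K"
        using edge_in_cone[OF K(1)] by (auto simp: sublattice_of_def)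
      ultimately show "\<exists>z\<in>cone_of \<Delta> I. y - z \<in> ?S" using span_mono by blast
    next
      assume "\<exists>z\<in>cone_of \<Delta> I. y - z \<in> ?S"
      then obtain z where z: "z \<in> cone_of \<Delta> I" "y - z \<in> ?S" by blast
      have pz: "?p z > 0" using gS[OF z(2)] y by (simp add: p_diff)
      show "pairing g (v i) > 0"
      proof (rule ccontr)
        assume "\<not> pairing g (v i) > 0"
        then have neg: "pairing g (v i) < 0" using gi by simp
        \<comment> \<open>a combination of \<open>z\<close> and \<open>edge i\<close> with positive coefficients lies on the hyperplane\<close>
        define \<alpha> where "\<alpha> = - (of_int (pairing g (v i)) :: real)"
        have \<alpha>: "\<alpha> > 0" using neg by (simp add: \<alpha>_def)
        have "\<alpha> *\<^sub>R z + ?p z *\<^sub>R edge i \<in> span (edge ` K)"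
        proof (rule kerg)
          have "?p (\<alpha> *\<^sub>R z + ?p z *\<^sub>R edge i) = \<alpha> * ?p z + ?p z * of_int (pairing g (v i))"
            by (simp only: p_add p_scale pe)
          then show "?p (\<alpha> *\<^sub>R z + ?p z *\<^sub>R edge i) = 0" by (simp add: \<alpha>_def)
        qed
        then have "\<alpha> *\<^sub>R z + ?p z *\<^sub>R edge i \<in> span (cone_of \<Delta> K)"
          using edges_basis_of_cone[OF K(1)] by blast
        then obtain a b where ab: "a \<in> cone_of \<Delta> K" "b \<in> cone_of \<Delta> K"
          "\<alpha> *\<^sub>R z + ?p z *\<^sub>R edge i = a - b"
          using span_convex_cone[OF convex_cone_cone[OF K(1)]] by blast
        have az: "\<alpha> *\<^sub>R z \<in> cone_of \<Delta> I"
          using convex_cone_scaleR[OF convex_cone_cone[OF Is] _ z(1), of \<alpha>] \<alpha> by simp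
        have bI: "b \<in> cone_of \<Delta> I" using ab(2) cone_mono[OF Is I(2)] by blast
        have pei: "?p z *\<^sub>R edge i \<in> cone_of \<Delta> I"
          using convex_cone_scaleR[OF convex_cone_cone[OF Is] _ ei, of "?p z"] pz by simp
        have "?p z *\<^sub>R edge i \<in> cone_of \<Delta> K"
        proof (rule face_summand[OF Is I(2) pei])
          show "\<alpha> *\<^sub>R z + b \<in> cone_of \<Delta> I" using convex_cone_add[OF convex_cone_cone[OF Is] az bI] .
          have "?p z *\<^sub>R edge i + (\<alpha> *\<^sub>R z + b) = a" using ab(3) by (simp add: algebra_simps)
          then show "?p z *\<^sub>R edge i + (\<alpha> *\<^sub>R z + b) \<in> cone_of \<Delta> K" using ab(1) by simp
        qed
        then have "?p (?p z *\<^sub>R edge i) = 0"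
          using pairing_zero_on_cone_span[OF K(1) g(2)] span_base by blast
        then show False using pz gi by (simp add: p_scale pe)
      qed
    qed
  qed
  then show "proj_degree \<Delta> K (proj_vec \<Delta> K y) =
      (\<Sum>I | I \<in> top_simplices \<and> K \<subseteq> I \<and> (\<Sum>i\<in>I. pairing g (v i)) > 0. weight \<Delta> I)"
    unfolding proj_degree_def by (intro sum.cong) auto
qed

text \<open>
  The degree of \<open>\<Delta>\<^sub>K\<close> is compared at a point with \<open>g > 0\<close> and at its negative.
\<close>

lemma facet_balance:
  assumes "complete_multi_fan \<Delta>"
    and K: "K \<in> simplices \<Delta>" "Suc (card K) = CARD('n)"
    and g: "g \<noteq> 0" "\<And>j. j \<in> K \<Longrightarrow> pairing g (v j) = 0"
  shows "(\<Sum>I | I \<in> top_simplices \<and> K \<subseteq> I. weight \<Delta> I * sgn (\<Sum>i\<in>I. pairing g (v i))) = 0"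
proof -
  let ?y = "of_int_vec g :: (real, 'n) vec"
  \<comment> \<open>\<open>g\<close> itself, read as a vector by the dual coordinates, is a point where \<open>g\<close> is positive\<close>
  have y: "pairing (of_int_vec g) ?y > (0::real)"
    using g(1) of_int_vec_eq_iff[of g 0, where ?'a = real] by (simp add: pairing_eq_inner of_int_vec_hom)
  have y': "pairing (of_int_vec (- g)) (- ?y) > (0::real)"
    using y by (simp add: pairing_def of_int_vec_def)
  have g': "- g \<noteq> 0" "\<And>j. j \<in> K \<Longrightarrow> pairing (- g) (v j) = 0"
    using g by (auto simp: pairing_def sum_negf)
  have neg: "pairing (- g) z = - pairing g z" for z by (simp add: pairing_def sum_negf)
  note 1 = proj_degree_facet[OF K g y] and 2 = proj_degree_facet[OF K g' y']
  have "proj_pre_complete \<Delta> K" using assms(1) K(1) by (simp add: complete_multi_fan_def)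
  then have e: "proj_degree \<Delta> K (proj_vec \<Delta> K ?y) = proj_degree \<Delta> K (proj_vec \<Delta> K (- ?y))"
    using 1(1) 2(1) unfolding proj_pre_complete_def by blast
  let ?T = "{I. I \<in> top_simplices \<and> K \<subseteq> I}" and ?s = "\<lambda>I. \<Sum>i\<in>I. pairing g (v i)"
  have fin: "finite ?T"
    using finite_simplices by (rule finite_subset[rotated]) (auto simp: simplices_card_def)
  have "(\<Sum>I\<in>?T. weight \<Delta> I * sgn (?s I)) =
    (\<Sum>I\<in>?T. if ?s I > 0 then weight \<Delta> I else 0) - (\<Sum>I\<in>?T. if ?s I < 0 then weight \<Delta> I else 0)"
    unfolding sum_subtractf[symmetric] by (intro sum.cong) (auto simp: sgn_if)
  also have "\<dots> = (\<Sum>I\<in>{I \<in> ?T. ?s I > 0}. weight \<Delta> I) - (\<Sum>I\<in>{I \<in> ?T. ?s I < 0}. weight \<Delta> I)"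
    using fin by (simp only: sum.inter_filter)
  also have "{I \<in> ?T. ?s I > 0} = {I. I \<in> top_simplices \<and> K \<subseteq> I \<and> ?s I > 0}" by blast
  also have "{I \<in> ?T. ?s I < 0} = {I. I \<in> top_simplices \<and> K \<subseteq> I \<and> (\<Sum>i\<in>I. pairing (- g) (v i)) > 0}"
    by (auto simp: neg sum_negf)
  also have "(\<Sum>I | I \<in> top_simplices \<and> K \<subseteq> I \<and> ?s I > 0. weight \<Delta> I) -
      (\<Sum>I | I \<in> top_simplices \<and> K \<subseteq> I \<and> (\<Sum>i\<in>I. pairing (- g) (v i)) > 0. weight \<Delta> I) = 0"
    using e 1(2) 2(2) by simp
  finally show ?thesis .
qed

end

section \<open>The push-forward takes polynomial values\<close>

lemma to_fract_qconst_divide: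
  fixes r s :: rat
  shows "to_fract (qconst (r / s) :: 'v::linorder qpoly) = to_fract (qconst r) / to_fract (qconst s)"
proof (cases "s = 0")
  case False
  have "to_fract (qconst (r / s) :: 'v qpoly) * to_fract (qconst s) = to_fract (qconst (r / s * s))"
    by (simp only: qconst_hom to_fract_mult)
  also have "r / s * s = r" using False by simp
  finally have "to_fract (qconst (r / s) :: 'v qpoly) * to_fract (qconst s) = to_fract (qconst r)" .
  moreover have "to_fract (qconst s :: 'v qpoly) \<noteq> 0" using False by (simp add: qconst_eq_0_iff)
  ultimately show ?thesis by (simp only: eq_divide_eq if_False not_False_eq_True if_True)
qed (simp add: qconst_hom)

lemma of_nat_eq_to_fract: "of_nat m = to_fract (qconst (of_nat m) :: 'v::linorder qpoly)"
  by (metis of_int_of_nat_eq qconst_of_int to_fract_of_int)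

lemma of_int_eq_to_fract: "of_int m = to_fract (qconst (of_int m) :: 'v::linorder qpoly)"
  by (simp add: qconst_of_int)

lemma prime_elem_dvd_prod:
  assumes "prime_elem \<pi>" "finite A" "\<pi> dvd (\<Prod>a\<in>A. f a)"
  shows "\<exists>a\<in>A. \<pi> dvd f a"
  using assms(2,3)
proof (induction A rule: finite_induct)
  case empty
  then show ?case using assms(1) by (simp add: prime_elem_def)
next
  case (insert a A)
  then have "\<pi> dvd f a \<or> \<pi> dvd (\<Prod>a\<in>A. f a)" using prime_elem_dvd_multD[OF assms(1)] by simp
  then show ?case using insert.IH by blast
qed

lemma lookup_qvar_mult_0: "lookup (qvar t * f) 0 = 0"
proof -
  have "0 \<notin> keys (qvar t * f)"
  proof
    assume "0 \<in> keys (qvar t * f)"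
    then obtain a b where "0 = a + b" "a \<in> keys (qvar t)"
      using keys_mult[of "qvar t" f] by blast
    then have "lookup (a + b) t = 0" "a = Poly_Mapping.single t 1"
      by (auto simp: qvar_def)
    then show False by (simp add: lookup_add)
  qed
  then show ?thesis by (simp add: in_keys_iff)
qed

lemma lookup_qconst_mult_0: "lookup (qconst c * f) 0 = c * lookup f 0"
proof -
  have "qconst c * f = Poly_Mapping.map ((*) c) f"
    unfolding qconst_def by (rule mult_map_scale_conv_mult[symmetric])
  then show ?thesis by (simp add: Poly_Mapping.map.rep_eq when_def)
qed

context multi_fan_with_edges
begin

abbreviation restriction :: "'v set \<Rightarrow> 'v qpoly \<Rightarrow> 'n qpoly" where
  "restriction I \<equiv> qsubst (\<lambda>i. lin_form (iota_gen v I i))"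

abbreviation euler_class :: "'v set \<Rightarrow> 'n qpoly" where
  "euler_class I \<equiv> \<Prod>i\<in>I. lin_form (dual_vec v I i)"

definition push_term :: "'v qpoly \<Rightarrow> 'v set \<Rightarrow> 'n qpoly fract" where
  "push_term p I = to_fract (qconst (of_int (weight \<Delta> I) / of_nat (H_order \<Delta> v I))) *
     to_fract (restriction I p) / to_fract (euler_class I)"

lemma finite_top: "finite top_simplices"
  using finite_simplices by (simp add: simplices_card_def)

lemma kills_nonfacesI:
  assumes "I \<in> top_simplices" "\<And>i. i \<notin> I \<Longrightarrow> g i = 0"
  shows "kills_nonfaces \<Delta> g"
  unfolding kills_nonfaces_def
proof clarify
  fix K assume K: "K \<subseteq> vertices \<Delta>" "K \<notin> simplices \<Delta>"
  then have "\<not> K \<subseteq> I" using simplex_subset top_simplexD assms(1) by metis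
  then obtain i where "i \<in> K" "g i = 0" using assms(2) by blast
  then show "(\<Prod>i\<in>K. g i) = 0"
    using finite_subset[OF K(1) finite_vertices] by (intro prod_zero) auto
qed

lemma pi_push_HT_class: "pi_push \<Delta> v (HT_class \<Delta> p) = (\<Sum>I\<in>top_simplices. push_term p I)"
  unfolding pi_push_def
proof (rule sum.cong[OF refl])
  fix I assume I: "I \<in> top_simplices"
  have "kills_nonfaces \<Delta> (\<lambda>i. lin_form (iota_gen v I i))"
    by (rule kills_nonfacesI[OF I]) (simp add: iota_gen_def lin_form_hom)
  then have "iota v I (HT_class \<Delta> p) = restriction I p"
    unfolding iota_def by (rule the_elem_qsubst_HT_class)
  then show "of_int (weight \<Delta> I) * to_fract (iota v I (HT_class \<Delta> p)) /
      (of_nat (H_order \<Delta> v I) * to_fract (euler_class I)) = push_term p I"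
    unfolding push_term_def to_fract_qconst_divide of_nat_eq_to_fract of_int_eq_to_fract
    by (simp only: times_divide_eq_left divide_divide_eq_left)
qed

lemma pairing_iota_gen:
  assumes I: "I \<in> top_simplices" and j: "j \<in> I"
  shows "pairing (iota_gen v I i) (of_int_vec (v j)) = (if j = i then 1 else 0)"
  using pairing_dual_vec[OF I _ j, of i] j by (auto simp: iota_gen_def pairing_simps)

lemma dual_vec_nonzero: "I \<in> top_simplices \<Longrightarrow> i \<in> I \<Longrightarrow> dual_vec v I i \<noteq> 0"
  using pairing_dual_vec[of I i i] by (auto simp: pairing_simps)

lemma facet_multiple:
  fixes d :: "(rat, 'n) vec"
  assumes I: "insert i K \<in> top_simplices" and g: "g \<noteq> 0" "\<And>j. j \<in> K \<Longrightarrow> pairing g (v j) = 0"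
    and d: "\<And>j. j \<in> K \<Longrightarrow> pairing d (of_int_vec (v j)) = 0"
  shows "d = (pairing d (of_int_vec (v i)) / of_int (pairing g (v i))) *s of_int_vec g"
proof -
  have gi: "pairing g (v i) \<noteq> 0" by (rule facet_pairing_nonzero[OF I g])
  have "d - (pairing d (of_int_vec (v i)) / of_int (pairing g (v i))) *s of_int_vec g = 0"
    by (rule pairing_zero_imp_zero[OF I])
      (use g d gi in \<open>auto simp: pairing_simps pairing_of_int_vec\<close>)
  then show ?thesis by simp
qed

text \<open>
  For \<open>I = insert i K\<close> the dual vector of \<open>i\<close> is \<open>g / g(v\<^sub>i)\<close>, which gives a simple pole; together with
  \<open>|H\<^sub>I| = h |g(v\<^sub>i)|\<close> this makes the coefficient of the pole \<open>w(I) sgn (g(v\<^sub>i)) / h\<close>.  The restrictions to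
  different \<open>I\<close> agree modulo \<open>g\<close>, since they agree on the hyperplane spanned by \<open>K\<close>.
\<close>

lemma facet_regular:
  assumes complete: "complete_multi_fan \<Delta>"
    and K: "K \<in> simplices \<Delta>" "Suc (card K) = CARD('n)"
    and g: "g \<noteq> 0" "\<And>j. j \<in> K \<Longrightarrow> pairing g (v j) = 0"
  shows "regular_at (lin_form (of_int_vec g)) (\<Sum>I | I \<in> top_simplices \<and> K \<subseteq> I. push_term p I)"
proof -
  let ?l = "of_int_vec g :: (rat, 'n) vec"
  let ?T = "{I. I \<in> top_simplices \<and> K \<subseteq> I}"
  let ?s = "\<lambda>I. \<Sum>i\<in>I. pairing g (v i)"
  let ?B = "\<lambda>I. restriction I (\<Prod>j\<in>K. qvar j)"
  have l0: "?l \<noteq> 0" using g(1) of_int_vec_eq_iff[of g 0] by (simp add: of_int_vec_hom)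
  have prime: "prime_elem (lin_form ?l)" by (rule prime_elem_lin_form[OF l0])
  have finK: "finite K" using simplex_finite[OF K(1)] .
  obtain h :: rat where h: "\<And>i. i \<notin> K \<Longrightarrow> insert i K \<in> top_simplices \<Longrightarrow>
    of_nat (H_order \<Delta> v (insert i K)) = h * of_int \<bar>pairing g (v i)\<bar>"
    using H_order_facet[OF finK g] by metis
  have B: "?B I = (\<Prod>j\<in>K. lin_form (dual_vec v I j))" if "K \<subseteq> I" for I
    using that by (auto simp: iota_gen_def intro!: prod.cong)
  have term_eq: "push_term p I = to_fract (qconst (1 / h)) *
      (of_int (weight \<Delta> I * sgn (?s I)) * (to_fract (restriction I p) / to_fract (?B I)) / to_fract (lin_form ?l))"
    if I: "I \<in> ?T" for I
  proof -
    have top: "I \<in> top_simplices" and KI: "K \<subseteq> I" using I by auto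
    obtain i where i: "I = insert i K" "i \<notin> K" using facet_cases[OF K(2) KI top] .
    define c where "c = pairing g (v i)"
    have s: "?s I = c" using i finK g(2) by (simp add: c_def)
    have c0: "c \<noteq> 0" using facet_pairing_nonzero[OF _ g, of i] top i by (simp add: c_def)
    have "pairing (dual_vec v I i) (of_int_vec (v j)) = 0" if "j \<in> K" for j
      using pairing_dual_vec[OF top, of i j] i that by auto
    moreover have "pairing (dual_vec v I i) (of_int_vec (v i)) = 1"
      using pairing_dual_vec[OF top, of i i] i by simp
    ultimately have "dual_vec v I i = (1 / of_int c) *s ?l"
      using facet_multiple[of i K g "dual_vec v I i"] top g i(1) by (simp add: c_def)
    then have di: "lin_form (dual_vec v I i) = qconst (1 / of_int c) * lin_form ?l"
      by (simp add: lin_form_hom)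
    have "euler_class I = lin_form (dual_vec v I i) * ?B I"
      unfolding B[OF KI] using i finK by simp
    then have E: "to_fract (euler_class I) =
        to_fract (qconst (1 / of_int c)) * to_fract (lin_form ?l) * to_fract (?B I)"
      by (simp only: di to_fract_mult)
    have H: "of_nat (H_order \<Delta> v I) = h * of_int \<bar>c\<bar>"
      using h[of i] i top by (simp add: c_def)
    have "of_int (weight \<Delta> I) / of_nat (H_order \<Delta> v I) =
        (1 / h) * of_int (weight \<Delta> I * sgn c) * (1 / of_int c :: rat)"
      unfolding H using c0 by (cases "c > 0") (simp_all add: sgn_if)
    then have w: "to_fract (qconst (of_int (weight \<Delta> I) / of_nat (H_order \<Delta> v I)) :: 'n qpoly) =
        to_fract (qconst (1 / h)) * of_int (weight \<Delta> I * sgn c) * to_fract (qconst (1 / of_int c))"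
      by (simp only: qconst_hom(4) to_fract_mult of_int_eq_to_fract)
    have nz: "to_fract (qconst (1 / of_int c) :: 'n qpoly) \<noteq> 0" using c0 by (simp add: qconst_eq_0_iff)
    have "k * m * z * x / (z * l * b) = k * (m * (x / b) / l)" if "z \<noteq> 0"
      for k m z x l b :: "'n qpoly fract"
      using that by (simp add: divide_simps)
    from this[OF nz] show ?thesis unfolding push_term_def E w s .
  qed
  have mult: "lin_form ?l dvd restriction I q - restriction I' q" if I: "I \<in> ?T" "I' \<in> ?T" for I I' q
  proof (rule qsubst_dvd_diff)
    fix i
    obtain k where k: "I = insert k K" using facet_cases[OF K(2), of I] I by blast
    let ?d = "iota_gen v I i - iota_gen v I' i"
    have "pairing ?d (of_int_vec (v j)) = 0" if "j \<in> K" for j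
    proof -
      have "I \<in> top_simplices" "I' \<in> top_simplices" "j \<in> I" "j \<in> I'" using I that by auto
      then show ?thesis by (simp add: pairing_simps pairing_iota_gen)
    qed
    then have "?d = (pairing ?d (of_int_vec (v k)) / of_int (pairing g (v k))) *s ?l"
      using I k by (intro facet_multiple[of k K] g) auto
    then have "\<exists>c. ?d = c *s ?l" ..
    then show "lin_form ?l dvd lin_form (iota_gen v I i) - lin_form (iota_gen v I' i)"
      unfolding lin_form_hom(3)[symmetric] lin_form_dvd_lin_form[OF l0] .
  qed
  have nb: "\<not> lin_form ?l dvd ?B I" if I: "I \<in> ?T" for I
  proof
    assume "lin_form ?l dvd ?B I"
    then obtain j where j: "j \<in> K" "lin_form ?l dvd lin_form (dual_vec v I j)"
      using prime_elem_dvd_prod[OF prime finK] B[of I] I by auto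
    then obtain c where c: "dual_vec v I j = c *s ?l" using lin_form_dvd_lin_form[OF l0] by blast
    have "pairing (dual_vec v I j) (of_int_vec (v j)) = 1"
      using pairing_dual_vec[of I j j] I j by auto
    then show False using g(2)[OF j(1)] by (simp add: c pairing_simps pairing_of_int_vec)
  qed
  have finT: "finite ?T" using finite_top by simp
  have "(\<Sum>I\<in>?T. push_term p I) = to_fract (qconst (1 / h)) *
    (\<Sum>I\<in>?T. of_int (weight \<Delta> I * sgn (?s I)) * (to_fract (restriction I p) / to_fract (?B I)) / to_fract (lin_form ?l))"
    unfolding sum_distrib_left by (rule sum.cong[OF refl term_eq])
  also have "regular_at (lin_form ?l) \<dots>"
    by (intro regular_at_mult[OF prime] regular_at_to_fract[OF prime]
        regular_at_residue_cancel[OF prime finT] facet_balance[OF complete K g] mult nb)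
  finally show ?thesis .
qed

text \<open>
  A maximal simplex contributes a pole along \<open>g\<close> only if all its vertices but one lie on the hyperplane
  \<open>g = 0\<close>; these vertices form the simplex by which the terms are grouped.
\<close>

lemma pi_push_regular:
  assumes complete: "complete_multi_fan \<Delta>" and g: "g \<noteq> 0"
  shows "regular_at (lin_form (of_int_vec g)) (\<Sum>I\<in>top_simplices. push_term p I)"
proof -
  let ?l = "of_int_vec g :: (rat, 'n) vec"
  have l0: "?l \<noteq> 0" using g of_int_vec_eq_iff[of g 0] by (simp add: of_int_vec_hom)
  have prime: "prime_elem (lin_form ?l)" by (rule prime_elem_lin_form[OF l0])
  define A where "A = {I \<in> top_simplices. \<exists>i\<in>I. \<forall>j\<in>I - {i}. pairing g (v j) = 0}"
  define \<kappa> where "\<kappa> I = {j \<in> I. pairing g (v j) = 0}" for I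
  have \<kappa>: "\<kappa> I \<in> simplices \<Delta> \<and> Suc (card (\<kappa> I)) = CARD('n)" if "I \<in> A" for I
  proof -
    obtain i where I: "I \<in> top_simplices" and i: "i \<in> I" "\<And>j. j \<in> I - {i} \<Longrightarrow> pairing g (v j) = 0"
      using \<open>I \<in> A\<close> unfolding A_def by auto
    have "pairing g (v i) \<noteq> 0" using pairing_int_nonzero[OF I g] i(2) by blast
    then have "\<kappa> I = I - {i}" using i by (auto simp: \<kappa>_def)
    moreover have "finite I" using simplex_finite top_simplexD(1)[OF I] by blast
    ultimately show ?thesis
      using i(1) top_simplexD[OF I] simplex_subset[of I "I - {i}"] card_Suc_Diff1[of I i] by auto
  qed
  have fiber: "{I \<in> A. \<kappa> I = K} = {I. I \<in> top_simplices \<and> K \<subseteq> I}" if K: "K \<in> \<kappa> ` A" for K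
  proof (intro equalityI subsetI)
    fix I assume "I \<in> {I. I \<in> top_simplices \<and> K \<subseteq> I}"
    then have I: "I \<in> top_simplices" "K \<subseteq> I" by auto
    obtain I' where I': "K = \<kappa> I'" "I' \<in> A" using K by blast
    then have gK: "pairing g (v j) = 0" if "j \<in> K" for j using that by (auto simp: \<kappa>_def)
    have cK: "Suc (card K) = CARD('n)" using \<kappa> I' by blast
    obtain i where i: "I = insert i K" "i \<notin> K" using facet_cases[OF cK I(2,1)] .
    have "pairing g (v i) \<noteq> 0" using facet_pairing_nonzero[OF _ g gK, of i] I(1) i by simp
    then have "\<kappa> I = K" using i gK by (auto simp: \<kappa>_def)
    moreover have "I \<in> A" unfolding A_def using I i gK by auto
    ultimately show "I \<in> {I \<in> A. \<kappa> I = K}" by blast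
  qed (auto simp: A_def \<kappa>_def)
  have finA: "finite A" using finite_top by (simp add: A_def)
  have "(\<Sum>I\<in>top_simplices. push_term p I) =
      (\<Sum>I\<in>A. push_term p I) + (\<Sum>I\<in>top_simplices - A. push_term p I)"
    using sum.subset_diff[of A top_simplices "push_term p"] finite_top by (auto simp: A_def add.commute)
  moreover have "(\<Sum>I\<in>A. push_term p I) = (\<Sum>K\<in>\<kappa> ` A. \<Sum>I | I \<in> A \<and> \<kappa> I = K. push_term p I)"
    by (rule sum.image_gen[OF finA])
  moreover have "regular_at (lin_form ?l) (\<Sum>K\<in>\<kappa> ` A. \<Sum>I | I \<in> A \<and> \<kappa> I = K. push_term p I)"
  proof (rule regular_at_sum[OF prime])
    fix K assume K: "K \<in> \<kappa> ` A"
    then have "K \<in> simplices \<Delta>" "Suc (card K) = CARD('n)" using \<kappa> by blast+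
    moreover have "pairing g (v j) = 0" if "j \<in> K" for j using that K by (auto simp: \<kappa>_def)
    ultimately show "regular_at (lin_form ?l) (\<Sum>I | I \<in> A \<and> \<kappa> I = K. push_term p I)"
      unfolding fiber[OF K] by (intro facet_regular complete g)
  qed
  moreover have "regular_at (lin_form ?l) (\<Sum>I\<in>top_simplices - A. push_term p I)"
  proof (rule regular_at_sum[OF prime])
    fix I assume "I \<in> top_simplices - A"
    then have I: "I \<in> top_simplices" "I \<notin> A" by auto
    have fin: "finite I" using simplex_finite top_simplexD(1)[OF I(1)] by blast
    have "\<not> lin_form ?l dvd euler_class I"
    proof
      assume "lin_form ?l dvd euler_class I"
      then obtain i where i: "i \<in> I" "lin_form ?l dvd lin_form (dual_vec v I i)"
        using prime_elem_dvd_prod[OF prime fin] by blast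
      then obtain c where c: "dual_vec v I i = c *s ?l" using lin_form_dvd_lin_form[OF l0] by blast
      then have "c \<noteq> 0" using dual_vec_nonzero[OF I(1) i(1)] by auto
      have "pairing g (v j) = 0" if "j \<in> I - {i}" for j
        using pairing_dual_vec[OF I(1) i(1), of j] that \<open>c \<noteq> 0\<close>
        by (simp add: c pairing_simps pairing_of_int_vec)
      then show False using I i by (auto simp: A_def)
    qed
    then show "regular_at (lin_form ?l) (push_term p I)"
      unfolding push_term_def to_fract_mult[symmetric] by (rule regular_at_divide)
  qed
  ultimately show ?thesis using regular_at_add[OF prime] by metis
qed

text \<open>
  The product of all \<open>u\<^sub>i\<^sup>I\<close> is a common denominator, with each factor proportional to an integral form.
\<close>

theorem pi_push_polynomial:
  assumes complete: "complete_multi_fan \<Delta>"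
  obtains f where "pi_push \<Delta> v (HT_class \<Delta> p) = to_fract f"
proof -
  let ?f = "\<Sum>I\<in>top_simplices. push_term p I"
  let ?G = "Sigma top_simplices (\<lambda>I. I)"
  let ?\<pi> = "\<lambda>(I, i). lin_form (dual_vec v I i)"
  have fin: "finite I" if "I \<in> top_simplices" for I using simplex_finite top_simplexD(1)[OF that] by blast
  have "\<exists>a. push_term p I * to_fract (\<Prod>x\<in>?G. ?\<pi> x) = to_fract a" if I: "I \<in> top_simplices" for I
  proof -
    have "(\<Prod>x\<in>?G. ?\<pi> x) = (\<Prod>I\<in>top_simplices. euler_class I)"
      using finite_top fin by (subst prod.Sigma) auto
    also have "\<dots> = euler_class I * (\<Prod>I\<in>top_simplices - {I}. euler_class I)"
      using I finite_top by (rule prod.remove[rotated])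
    finally have P: "to_fract (\<Prod>x\<in>?G. ?\<pi> x) =
        to_fract (euler_class I) * to_fract (\<Prod>I\<in>top_simplices - {I}. euler_class I)"
      by (simp only: to_fract_mult)
    have "to_fract (euler_class I) \<noteq> 0"
      using fin[OF I] dual_vec_nonzero[OF I] by (simp add: lin_form_eq_0_iff)
    then show ?thesis unfolding push_term_def P
      by (intro exI[of _ "qconst (of_int (weight \<Delta> I) / of_nat (H_order \<Delta> v I)) * restriction I p *
        (\<Prod>I\<in>top_simplices - {I}. euler_class I)"]) (simp only: to_fract_mult, simp)
  qed
  then obtain a where a: "\<And>I. I \<in> top_simplices \<Longrightarrow> push_term p I * to_fract (\<Prod>x\<in>?G. ?\<pi> x) = to_fract (a I)"
    by metis
  have "\<exists>b. ?f = to_fract b"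
  proof (rule regular_at_all_imp_polynomial)
    show "finite ?G" using finite_top fin by blast
    show "prime_elem (?\<pi> x)" if "x \<in> ?G" for x
      using that dual_vec_nonzero prime_elem_lin_form by auto
    show "regular_at (?\<pi> x) ?f" if x: "x \<in> ?G" for x
    proof -
      obtain I i where Ii: "x = (I, i)" "I \<in> top_simplices" "i \<in> I" using x by blast
      let ?u = "dual_vec v I i"
      obtain m :: int where m: "m > 0" "\<And>t. t \<in> UNIV \<Longrightarrow> \<exists>k::int. of_int m * vec_nth ?u t = of_int k"
        using common_denominator[of "UNIV :: 'n set" "vec_nth ?u"] finite by metis
      then obtain k :: "'n \<Rightarrow> int" where k: "\<And>t. of_int m * vec_nth ?u t = of_int (k t)" by (metis UNIV_I)
      define g where "g = vec_lambda k"
      have gu: "of_int_vec g = of_int m *s ?u" using k by (simp add: g_def of_int_vec_def vec_eq_iff)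
      then have "g \<noteq> 0" using m(1) dual_vec_nonzero[OF Ii(2,3)] by (auto simp: of_int_vec_hom)
      then have "regular_at (lin_form (of_int_vec g)) ?f" by (rule pi_push_regular[OF complete])
      moreover have "lin_form (of_int_vec g) dvd s" if d: "lin_form ?u dvd s" for s
      proof -
        have "lin_form ?u = qconst (1 / of_int m) * lin_form (of_int_vec g)"
          unfolding gu lin_form_hom mult.assoc[symmetric] qconst_hom(4)[symmetric]
          using m(1) by (simp add: qconst_hom)
        then show ?thesis using d by (metis dvd_mult_right)
      qed
      ultimately show ?thesis unfolding regular_at_def Ii(1) by auto
    qed
    show "?f * to_fract (\<Prod>x\<in>?G. ?\<pi> x) = to_fract (\<Sum>I\<in>top_simplices. a I)"
      by (simp only: sum_distrib_right to_fract_sum a cong: sum.cong)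
  qed
  then show ?thesis using that unfolding pi_push_HT_class by blast
qed

abbreviation push :: "'v qpoly \<Rightarrow> rat" where
  "push p \<equiv> p_push \<Delta> v (HT_class \<Delta> p)"

lemma push_eqI: "(\<Sum>I\<in>top_simplices. push_term p I) = to_fract f \<Longrightarrow> push p = lookup f 0"
  unfolding p_push_def pi_push_HT_class by simp

lemma push_add:
  assumes "complete_multi_fan \<Delta>" shows "push (p + q) = push p + push q"
proof -
  obtain f h where f: "(\<Sum>I\<in>top_simplices. push_term p I) = to_fract f"
    and h: "(\<Sum>I\<in>top_simplices. push_term q I) = to_fract h"
    using pi_push_polynomial[OF assms] unfolding pi_push_HT_class by metis
  have "(\<Sum>I\<in>top_simplices. push_term (p + q) I) = to_fract (f + h)"
    unfolding to_fract_add f[symmetric] h[symmetric] sum.distrib[symmetric]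
    by (intro sum.cong) (simp_all add: push_term_def add_divide_distrib distrib_left)
  then have "push (p + q) = lookup (f + h) 0" by (rule push_eqI)
  then show ?thesis by (simp add: lookup_add push_eqI[OF f] push_eqI[OF h])
qed

lemma push_mult:
  assumes "complete_multi_fan \<Delta>" and "\<And>I. I \<in> top_simplices \<Longrightarrow> restriction I q = e"
  shows "\<exists>f. push p = lookup f 0 \<and> push (q * p) = lookup (e * f) 0"
proof -
  obtain f where f: "(\<Sum>I\<in>top_simplices. push_term p I) = to_fract f"
    using pi_push_polynomial[OF assms(1)] unfolding pi_push_HT_class by metis
  have "(\<Sum>I\<in>top_simplices. push_term (q * p) I) = to_fract (e * f)"
    unfolding to_fract_mult f[symmetric] sum_distrib_left
    by (intro sum.cong) (simp_all add: push_term_def assms(2))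
  from push_eqI[OF f] push_eqI[OF this] show ?thesis by (intro exI[of _ f] conjI)
qed

lemma push_scale:
  assumes "complete_multi_fan \<Delta>" shows "push (qconst c * p) = c * push p"
proof -
  have "\<exists>f :: 'n qpoly. push p = lookup f 0 \<and> push (qconst c * p) = lookup (qconst c * f) 0"
    by (rule push_mult[OF assms]) simp
  then show ?thesis by (auto simp: lookup_qconst_mult_0)
qed

text \<open>
  Represents the image in the Stanley-Reisner ring of the \<open>t\<close>-th element of the basis of \<open>M\<close>.
\<close>

definition linear_relation :: "'n \<Rightarrow> 'v qpoly" where
  "linear_relation t = (\<Sum>i\<in>vertices \<Delta>. qconst (of_int (vec_nth (v i) t)) * qvar i)"

lemma sum_vertices_iota_gen:
  assumes I: "I \<in> top_simplices"
  shows "(\<Sum>i\<in>vertices \<Delta>. of_int (vec_nth (v i) t) * vec_nth (iota_gen v I i) s) = (if s = t then 1 else 0)"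
proof -
  have "(\<Sum>i\<in>vertices \<Delta>. of_int (vec_nth (v i) t) * vec_nth (iota_gen v I i) s) =
      (\<Sum>i\<in>I. of_int (vec_nth (v i) t) * vec_nth (dual_vec v I i) s)"
    using simplex_vertices[OF top_simplexD(1)[OF I]] finite_vertices
    by (intro sum.mono_neutral_cong_right) (auto simp: iota_gen_def)
  then show ?thesis using dual_vec_coordinates[OF I] by simp
qed

lemma restriction_linear_relation:
  assumes I: "I \<in> top_simplices"
  shows "restriction I (linear_relation t) = qvar t"
proof -
  have "restriction I (linear_relation t) =
      lin_form (\<Sum>i\<in>vertices \<Delta>. of_int (vec_nth (v i) t) *s iota_gen v I i)"
    by (simp add: linear_relation_def lin_form_sum lin_form_hom)
  also have "(\<Sum>i\<in>vertices \<Delta>. of_int (vec_nth (v i) t) *s iota_gen v I i) = axis t 1"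
    using sum_vertices_iota_gen[OF I, of t] by (simp add: vec_eq_iff axis_def)
  also have "lin_form (axis t 1) = (\<Sum>j\<in>UNIV. if j = t then qvar j else 0)"
    unfolding lin_form_def by (intro sum.cong) (auto simp: axis_def qconst_hom)
  finally show ?thesis by simp
qed

text \<open>
  The relation restricts to the coordinate \<open>t\<close> at every maximal simplex, so \<open>push\<close> takes the constant
  term of a multiple of this coordinate.
\<close>

lemma push_linear_relation:
  assumes "complete_multi_fan \<Delta>" shows "push (linear_relation t * p) = 0"
proof -
  obtain f where "push (linear_relation t * p) = lookup (qvar t * f) 0"
    using push_mult[OF assms restriction_linear_relation, of p t] by auto
  then show ?thesis by (simp add: lookup_qvar_mult_0)
qed

lemma prod_nonface_eq_0:
  assumes I: "I \<in> top_simplices" and g: "\<And>i. i \<notin> I \<Longrightarrow> g i = 0" and m: "keys m \<notin> simplices \<Delta>"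
  shows "qsubst g (xmono m) = 0"
proof -
  have "\<not> keys m \<subseteq> I" using m I simplex_subset top_simplexD by metis
  then obtain i where "i \<in> keys m" "g i = 0" using g by blast
  then show ?thesis
    unfolding xmono_eq_prod qsubst_prod
    by (intro prod_zero bexI[of _ i]) (auto simp: in_keys_iff zero_power)
qed

lemma push_nonface:
  assumes "complete_multi_fan \<Delta>" and m: "keys m \<notin> simplices \<Delta>"
  shows "push (q * xmono m) = 0"
proof -
  have "push (xmono m * q) = 0"
  proof -
    have "restriction I (xmono m) = 0" if I: "I \<in> top_simplices" for I
      by (rule prod_nonface_eq_0[OF I _ m]) (simp add: iota_gen_def lin_form_hom)
    then obtain f where "push (xmono m * q) = lookup (0 * f) 0"
      using push_mult[OF assms(1), of "xmono m" 0 q] by auto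
    then show ?thesis by simp
  qed
  then show ?thesis by (simp add: mult.commute)
qed

abbreviation exp_push :: "'v qpoly \<Rightarrow> 'v qpoly \<Rightarrow> rat" where
  "exp_push q p \<equiv> p_push_exp \<Delta> v (HT_class \<Delta> q) (HT_class \<Delta> p)"

lemma exp_push_eq:
  assumes "qvars q \<subseteq> vertices \<Delta>" "qvars p \<subseteq> vertices \<Delta>"
  shows "exp_push q p = (\<Sum>m\<le>CARD('n). push (q ^ m * p) / fact m)"
  unfolding p_push_exp_def
  by (intro sum.cong refl)
    (simp add: HT_class_power[OF assms(1)] HT_class_mult[OF qvars_power[OF assms(1)] assms(2)])

context
  fixes q :: "'v qpoly"
  assumes complete: "complete_multi_fan \<Delta>" and q: "qvars q \<subseteq> vertices \<Delta>"
begin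

lemma exp_push_add:
  assumes "qvars p \<subseteq> vertices \<Delta>" "qvars p' \<subseteq> vertices \<Delta>"
  shows "exp_push q (p + p') = exp_push q p + exp_push q p'"
  using assms qvars_add[OF assms]
  by (simp add: exp_push_eq[OF q] distrib_left push_add[OF complete] add_divide_distrib sum.distrib)

lemma exp_push_scale:
  assumes "qvars p \<subseteq> vertices \<Delta>"
  shows "exp_push q (qconst c * p) = c * exp_push q p"
proof -
  have "push (q ^ m * (qconst c * p)) = c * push (q ^ m * p)" for m
    using push_scale[OF complete, of c "q ^ m * p"] by (simp add: mult.left_commute)
  moreover have "qvars (qconst c * p) \<subseteq> vertices \<Delta>" by (rule qvars_mult) (simp_all add: qvars_hom assms)
  ultimately show ?thesis by (simp add: exp_push_eq[OF q] assms sum_distrib_left)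
qed

lemma exp_push_sum:
  assumes "\<And>a. a \<in> A \<Longrightarrow> qvars (f a) \<subseteq> vertices \<Delta>"
  shows "exp_push q (\<Sum>a\<in>A. f a) = (\<Sum>a\<in>A. exp_push q (f a))"
proof -
  have z: "exp_push q 0 = 0" using exp_push_scale[of 0 0] by (simp add: qvars_hom)
  show ?thesis using assms
    by (induction A rule: infinite_finite_induct) (simp_all add: z exp_push_add qvars_sum)
qed

lemma exp_push_linear_relation:
  assumes "qvars p \<subseteq> vertices \<Delta>"
  shows "exp_push q (linear_relation t * p) = 0"
proof -
  have "push (q ^ m * (linear_relation t * p)) = 0" for m
    using push_linear_relation[OF complete, of t "q ^ m * p"] by (simp add: mult.left_commute)
  moreover have "qvars (linear_relation t * p) \<subseteq> vertices \<Delta>"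
    unfolding linear_relation_def
    by (intro qvars_mult qvars_sum assms) (auto simp: qvars_hom)
  ultimately show ?thesis by (simp add: exp_push_eq[OF q])
qed

lemma exp_push_nonface:
  assumes "keys m \<subseteq> vertices \<Delta>" "keys m \<notin> simplices \<Delta>"
  shows "exp_push q (xmono m) = 0"
  using push_nonface[OF complete assms(2)] assms(1) by (simp add: exp_push_eq[OF q] qvars_xmono)

end

end

section \<open>Determinants of variable size\<close>

lemma det_size_transpose: "det_size r (\<lambda>a b. A b a) = det_size r A"
proof -
  have "det_size r A = (\<Sum>p | p permutes {..<r}. of_int (sign (inv_into UNIV p)) * (\<Prod>a<r. A a (inv_into UNIV p a)))"
    unfolding det_size_def by (rule sum_permutations_inverse)
  also have "\<dots> = (\<Sum>p | p permutes {..<r}. of_int (sign p) * (\<Prod>a<r. A (p a) a))"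
  proof (intro sum.cong refl, clarify)
    fix p assume p: "p permutes {..<r}"
    have "(\<Prod>a<r. A a (inv_into UNIV p a)) = (\<Prod>a<r. A (p a) (inv_into UNIV p (p a)))"
      using prod.permute[OF p, of "\<lambda>a. A a (inv_into UNIV p a)"] by (simp add: o_def)
    then show "of_int (sign (inv_into UNIV p)) * (\<Prod>a<r. A a (inv_into UNIV p a)) = of_int (sign p) * (\<Prod>a<r. A (p a) a)"
      using sign_inverse[OF permutes_imp_permutation[OF _ p]] permutes_inverses(2)[OF p] by simp
  qed
  finally show ?thesis by (simp add: det_size_def)
qed

lemma det_size_permute_rows:
  assumes s: "s permutes {..<r}"
  shows "det_size r (\<lambda>a b. A (s a) b) = of_int (sign s) * det_size r A"
proof -
  have "det_size r (\<lambda>a b. A (s a) b) =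
      (\<Sum>p | p permutes {..<r}. of_int (sign (p \<circ> s)) * (\<Prod>a<r. A (s a) ((p \<circ> s) a)))"
    unfolding det_size_def by (rule sum_permutations_compose_right[OF s])
  also have "\<dots> = (\<Sum>p | p permutes {..<r}. of_int (sign s) * (of_int (sign p) * (\<Prod>a<r. A a (p a))))"
  proof (intro sum.cong refl, clarify)
    fix p assume p: "p permutes {..<r}"
    have "(\<Prod>a<r. A (s a) (p (s a))) = (\<Prod>a<r. A a (p a))"
      using prod.permute[OF s, of "\<lambda>a. A a (p a)"] by (simp add: o_def)
    moreover have "sign (p \<circ> s) = sign s * sign p"
      using sign_compose[OF permutes_imp_permutation[OF _ p] permutes_imp_permutation[OF _ s]] by simp
    ultimately show "of_int (sign (p \<circ> s)) * (\<Prod>a<r. A (s a) ((p \<circ> s) a)) =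
      of_int (sign s) * (of_int (sign p) * (\<Prod>a<r. A a (p a)))" by (simp add: mult_ac)
  qed
  finally show ?thesis by (simp add: det_size_def sum_distrib_left)
qed

text \<open>
  Composition with the transposition of the two rows exchanges even and odd permutations.
\<close>

lemma det_size_identical_rows:
  assumes cd: "c < r" "d < r" "c \<noteq> d" and eq: "\<And>b. b < r \<Longrightarrow> A c b = A d b"
  shows "det_size r A = 0"
proof -
  let ?t = "Transposition.transpose c d"
  let ?h = "\<lambda>p. of_int (sign p) * (\<Prod>a<r. A a (p a))"
  have t: "?t permutes {..<r}" using cd by (intro permutes_swap_id) auto
  have sg: "sign (p \<circ> ?t) = - sign p" if "p permutes {..<r}" for p
    using sign_compose[OF permutes_imp_permutation[OF _ that] permutes_imp_permutation[OF _ t]] cd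
    by (simp add: sign_swap_id)
  have ev: "evenperm (p \<circ> ?t) \<longleftrightarrow> \<not> evenperm p" if "p permutes {..<r}" for p
    using sg[OF that] by (auto simp: sign_def split: if_splits)
  have h: "?h (p \<circ> ?t) = - ?h p" if p: "p permutes {..<r}" for p
  proof -
    have "(\<Prod>a<r. A a (p (?t a))) = (\<Prod>a<r. A (?t a) (p a))"
      using prod.permute[OF t, of "\<lambda>a. A a (p (?t a))"] by (simp add: o_def)
    also have "\<dots> = (\<Prod>a<r. A a (p a))"
      using eq permutes_in_image[OF p] by (intro prod.cong) (auto simp: Transposition.transpose_def)
    finally show ?thesis by (simp add: sg[OF p])
  qed
  have fin: "finite {p. p permutes {..<r}}" by (simp add: finite_permutations)
  let ?E = "{p. p permutes {..<r} \<and> evenperm p}" and ?O = "{p. p permutes {..<r} \<and> \<not> evenperm p}"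
  have "(\<Sum>p\<in>?O. ?h p) = (\<Sum>p\<in>?E. ?h (p \<circ> ?t))"
    by (rule sum.reindex_bij_witness[of _ "\<lambda>p. p \<circ> ?t" "\<lambda>p. p \<circ> ?t"])
      (auto simp: ev o_assoc[symmetric] intro!: permutes_compose[OF t])
  also have "\<dots> = - (\<Sum>p\<in>?E. ?h p)"
    unfolding sum_negf[symmetric] by (intro sum.cong refl h) auto
  finally have *: "(\<Sum>p\<in>?O. ?h p) = - (\<Sum>p\<in>?E. ?h p)" .
  have "det_size r A = (\<Sum>p\<in>?E \<union> ?O. ?h p)"
    unfolding det_size_def by (intro sum.cong) auto
  also have "\<dots> = (\<Sum>p\<in>?E. ?h p) + (\<Sum>p\<in>?O. ?h p)"
    using fin by (intro sum.union_disjoint) (auto elim: finite_subset[rotated])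
  finally show ?thesis using * by simp
qed

lemma det_size_cong: "(\<And>a b. a < r \<Longrightarrow> b < r \<Longrightarrow> A a b = B a b) \<Longrightarrow> det_size r A = det_size r B"
  unfolding det_size_def using permutes_in_image
  by (intro sum.cong refl arg_cong2[where f = "(*)"] prod.cong) fastforce+

lemma det_size_zero_row:
  assumes "c < r" "\<And>b. b < r \<Longrightarrow> A c b = 0" shows "det_size r A = 0"
  unfolding det_size_def
proof (rule sum.neutral, clarify)
  fix p assume p: "p permutes {..<r}"
  have "(\<Prod>a<r. A a (p a)) = 0"
    using assms permutes_in_image[OF p, of c] by (intro prod_zero) auto
  then show "of_int (sign p) * (\<Prod>a<r. A a (p a)) = 0" by simp
qed

lemma det_size_row0_linear:
  assumes "0 < r"
  shows "det_size r (\<lambda>a b. if a = 0 then \<Sum>s\<in>S. c s * f s b else A a b) =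
    (\<Sum>s\<in>S. c s * det_size r (\<lambda>a b. if a = 0 then f s b else A a b))"
proof -
  obtain q where r: "r = Suc q" using assms by (cases r) auto
  show ?thesis
    unfolding det_size_def r prod.lessThan_Suc_shift
    by (simp add: sum_distrib_left sum_distrib_right mult_ac) (rule sum.swap)
qed

lemma det_size_1: "det_size r (\<lambda>a b. if a = b then 1 else 0) = 1"
proof -
  have "(\<Prod>a<r. if a = p a then 1 else 0 :: 'a) = (if p = id then 1 else 0)" if "p permutes {..<r}" for p
  proof (cases "p = id")
    case False
    then obtain a where "p a \<noteq> a" by (auto simp: fun_eq_iff)
    then have "a \<in> {..<r}" "(if a = p a then 1 else 0 :: 'a) = 0"
      using permutes_not_in[OF that] by auto
    then have "(\<Prod>a<r. if a = p a then 1 else 0 :: 'a) = 0"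
      by (intro prod_zero) blast+
    then show ?thesis using False by simp
  qed simp
  then have "det_size r (\<lambda>a b. if a = b then 1 else 0 :: 'a) =
      (\<Sum>p | p permutes {..<r}. if p = id then 1 else 0)"
    unfolding det_size_def by (intro sum.cong) auto
  then show ?thesis by (simp add: finite_permutations permutes_id)
qed

text \<open>
  Expanding all entries gives a sum over maps \<open>f\<close> from rows to columns.  A map that is not injective
  contributes a determinant with equal rows; the injective maps with image \<open>S\<close> are the permutations of
  the increasing enumeration of \<open>S\<close>.
\<close>

theorem Cauchy_Binet:
  fixes A B :: "nat \<Rightarrow> 'n::{finite,linorder} \<Rightarrow> 'a::comm_ring_1"
  shows "det_size r (\<lambda>a b. \<Sum>i\<in>UNIV. A a i * B b i) =
    (\<Sum>S | card S = r. det_size r (\<lambda>a b. A a (sorted_list_of_set S ! b)) *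
       det_size r (\<lambda>a b. B a (sorted_list_of_set S ! b)))"
proof -
  let ?P = "{p. p permutes {..<r}}"
  let ?F = "{..<r} \<rightarrow>\<^sub>E (UNIV :: 'n set)"
  define W where "W f = (\<Prod>a<r. A a (f a)) * det_size r (\<lambda>a b. B b (f a))" for f
  have finF: "finite ?F" by (intro finite_PiE) auto
  have "det_size r (\<lambda>a b. \<Sum>i\<in>UNIV. A a i * B b i) =
    (\<Sum>p\<in>?P. of_int (sign p) * (\<Sum>f\<in>?F. \<Prod>a<r. A a (f a) * B (p a) (f a)))"
    unfolding det_size_def by (subst prod_sum_PiE) auto
  also have "\<dots> = (\<Sum>f\<in>?F. W f)"
    unfolding W_def det_size_def sum_distrib_left prod.distrib
    by (subst sum.swap) (simp add: mult_ac)
  also have "\<dots> = (\<Sum>f | f \<in> ?F \<and> inj_on f {..<r}. W f)"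
  proof (rule sum.mono_neutral_right[OF finF])
    show "\<forall>f\<in>?F - {f \<in> ?F. inj_on f {..<r}}. W f = 0"
    proof
      fix f assume "f \<in> ?F - {f \<in> ?F. inj_on f {..<r}}"
      then obtain c d where "c < r" "d < r" "c \<noteq> d" "f c = f d" by (auto simp: inj_on_def)
      then have "det_size r (\<lambda>a b. B b (f a)) = 0" by (intro det_size_identical_rows[of c r d]) auto
      then show "W f = 0" by (simp add: W_def)
    qed
  qed auto
  also have "\<dots> = (\<Sum>S | card S = r. \<Sum>f | f \<in> {f. f \<in> ?F \<and> inj_on f {..<r}} \<and> f ` {..<r} = S. W f)"
  proof (rule sum.group[symmetric])
    show "finite {f. f \<in> ?F \<and> inj_on f {..<r}}"
      by (rule finite_subset[OF _ finF]) blast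
    show "(\<lambda>f. f ` {..<r}) ` {f. f \<in> ?F \<and> inj_on f {..<r}} \<subseteq> {S. card S = r}"
      by (clarsimp simp: card_image)
  qed simp
  also have "\<dots> = (\<Sum>S | card S = r. det_size r (\<lambda>a b. A a (sorted_list_of_set S ! b)) *
       det_size r (\<lambda>a b. B a (sorted_list_of_set S ! b)))"
  proof (rule sum.cong[OF refl])
    fix S :: "'n set" assume "S \<in> {S. card S = r}"
    then have rS: "card S = r" by simp
    define s where "s = (!) (sorted_list_of_set S)"
    have s: "bij_betw s {..<r} S"
      unfolding s_def using rS by (intro bij_betw_nth) auto
    have D: "det_size r (\<lambda>a b. B b (s (p a))) = of_int (sign p) * det_size r (\<lambda>a b. B a (s b))"
      if "p \<in> ?P" for p
      using det_size_permute_rows[of p r "\<lambda>a b. B b (s a)"] that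
        det_size_transpose[of r "\<lambda>a b. B b (s a)"] by simp
    let ?G = "{f. f \<in> {f. f \<in> ?F \<and> inj_on f {..<r}} \<and> f ` {..<r} = S}"
    have "bij_betw (\<lambda>p. restrict (s \<circ> p) {..<r}) ?P ?G"
    proof (rule bij_betwI')
      fix p q assume p: "p \<in> ?P" and q: "q \<in> ?P"
      show "(restrict (s \<circ> p) {..<r} = restrict (s \<circ> q) {..<r}) = (p = q)"
      proof
        assume e: "restrict (s \<circ> p) {..<r} = restrict (s \<circ> q) {..<r}"
        show "p = q"
        proof
          fix a show "p a = q a"
          proof (cases "a < r")
            case True
            have "s (p a) = s (q a)" using fun_cong[OF e, of a] True by simp
            moreover have "p a < r" "q a < r" using p q permutes_in_image True by fastforce+
            ultimately show ?thesis using s by (auto simp: bij_betw_def inj_on_def)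
          next
            case False
            then show ?thesis using p q permutes_not_in by (metis lessThan_iff mem_Collect_eq)
          qed
        qed
      qed simp
    next
      fix p assume "p \<in> ?P"
      then have "bij_betw p {..<r} {..<r}" by (auto intro: permutes_imp_bij)
      then have "bij_betw (s \<circ> p) {..<r} S" using s by (rule bij_betw_trans)
      then show "restrict (s \<circ> p) {..<r} \<in> ?G" by (auto simp: bij_betw_def)
    next
      fix f assume f: "f \<in> ?G"
      define p where "p a = (if a < r then inv_into {..<r} s (f a) else a)" for a
      have "bij_betw f {..<r} S" using f by (auto simp: bij_betw_def)
      then have "bij_betw (inv_into {..<r} s \<circ> f) {..<r} {..<r}"
        using bij_betw_inv_into[OF s] by (rule bij_betw_trans)
      then have "bij_betw p {..<r} {..<r}"
        by (subst bij_betw_cong[of _ p "inv_into {..<r} s \<circ> f"]) (auto simp: p_def)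
      then have p: "p permutes {..<r}" by (intro bij_imp_permutes) (auto simp: p_def)
      have "f = restrict (s \<circ> p) {..<r}"
      proof
        fix a show "f a = restrict (s \<circ> p) {..<r} a"
        proof (cases "a < r")
          case True
          then have "f a \<in> S" using f by auto
          then show ?thesis using True bij_betw_inv_into_right[OF s] by (simp add: p_def)
        next
          case False
          then show ?thesis using f by (auto simp: PiE_def extensional_def)
        qed
      qed
      then show "\<exists>p\<in>?P. f = restrict (s \<circ> p) {..<r}" using p by blast
    qed
    then have "(\<Sum>f\<in>?G. W f) = (\<Sum>p\<in>?P. W (restrict (s \<circ> p) {..<r}))"
      by (rule sum.reindex_bij_betw[symmetric])
    also have "\<dots> = (\<Sum>p\<in>?P. (of_int (sign p) * (\<Prod>a<r. A a (s (p a)))) * det_size r (\<lambda>a b. B a (s b)))"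
    proof (rule sum.cong[OF refl])
      fix p assume p: "p \<in> ?P"
      have "W (restrict (s \<circ> p) {..<r}) = (\<Prod>a<r. A a (s (p a))) * det_size r (\<lambda>a b. B b (s (p a)))"
        unfolding W_def by (intro arg_cong2[where f = "(*)"] prod.cong det_size_cong) auto
      then show "W (restrict (s \<circ> p) {..<r}) =
          (of_int (sign p) * (\<Prod>a<r. A a (s (p a)))) * det_size r (\<lambda>a b. B a (s b))"
        using D[OF p] by (simp add: mult_ac)
    qed
    also have "\<dots> = det_size r (\<lambda>a b. A a (s b)) * det_size r (\<lambda>a b. B a (s b))"
      by (simp only: sum_distrib_right[symmetric] det_size_def[of r "\<lambda>a b. A a (s b)"])
    finally show "(\<Sum>f\<in>?G. W f) = det_size r (\<lambda>a b. A a (sorted_list_of_set S ! b)) *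
       det_size r (\<lambda>a b. B a (sorted_list_of_set S ! b))" unfolding s_def .
  qed
  finally show ?thesis .
qed

section \<open>Wedge products and the generic plane\<close>

lemma det_size_qconst: "qconst (det_size r A) = det_size r (\<lambda>a b. qconst (A a b))"
  by (simp add: det_size_def qconst_sum qconst_prod qconst_hom qconst_of_int)

lemma det_size_qsubst: "qsubst g (det_size r A) = det_size r (\<lambda>a b. qsubst g (A a b))"
  by (simp add: det_size_def)

lemma det_size_to_fract: "to_fract (det_size r A) = det_size r (\<lambda>a b. to_fract (A a b))"
  by (simp add: det_size_def)

lemma qsubst_qsubst: "qsubst g (qsubst h p) = qsubst (\<lambda>i. qsubst g (h i)) p"
  by (induction p rule: qpoly_induct) simp_all

lemma qvars_wedge: "qvars (wedge us) \<subseteq> {S. card S = length us}"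
  unfolding wedge_def by (intro qvars_sum qvars_mult) (auto simp: qvars_hom)

lemma homogeneous_wedge: "homogeneous 1 (wedge us)"
  unfolding wedge_def
  using homogeneous_mult[OF homogeneous_qconst homogeneous_qvar] by (intro homogeneous_sum) simp

lemma wedge_zero:
  fixes us :: "(rat, 'n::{finite,linorder}) vec list"
  shows "wedge (0 # us) = 0"
proof -
  have "det_size (length (0 # us)) (\<lambda>a b. vec_nth ((0 # us) ! a) (sorted_list_of_set S ! b)) = 0" for S :: "'n set"
    by (rule det_size_zero_row[of 0]) simp_all
  then show ?thesis unfolding wedge_def by (simp only: qconst_hom mult_zero_left sum.neutral_const)
qed

text \<open>
  The value of the form \<open>u\<close> at the \<open>b\<close>-th row of the generic matrix.
\<close>

definition row_pairing :: "(rat, 'n) vec \<Rightarrow> nat \<Rightarrow> 'n::{finite,linorder} entry qpoly" where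
  "row_pairing u b = (\<Sum>i\<in>UNIV. qconst (vec_nth u i) * qvar (Entry b i))"

lemma plucker_wedge:
  "plucker (length us) (wedge us) = det_size (length us) (\<lambda>a b. row_pairing (us ! a) b)"
  unfolding row_pairing_def Cauchy_Binet wedge_def plucker_def
  by (simp add: det_size_qconst det_size_qsubst)

lemma row_pairing_sum_scale:
  "row_pairing (\<Sum>a\<in>A. c a *s f a) b = (\<Sum>a\<in>A. qconst (c a) * row_pairing (f a) b)"
  unfolding row_pairing_def
  by (simp add: qconst_sum qconst_hom sum_distrib_left sum_distrib_right mult_ac) (rule sum.swap)

lemma plucker_wedge_Cons:
  "plucker (Suc (length us)) (wedge (u # us)) =
    det_size (Suc (length us)) (\<lambda>a b. if a = 0 then row_pairing u b else row_pairing (us ! (a - 1)) b)"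
  using plucker_wedge[of "u # us"] by (auto intro!: det_size_cong simp: nth_Cons')

lemma plucker_wedge_linear:
  "plucker (Suc (length us)) (wedge ((\<Sum>a\<in>A. c a *s f a) # us)) =
    (\<Sum>a\<in>A. qconst (c a) * plucker (Suc (length us)) (wedge (f a # us)))"
  unfolding plucker_wedge_Cons row_pairing_sum_scale by (rule det_size_row0_linear) simp

lemma plucker_wedge_repeated:
  assumes "a < length us" shows "plucker (Suc (length us)) (wedge (us ! a # us)) = 0"
  unfolding plucker_wedge_Cons using assms by (intro det_size_identical_rows[of 0 _ "Suc a"]) auto

lemma row_pairing_axis: "row_pairing (axis s 1) b = qvar (Entry b s)"
proof -
  have "row_pairing (axis s 1) b = (\<Sum>i\<in>UNIV. if i = s then qvar (Entry b i) else 0)"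
    unfolding row_pairing_def by (intro sum.cong) (auto simp: axis_def qconst_hom)
  then show ?thesis by simp
qed

text \<open>
  The coefficients here are those of the pulled back wedge product as a linear form in its first
  factor.  At a form \<open>y\<close> that vanishes on the generic plane, the first row of the determinant is zero.
\<close>

lemma plucker_wedge_orthogonal:
  assumes "\<And>b. b \<le> length us \<Longrightarrow> (\<Sum>s\<in>UNIV. y s * to_fract (qvar (Entry b s))) = 0"
  shows "(\<Sum>s\<in>UNIV. y s * to_fract (plucker (Suc (length us)) (wedge (axis s 1 # us)))) = 0"
proof -
  let ?r = "Suc (length us)"
  have "(\<Sum>s\<in>UNIV. y s * to_fract (plucker ?r (wedge (axis s 1 # us)))) =
    det_size ?r (\<lambda>a b. if a = 0 then \<Sum>s\<in>UNIV. y s * to_fract (qvar (Entry b s))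
      else to_fract (row_pairing (us ! (a - 1)) b))"
    unfolding plucker_wedge_Cons det_size_to_fract if_distrib[of to_fract] row_pairing_axis
    by (rule det_size_row0_linear[symmetric]) simp
  also have "\<dots> = 0" by (rule det_size_zero_row[of 0]) (use assms in auto)
  finally show ?thesis .
qed

lemma wedge_coordinates:
  "plucker (Suc (length us)) (wedge (u # us)) =
    (\<Sum>s\<in>UNIV. qconst (vec_nth u s) * plucker (Suc (length us)) (wedge (axis s 1 # us)))"
proof -
  have "u = (\<Sum>s\<in>UNIV. vec_nth u s *s axis s 1)"
    by (simp add: vec_eq_iff axis_def if_distrib[of "\<lambda>x. _ * x"] cong: if_cong)
  then show ?thesis
    using plucker_wedge_linear[of us "vec_nth u" "\<lambda>s. axis s 1" UNIV] by simp
qed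

lemma family_independent:
  fixes f :: "'i \<Rightarrow> (rat, 'n::finite) vec"
  assumes A: "finite A" and ind: "\<And>c. (\<Sum>a\<in>A. c a *s f a) = 0 \<Longrightarrow> \<forall>a\<in>A. c a = 0"
  shows "inj_on f A" "vec.independent (f ` A)"
proof -
  show inj: "inj_on f A"
  proof (rule inj_onI, rule ccontr)
    fix a b assume ab: "a \<in> A" "b \<in> A" "f a = f b" "a \<noteq> b"
    let ?c = "\<lambda>x. (if x = a then 1 else 0) - (if x = b then 1 else 0) :: rat"
    have "(\<Sum>x\<in>A. ?c x *s f x) = (\<Sum>x\<in>A. if x = a then f x else 0) - (\<Sum>x\<in>A. if x = b then f x else 0)"
      unfolding sum_subtractf[symmetric] by (intro sum.cong) (auto simp: vector_sub_rdistrib)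
    also have "\<dots> = 0" using ab A by simp
    finally have "?c a = 0" using ind[of ?c] ab(1) by blast
    then show False using ab(4) by simp
  qed
  show "vec.independent (f ` A)"
    unfolding vec.independent_explicit
  proof (intro conjI allI impI ballI)
    show "finite (f ` A)" using A by simp
    fix c x assume "(\<Sum>x\<in>f ` A. c x *s x) = 0" "x \<in> f ` A"
    then show "c x = 0" using ind[of "c \<circ> f"] by (auto simp: sum.reindex[OF inj])
  qed
qed

lemma dual_family_exists:
  fixes f :: "nat \<Rightarrow> (rat, 'n::finite) vec"
  assumes ind: "\<And>c. (\<Sum>a<r. c a *s f a) = 0 \<Longrightarrow> \<forall>a<r. c a = 0"
  shows "\<exists>g. \<forall>b<r. \<forall>a<r. pairing (f a) (g b) = (if a = b then 1 else 0)"
proof -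
  have B: "inj_on f {..<r}" "vec.independent (f ` {..<r})"
    using family_independent[of "{..<r}" f] ind by auto
  obtain i0 :: 'n where True by blast
  have "\<exists>w. \<forall>a<r. pairing (f a) w = (if a = b then 1 else 0)" if b: "b < r" for b
  proof -
    obtain h where h: "Vector_Spaces.linear (*s) (*s) h"
      "\<forall>x\<in>f ` {..<r}. h x = (if x = f b then axis i0 1 else 0 :: (rat, 'n) vec)"
      using vec.linear_independent_extend[OF B(2), of "\<lambda>x. if x = f b then axis i0 1 else 0"] by blast
    have "pairing (f a) (vec_nth (matrix h) i0) = (if a = b then 1 else 0)" if a: "a < r" for a
    proof -
      have "pairing (f a) (vec_nth (matrix h) i0) = vec_nth (matrix h *v f a) i0"
        by (simp add: pairing_def matrix_vector_mult_def mult.commute)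
      also have "\<dots> = vec_nth (h (f a)) i0" using matrix_works[OF h(1)] by simp
      also have "\<dots> = (if f a = f b then 1 else 0)" using h(2) a by (simp add: axis_def)
      also have "f a = f b \<longleftrightarrow> a = b" using B(1) a b by (auto simp: inj_on_def)
      finally show ?thesis .
    qed
    then show ?thesis by blast
  qed
  then show ?thesis by metis
qed

text \<open>
  Specializing the generic rows to a dual family turns the matrix of pairings into the identity.
\<close>

lemma plucker_wedge_nonzero:
  fixes us :: "(rat, 'n::{finite,linorder}) vec list"
  assumes ind: "\<And>c. (\<Sum>a<length us. c a *s us ! a) = 0 \<Longrightarrow> \<forall>a<length us. c a = 0"
  shows "plucker (length us) (wedge us) \<noteq> 0"
proof -
  obtain g where g: "\<forall>b<length us. \<forall>a<length us. pairing (us ! a) (g b) = (if a = b then 1 else 0)"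
    using dual_family_exists[where f = "(!) us" and r = "length us", OF ind] ..
  let ?h = "\<lambda>x :: 'n entry. (case x of Entry b s \<Rightarrow> qconst (vec_nth (g b) s)) :: 'n qpoly"
  have "qsubst ?h (row_pairing u b) = qconst (pairing u (g b))" for u b
    by (simp add: row_pairing_def pairing_def qconst_sum qconst_hom)
  then have "qsubst ?h (plucker (length us) (wedge us)) =
      det_size (length us) (\<lambda>a b. qconst (pairing (us ! a) (g b)))"
    by (simp add: plucker_wedge det_size_qsubst)
  also have "\<dots> = det_size (length us) (\<lambda>a b. if a = b then 1 else 0)"
    by (rule det_size_cong) (simp add: g qconst_hom)
  also have "\<dots> = 1" by (rule det_size_1)
  finally show ?thesis by auto
qed

context multi_fan_with_edges
begin

abbreviation annihilator_basis :: "'v set \<Rightarrow> (rat, 'n) vec list" where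
  "annihilator_basis J \<equiv> map of_int_vec (omega_basis \<Delta> J)"

lemma lattice_basis_omega:
  assumes J: "J \<in> simplices \<Delta>"
  shows "lattice_basis (omega_basis \<Delta> J) {u. \<forall>j\<in>J. pairing u (v j) = 0}"
proof -
  have "\<exists>us. lattice_basis us {u. \<forall>j\<in>J. pairing u (v j) = 0}"
    by (rule lattice_basis_exists) (auto simp: pairing_simps)
  then show ?thesis
    unfolding omega_basis_def annihilator_sublattice_of[OF J] by (rule someI_ex)
qed

lemma annihilator_basis_independent:
  assumes J: "J \<in> simplices \<Delta>"
    and z: "(\<Sum>a<length (omega_basis \<Delta> J). c a *s of_int_vec (omega_basis \<Delta> J ! a)) = (0 :: (rat, 'n) vec)"
    and a: "a < length (omega_basis \<Delta> J)"
  shows "c a = 0"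
proof -
  let ?w = "omega_basis \<Delta> J"
  obtain m :: int where m: "m > 0" "\<And>a. a \<in> {..<length ?w} \<Longrightarrow> \<exists>k::int. of_int m * c a = of_int k"
    using common_denominator[of "{..<length ?w}" c] by auto
  then obtain k :: "nat \<Rightarrow> int" where k: "\<And>a. a < length ?w \<Longrightarrow> of_int m * c a = of_int (k a)"
    by (metis lessThan_iff)
  have "of_int_vec (\<Sum>a<length ?w. k a *s ?w ! a) =
      of_int m *s (\<Sum>a<length ?w. c a *s (of_int_vec (?w ! a) :: (rat, 'n) vec))"
    unfolding vec.scale_sum_right of_int_vec_sum
    by (intro sum.cong refl) (simp add: of_int_vec_hom k)
  also have "\<dots> = of_int_vec 0" by (simp add: z of_int_vec_hom)
  finally have "(\<Sum>a<length ?w. k a *s ?w ! a) = 0" by (simp only: of_int_vec_eq_iff)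
  then have "k a = 0" using lattice_basisD(3)[OF lattice_basis_omega[OF J]] a by blast
  then show ?thesis using k[OF a] m(1) by simp
qed

lemma annihilator_basis_spans:
  fixes u :: "(rat, 'n) vec"
  assumes J: "J \<in> simplices \<Delta>" and u: "\<And>j. j \<in> J \<Longrightarrow> pairing u (of_int_vec (v j)) = 0"
  obtains c where "u = (\<Sum>a<length (omega_basis \<Delta> J). c a *s annihilator_basis J ! a)"
proof -
  let ?w = "omega_basis \<Delta> J"
  obtain m :: int where m: "m > 0" "\<And>t. t \<in> UNIV \<Longrightarrow> \<exists>k::int. of_int m * vec_nth u t = of_int k"
    using common_denominator[of "UNIV :: 'n set" "vec_nth u"] finite by metis
  then obtain k :: "'n \<Rightarrow> int" where k: "\<And>t. of_int m * vec_nth u t = of_int (k t)" by (metis UNIV_I)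
  define g where "g = vec_lambda k"
  have gu: "of_int_vec g = of_int m *s u" using k by (simp add: g_def of_int_vec_def vec_eq_iff)
  have "pairing g (v j) = 0" if "j \<in> J" for j
  proof -
    have "(of_int (pairing g (v j)) :: rat) = of_int m * pairing u (of_int_vec (v j))"
      unfolding pairing_of_int_vec[symmetric] gu by (simp add: pairing_simps)
    then show ?thesis using u[OF that] by simp
  qed
  then have "g \<in> {u. \<forall>j\<in>J. pairing u (v j) = 0}" by blast
  then obtain c where c: "g = (\<Sum>a<length ?w. c a *s ?w ! a)"
    using lattice_basisD(1)[OF lattice_basis_omega[OF J]] by blast
  have "u = (1 / of_int m) *s of_int_vec g" using m(1) by (simp add: gu)
  also have "\<dots> = (\<Sum>a<length ?w. (of_int (c a) / of_int m) *s annihilator_basis J ! a)"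
    unfolding c of_int_vec_sum vec.scale_sum_right by (intro sum.cong) (simp_all add: of_int_vec_hom)
  finally show ?thesis by (rule that)
qed

lemma pairing_annihilator_basis:
  assumes J: "J \<in> simplices \<Delta>" and "a < length (omega_basis \<Delta> J)" "j \<in> J"
  shows "pairing (annihilator_basis J ! a) (of_int_vec (v j)) = 0"
  using lattice_basisD(2)[OF lattice_basis_omega[OF J] assms(2)] assms(2,3)
  by (simp add: pairing_of_int_vec)

text \<open>
  The forms that vanish on \<open>N\<^sub>J\<close> have two rational bases: the given lattice basis, and the dual vectors of
  the vertices outside \<open>J\<close> of a maximal simplex.
\<close>

lemma length_omega_basis:
  assumes J: "J \<in> simplices \<Delta>"
  shows "length (omega_basis \<Delta> J) + card J = CARD('n)"
proof -
  let ?w = "omega_basis \<Delta> J" and ?W = "{u :: (rat, 'n) vec. \<forall>j\<in>J. pairing u (of_int_vec (v j)) = 0}"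
  obtain I where I: "I \<in> top_simplices" "J \<subseteq> I" using simplex_in_top[OF J] by blast
  have fin: "finite I" using simplex_finite top_simplexD(1)[OF I(1)] by blast
  have "vec.dim ?W = card (I - J)"
  proof (rule vec.dim_unique)
    have ind: "\<forall>i\<in>I - J. c i = 0" if "(\<Sum>i\<in>I - J. c i *s dual_vec v I i) = 0" for c
    proof
      fix j assume j: "j \<in> I - J"
      have "0 = pairing (\<Sum>i\<in>I - J. c i *s dual_vec v I i) (of_int_vec (v j))"
        using that by (simp add: pairing_simps)
      also have "\<dots> = (\<Sum>i\<in>I - J. if i = j then c i else 0)"
        unfolding pairing_sum pairing_simps using pairing_dual_vec[OF I(1)] j
        by (intro sum.cong) auto
      finally show "c j = 0" using j fin by simp
    qed
    show "dual_vec v I ` (I - J) \<subseteq> ?W" using pairing_dual_vec[OF I(1)] I(2) by auto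
    show "vec.independent (dual_vec v I ` (I - J))" "card (dual_vec v I ` (I - J)) = card (I - J)"
      using family_independent[where A = "I - J" and f = "dual_vec v I", OF _ ind] fin
      by (auto intro!: card_image)
    show "?W \<subseteq> vec.span (dual_vec v I ` (I - J))"
    proof
      fix u assume u: "u \<in> ?W"
      have "u = (\<Sum>i\<in>I. pairing u (of_int_vec (v i)) *s dual_vec v I i)"
        by (rule dual_vec_expansion[OF I(1)])
      also have "\<dots> = (\<Sum>i\<in>I - J. pairing u (of_int_vec (v i)) *s dual_vec v I i)"
        using u fin by (intro sum.mono_neutral_right) auto
      also have "\<dots> \<in> vec.span (dual_vec v I ` (I - J))"
        by (intro vec.span_sum vec.span_scale vec.span_base) auto
      finally show "u \<in> vec.span (dual_vec v I ` (I - J))" .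
    qed
  qed
  moreover have "vec.dim ?W = length ?w"
  proof (rule vec.dim_unique)
    let ?f = "\<lambda>a. annihilator_basis J ! a"
    have ind: "\<forall>a\<in>{..<length ?w}. c a = 0" if "(\<Sum>a<length ?w. c a *s ?f a) = 0" for c
      using annihilator_basis_independent[OF J, of c] that by simp
    show "?f ` {..<length ?w} \<subseteq> ?W" using pairing_annihilator_basis[OF J] by auto
    show "vec.independent (?f ` {..<length ?w})" "card (?f ` {..<length ?w}) = length ?w"
      using family_independent[where A = "{..<length ?w}" and f = ?f, OF _ ind] card_image[of ?f "{..<length ?w}"] by auto
    show "?W \<subseteq> vec.span (?f ` {..<length ?w})"
    proof
      fix u assume "u \<in> ?W"
      then obtain c where "u = (\<Sum>a<length ?w. c a *s ?f a)"
        using annihilator_basis_spans[OF J, of u] by blast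
      also have "\<dots> \<in> vec.span (?f ` {..<length ?w})"
        by (intro vec.span_sum vec.span_scale vec.span_base) auto
      finally show "u \<in> vec.span (?f ` {..<length ?w})" .
    qed
  qed
  moreover have "card (I - J) + card J = CARD('n)"
    using fin I(2) top_simplexD(2)[OF I(1)] card_mono[OF fin I(2)]
    by (simp add: card_Diff_subset finite_subset)
  ultimately show ?thesis by simp
qed

lemma top_simplex:
  assumes "J \<in> simplices \<Delta>"
  shows "top_simplex \<Delta> J \<in> top_simplices" "J \<subseteq> top_simplex \<Delta> J"
  using someI_ex[of "\<lambda>I. I \<in> top_simplices \<and> J \<subseteq> I"] simplex_in_top[OF assms]
  unfolding top_simplex_def by auto

text \<open>
  The value of \<open>u\<^sub>i\<^sup>I\<close> at a generator of the line in which the generic plane meets the span of \<open>N\<^sub>J\<close>.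
\<close>

definition face_coordinate :: "'v set \<Rightarrow> 'v \<Rightarrow> 'n entry qpoly" where
  "face_coordinate J i = plucker (CARD('n) - card J + 1) (f_gen \<Delta> v J i)"

lemma face_coordinate_eq:
  assumes J: "J \<in> simplices \<Delta>"
  shows "face_coordinate J i = plucker (Suc (length (annihilator_basis J)))
    (wedge (iota_gen v (top_simplex \<Delta> J) i # annihilator_basis J))"
proof -
  have "CARD('n) - card J + 1 = Suc (length (annihilator_basis J))"
    using length_omega_basis[OF J] by simp
  then show ?thesis unfolding face_coordinate_def f_gen_def by (simp only:)
qed

text \<open>
  For \<open>i\<close> outside \<open>J\<close> the first factor of the wedge product vanishes on \<open>N\<^sub>J\<close>, so it is a combination
  of the other factors.
\<close>

lemma face_coordinate_outside:
  assumes J: "J \<in> simplices \<Delta>" and i: "i \<notin> J"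
  shows "face_coordinate J i = 0"
proof -
  let ?I = "top_simplex \<Delta> J" and ?w = "annihilator_basis J"
  have "pairing (iota_gen v ?I i) (of_int_vec (v j)) = 0" if "j \<in> J" for j
    using pairing_dual_vec[OF top_simplex(1)[OF J], of i j] top_simplex(2)[OF J] that i
    by (auto simp: iota_gen_def pairing_simps)
  then obtain c where c: "iota_gen v ?I i = (\<Sum>a<length (omega_basis \<Delta> J). c a *s ?w ! a)"
    using annihilator_basis_spans[OF J] by blast
  show ?thesis unfolding face_coordinate_eq[OF J] c plucker_wedge_linear
  proof (intro sum.neutral ballI)
    fix a assume "a \<in> {..<length (omega_basis \<Delta> J)}"
    then have "a < length ?w" by simp
    from plucker_wedge_repeated[OF this]
    show "qconst (c a) * plucker (Suc (length ?w)) (wedge (?w ! a # ?w)) = 0" by simp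
  qed
qed

text \<open>
  The edge vector of \<open>i\<close> separates the dual vector of \<open>i\<close> from the forms that vanish on \<open>N\<^sub>J\<close>, so the
  factors of the wedge product are independent.
\<close>

lemma face_coordinate_nonzero:
  assumes J: "J \<in> simplices \<Delta>" and i: "i \<in> J"
  shows "face_coordinate J i \<noteq> 0"
proof -
  let ?I = "top_simplex \<Delta> J" and ?w = "annihilator_basis J"
  let ?u = "dual_vec v ?I i" and ?q = "length (omega_basis \<Delta> J)"
  have I: "?I \<in> top_simplices" "i \<in> ?I" using top_simplex[OF J] i by auto
  have "\<forall>a<length (?u # ?w). c a = 0" if z: "(\<Sum>a<length (?u # ?w). c a *s (?u # ?w) ! a) = 0" for c
  proof -
    have e: "c 0 *s ?u + (\<Sum>a<?q. c (Suc a) *s ?w ! a) = 0"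
      using z by (simp add: sum.lessThan_Suc_shift del: sum.lessThan_Suc)
    have "0 = pairing (c 0 *s ?u + (\<Sum>a<?q. c (Suc a) *s ?w ! a)) (of_int_vec (v i))"
      unfolding e by (simp add: pairing_simps)
    also have "\<dots> = c 0"
      using pairing_dual_vec[OF I I(2)] pairing_annihilator_basis[OF J _ i]
      by (simp add: pairing_simps pairing_sum del: nth_map)
    finally have c0: "c 0 = 0" ..
    then have "c (Suc a) = 0" if "a < ?q" for a
      using annihilator_basis_independent[OF J, of "\<lambda>a. c (Suc a)" a] e that by simp
    then show ?thesis using c0 by (auto simp: less_Suc_eq_0_disj)
  qed
  then have "plucker (length (?u # ?w)) (wedge (?u # ?w)) \<noteq> 0" by (rule plucker_wedge_nonzero)
  then show ?thesis unfolding face_coordinate_eq[OF J] using I by (simp add: iota_gen_def)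
qed

end

section \<open>Expansion of the functional in values at simplices\<close>

context multi_fan_with_edges
begin

text \<open>
  General position: the generic rows together with the edge vectors of \<open>K\<close> are independent, because the
  rows can be specialized to further edge vectors of a maximal simplex.  The form is found by inverting
  a square matrix that consists of generic rows and edge vectors.
\<close>

lemma exists_generic_form:
  assumes K: "K \<in> simplices \<Delta>" and k: "card K < k" "k \<le> CARD('n)" and i: "i \<in> K"
  shows "\<exists>y :: 'n \<Rightarrow> 'n entry qpoly fract.
    (\<forall>b \<le> CARD('n) - k. (\<Sum>s\<in>UNIV. y s * to_fract (qvar (Entry b s))) = 0) \<and>
    (\<forall>j\<in>K. (\<Sum>t\<in>UNIV. y t * of_int (vec_nth (v j) t)) = (if j = i then 1 else 0))"
proof -
  define r where "r = Suc (CARD('n) - k)"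
  obtain I where I: "I \<in> top_simplices" "K \<subseteq> I" using simplex_in_top[OF K] by blast
  have fin: "finite I" using simplex_finite top_simplexD(1)[OF I(1)] by blast
  obtain \<beta> where \<beta>: "bij_betw \<beta> (UNIV :: 'n set) I" "det (\<chi> a. v (\<beta> a)) \<noteq> 0"
    using top_simplex_enumeration[OF I(1)] .
  have "r \<le> card (I - K)"
    using k card_Diff_subset[OF finite_subset[OF I(2) fin] I(2)] top_simplexD(2)[OF I(1)]
    by (simp add: r_def)
  \<comment> \<open>the edge vectors of \<open>R\<close> make room for the generic rows\<close>
  then obtain R where R: "R \<subseteq> I - K" "card R = r" "finite R"
    by (rule obtain_subset_with_card_n)
  obtain e where e: "bij_betw e R {0..<r}" using ex_bij_betw_finite_nat[OF R(3)] R(2) by blast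
  define M :: "(('n entry qpoly, 'n) vec, 'n) vec" where
    "M = (\<chi> a t. if \<beta> a \<in> R then qvar (Entry (e (\<beta> a)) t) else of_int (vec_nth (v (\<beta> a)) t))"
  \<comment> \<open>the specialization of the generic rows to the edge vectors that they stand for\<close>
  let ?h = "\<lambda>x. (case x of Entry b t \<Rightarrow> of_int (vec_nth (v (inv_into R e b)) t)) :: 'n qpoly"
  have h: "qsubst ?h (vec_nth (vec_nth M a) t) = of_int (vec_nth (v (\<beta> a)) t)" for a t
    using bij_betw_inv_into_left[OF e, of "\<beta> a"] by (simp add: M_def)
  have "qsubst ?h (det M) = det (\<chi> a. of_int_vec (v (\<beta> a)))"
    by (simp add: det_def h of_int_vec_def)
  also have "\<dots> \<noteq> 0" unfolding det_of_int_vec using \<beta>(2) by simp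
  finally have dM: "det M \<noteq> 0" by auto
  define F :: "(('n entry qpoly fract, 'n) vec, 'n) vec" where
    "F = (\<chi> a t. to_fract (vec_nth (vec_nth M a) t))"
  have "det F = to_fract (det M)" by (simp add: F_def det_def)
  then have "det F \<noteq> 0" using dM by simp
  then obtain B where B: "F ** B = mat 1" by (metis invertible_det_nz invertible_right_inverse)
  obtain a0 where a0: "i = \<beta> a0" using \<beta>(1) i I(2) by (auto simp: bij_betw_def)
  define y where "y = B *v axis a0 1"
  have "F *v y = axis a0 1" by (simp add: y_def matrix_vector_mul_assoc B)
  then have "vec_nth (F *v y) a = (if a = a0 then 1 else 0)" for a by (simp add: axis_def)
  then have Fy: "(\<Sum>t\<in>UNIV. vec_nth y t * to_fract (vec_nth (vec_nth M a) t)) = (if a = a0 then 1 else 0)" for a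
    by (simp add: matrix_vector_mult_def F_def mult.commute)
  have Kr: "(\<Sum>t\<in>UNIV. vec_nth y t * of_int (vec_nth (v j) t)) = (if j = i then 1 else 0)" if j: "j \<in> K" for j
  proof -
    obtain a where a: "j = \<beta> a" using \<beta>(1) j I(2) by (auto simp: bij_betw_def)
    have "\<beta> a \<notin> R" using R(1) j a by auto
    then have "(\<Sum>t\<in>UNIV. vec_nth y t * of_int (vec_nth (v j) t)) = (if a = a0 then 1 else 0)"
      using Fy[of a] by (simp add: M_def a)
    also have "a = a0 \<longleftrightarrow> j = i" using \<beta>(1) a a0 by (auto simp: bij_betw_def inj_def)
    finally show ?thesis .
  qed
  show ?thesis
  proof (intro exI[of _ "vec_nth y"] conjI allI impI ballI Kr)
    fix b assume "b \<le> CARD('n) - k"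
    then have "b \<in> e ` R" using bij_betw_imp_surj_on[OF e] by (simp add: r_def)
    then obtain j where j: "j \<in> R" "e j = b" by blast
    obtain a where a: "j = \<beta> a" using \<beta>(1) j(1) R(1) by (auto simp: bij_betw_def)
    have "a \<noteq> a0" using a a0 j(1) R(1) i by auto
    then show "(\<Sum>s\<in>UNIV. vec_nth y s * to_fract (qvar (Entry b s))) = 0"
      using Fy[of a] j a by (simp add: M_def)
  qed
qed

text \<open>
  Downward induction on the size of the support.  A monomial that is not squarefree has fewer than \<open>k\<close>
  variables; the relation of a form with value 1 at \<open>v\<^sub>i\<close> and 0 at the other edge vectors of the support
  expresses it by monomials with larger support.
\<close>

lemma monomials_vanish:
  fixes \<Psi> :: "'v qpoly \<Rightarrow> 'n entry qpoly fract"
  assumes k: "k \<le> CARD('n)"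
    and nonface: "\<And>m. keys m \<subseteq> vertices \<Delta> \<Longrightarrow> keys m \<notin> simplices \<Delta> \<Longrightarrow>
      \<Psi> (xmono m) = 0"
    and face: "\<And>J. J \<in> simplices_card \<Delta> k \<Longrightarrow> \<Psi> (\<Prod>j\<in>J. qvar j) = 0"
    and relation: "\<And>y m. (\<And>b. b \<le> CARD('n) - k \<Longrightarrow> (\<Sum>s\<in>UNIV. y s * to_fract (qvar (Entry b s))) = 0) \<Longrightarrow>
      keys m \<subseteq> vertices \<Delta> \<Longrightarrow>
      (\<Sum>i\<in>vertices \<Delta>. (\<Sum>t\<in>UNIV. y t * of_int (vec_nth (v i) t)) * \<Psi> (qvar i * xmono m)) = 0"
    and m: "keys m \<subseteq> vertices \<Delta>" "mdeg m = k"
  shows "\<Psi> (xmono m) = 0"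
  using m
proof (induction "k - card (keys m)" arbitrary: m rule: less_induct)
  case less
  let ?K = "keys m"
  have one: "lookup m i \<ge> 1" if "i \<in> ?K" for i using that by (simp add: in_keys_iff)
  then have "card ?K \<le> mdeg m" using sum_mono[of ?K "\<lambda>_. 1" "lookup m"] by simp
  then have card: "card ?K \<le> k" using less.prems by simp
  show ?case
  proof (cases "?K \<in> simplices \<Delta>")
    case False
    then show ?thesis using nonface less.prems(1) by blast
  next
    case K: True
    show ?thesis
    proof (cases "\<forall>i\<in>?K. lookup m i = 1")
      case True
      then have "card ?K = k" using less.prems(2) by simp
      moreover have "xmono m = (\<Prod>j\<in>?K. qvar j)" unfolding xmono_eq_prod using True by simp
      ultimately show ?thesis using face[of ?K] K by (simp add: simplices_card_def)
    next
      case False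
      then obtain i where i: "i \<in> ?K" "lookup m i \<noteq> 1" by blast
      then have i2: "lookup m i \<ge> 2" using one[OF i(1)] by simp
      have "(\<Sum>i\<in>?K. 1) < mdeg m"
        using i(1) i2 one by (intro sum_strict_mono_ex1) (auto intro!: bexI[of _ i])
      then have lt: "card ?K < k" using less.prems(2) by simp
      \<comment> \<open>the exponent of \<open>i\<close> is at least 2, so \<open>m'\<close> still has support \<open>?K\<close>\<close>
      define m' where "m' = m - Poly_Mapping.single i 1"
      have mm': "m = Poly_Mapping.single i 1 + m'"
        using i2 by (intro poly_mapping_eqI) (auto simp: m'_def lookup_add lookup_minus lookup_single when_def)
      have km': "keys m' = ?K"
        using i2 by (auto simp: m'_def in_keys_iff lookup_minus lookup_single when_def)
      have dm': "Suc (mdeg m') = k"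
        using less.prems(2) mdeg_add[of "Poly_Mapping.single i 1" m'] mm' by simp
      have mono: "qvar j * xmono m' = xmono (Poly_Mapping.single j 1 + m')" for j
        by (simp only: qvar_eq_xmono xmono_add)
      obtain y :: "'n \<Rightarrow> 'n entry qpoly fract" where
        y: "\<forall>b \<le> CARD('n) - k. (\<Sum>s\<in>UNIV. y s * to_fract (qvar (Entry b s))) = 0"
          "\<forall>j\<in>?K. (\<Sum>t\<in>UNIV. y t * of_int (vec_nth (v j) t)) = (if j = i then 1 else 0)"
        using exists_generic_form[OF K lt k i(1)] by blast
      have "0 = (\<Sum>j\<in>vertices \<Delta>. (\<Sum>t\<in>UNIV. y t * of_int (vec_nth (v j) t)) * \<Psi> (qvar j * xmono m'))"
        using relation[of y m'] y(1) km' less.prems(1) by simp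
      also have "\<dots> = (\<Sum>j\<in>vertices \<Delta>. if j = i then \<Psi> (xmono m) else 0)"
      proof (rule sum.cong[OF refl])
        fix j assume j: "j \<in> vertices \<Delta>"
        show "(\<Sum>t\<in>UNIV. y t * of_int (vec_nth (v j) t)) * \<Psi> (qvar j * xmono m') =
          (if j = i then \<Psi> (xmono m) else 0)"
        proof (cases "j \<in> ?K")
          case True
          then show ?thesis using y(2) mono[of i] mm' by simp
        next
          case False
          have kj: "keys (Poly_Mapping.single j 1 + m') = insert j ?K"
            by (simp add: keys_add_nat km')
          have "\<Psi> (xmono (Poly_Mapping.single j 1 + m')) = 0"
          proof (rule less.hyps)
            show "k - card (keys (Poly_Mapping.single j 1 + m')) < k - card ?K"
              unfolding kj using False lt by simp
            show "keys (Poly_Mapping.single j 1 + m') \<subseteq> vertices \<Delta>"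
              unfolding kj using j less.prems(1) by simp
            show "mdeg (Poly_Mapping.single j 1 + m') = k" unfolding mdeg_add using dm' by simp
          qed
          then show ?thesis using False i(1) mono by auto
        qed
      qed
      also have "\<dots> = \<Psi> (xmono m)" using i(1) less.prems(1) finite_vertices by auto
      finally show ?thesis by simp
    qed
  qed
qed

text \<open>
  Evaluation at a generator of the line in which the generic plane meets the span of \<open>N\<^sub>J\<close>.
\<close>

definition face_value :: "'v set \<Rightarrow> 'v qpoly \<Rightarrow> 'n entry qpoly fract" where
  "face_value J p = to_fract (qsubst (face_coordinate J) p)"

lemma f_gen_kills_nonfaces:
  assumes J: "J \<in> simplices \<Delta>" shows "kills_nonfaces \<Delta> (f_gen \<Delta> v J)"
  by (rule kills_nonfacesI[OF top_simplex(1)[OF J]]) (simp add: f_gen_def iota_gen_def wedge_zero)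

lemma f_hom_HT_class:
  assumes "J \<in> simplices \<Delta>" shows "f_hom \<Delta> v J (HT_class \<Delta> p) = qsubst (f_gen \<Delta> v J) p"
  unfolding f_hom_def by (rule the_elem_qsubst_HT_class[OF f_gen_kills_nonfaces[OF assms]])

lemma plucker_f_hom:
  assumes "J \<in> simplices \<Delta>"
  shows "to_fract (plucker (CARD('n) - card J + 1) (f_hom \<Delta> v J (HT_class \<Delta> p))) = face_value J p"
  unfolding f_hom_HT_class[OF assms] face_value_def
  by (simp add: plucker_def qsubst_qsubst face_coordinate_def[abs_def])

lemma mu_HT_class:
  assumes "J \<in> simplices \<Delta>"
  shows "mu \<Delta> v (HT_class \<Delta> p) J = face_value J p / face_value J (\<Prod>j\<in>J. qvar j)"
  unfolding mu_def Let_def x_face_def plucker_f_hom[OF assms] ..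

lemma face_value_hom:
  "face_value J (p + q) = face_value J p + face_value J q"
  "face_value J (p * q) = face_value J p * face_value J q"
  "face_value J (qconst c) = rat_const c"
  by (simp_all add: face_value_def rat_const_def)

lemma face_value_self:
  assumes "J \<in> simplices \<Delta>" shows "face_value J (\<Prod>j\<in>J. qvar j) \<noteq> 0"
  using face_coordinate_nonzero[OF assms] simplex_finite[OF assms] by (simp add: face_value_def)

lemma face_value_other:
  assumes "J \<in> simplices \<Delta>" "J' \<in> simplices \<Delta>" "card J = card J'" "J' \<noteq> J"
  shows "face_value J (\<Prod>j\<in>J'. qvar j) = 0"
proof -
  have "\<not> J' \<subseteq> J" using assms card_subset_eq[OF simplex_finite[OF assms(1)]] by auto
  then obtain j where "j \<in> J'" "face_coordinate J j = 0" using face_coordinate_outside[OF assms(1)] by blast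
  then have "(\<Prod>j\<in>J'. face_coordinate J j) = 0" using simplex_finite[OF assms(2)] by (intro prod_zero) auto
  then show ?thesis by (simp only: face_value_def qsubst_prod qsubst_qvar to_fract_0)
qed

lemma face_value_nonface:
  assumes J: "J \<in> simplices \<Delta>" and "keys m \<notin> simplices \<Delta>"
  shows "face_value J (xmono m) = 0"
  using prod_nonface_eq_0[OF top_simplex(1)[OF J] _ assms(2), of "face_coordinate J"]
    face_coordinate_outside[OF J] top_simplex(2)[OF J]
  by (auto simp: face_value_def)

text \<open>
  The relation of \<open>y\<close> restricts to \<open>y\<close> itself at the maximal simplex, and \<open>y\<close> vanishes at the chosen
  point because this point lies in the generic plane.
\<close>

lemma face_value_relation:
  assumes J: "J \<in> simplices \<Delta>"
    and y: "\<And>b. b \<le> CARD('n) - card J \<Longrightarrow> (\<Sum>s\<in>UNIV. y s * to_fract (qvar (Entry b s))) = 0"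
  shows "(\<Sum>i\<in>vertices \<Delta>. (\<Sum>t\<in>UNIV. y t * of_int (vec_nth (v i) t)) * face_value J (qvar i)) = 0"
proof -
  let ?w = "annihilator_basis J" and ?I = "top_simplex \<Delta> J"
  define A where "A s = to_fract (plucker (Suc (length ?w)) (wedge (axis s 1 # ?w)))" for s
  have len: "length ?w = CARD('n) - card J" using length_omega_basis[OF J] by simp
  have yA: "(\<Sum>t\<in>UNIV. y t * A t) = 0"
    unfolding A_def by (rule plucker_wedge_orthogonal) (use y len in simp)
  have fv: "face_value J (qvar i) = (\<Sum>s\<in>UNIV. rat_const (vec_nth (iota_gen v ?I i) s) * A s)" for i
    unfolding face_value_def qsubst_qvar face_coordinate_eq[OF J]
    by (subst wedge_coordinates) (simp add: A_def rat_const_def)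
  have rc: "(\<Sum>i\<in>vertices \<Delta>. of_int (vec_nth (v i) t) * rat_const (vec_nth (iota_gen v ?I i) s)) =
      (if s = t then 1 else 0 :: 'n entry qpoly fract)" for s t
  proof -
    have "(\<Sum>i\<in>vertices \<Delta>. of_int (vec_nth (v i) t) * rat_const (vec_nth (iota_gen v ?I i) s)) =
        (rat_const (\<Sum>i\<in>vertices \<Delta>. of_int (vec_nth (v i) t) * vec_nth (iota_gen v ?I i) s)
          :: 'n entry qpoly fract)"
      by (simp add: rat_const_def qconst_sum qconst_hom of_int_eq_to_fract)
    then show ?thesis
      unfolding sum_vertices_iota_gen[OF top_simplex(1)[OF J]] by (simp add: rat_const_def qconst_hom)
  qed
  have "(\<Sum>i\<in>vertices \<Delta>. (\<Sum>t\<in>UNIV. y t * of_int (vec_nth (v i) t)) * face_value J (qvar i)) =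
    (\<Sum>i\<in>vertices \<Delta>. \<Sum>t\<in>UNIV. \<Sum>s\<in>UNIV. y t * A s *
      (of_int (vec_nth (v i) t) * rat_const (vec_nth (iota_gen v ?I i) s)))"
    unfolding fv sum_product by (intro sum.cong refl) (simp add: mult_ac)
  also have "\<dots> = (\<Sum>t\<in>UNIV. \<Sum>s\<in>UNIV. y t * A s *
      (\<Sum>i\<in>vertices \<Delta>. of_int (vec_nth (v i) t) * rat_const (vec_nth (iota_gen v ?I i) s)))"
    unfolding sum_distrib_left
    by (subst sum.swap) (intro sum.cong refl, subst sum.swap, rule refl)
  also have "\<dots> = (\<Sum>t\<in>UNIV. y t * A t)"
    unfolding rc by (intro sum.cong refl) (simp add: if_distrib[of "\<lambda>x. _ * x"] cong: if_cong)
  finally show ?thesis using yA by simp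
qed

lemma mu_in_Rat_Grassmannian:
  assumes J: "J \<in> simplices_card \<Delta> k" and p: "homogeneous k p"
  shows "mu \<Delta> v (HT_class \<Delta> p) J \<in> Rat_Grassmannian (CARD('n) - k + 1)"
proof -
  have Js: "J \<in> simplices \<Delta>" and card: "card J = k" using J by (auto simp: simplices_card_def)
  let ?r = "CARD('n) - k + 1"
  let ?F = "qsubst (f_gen \<Delta> v J) p" and ?G = "qsubst (f_gen \<Delta> v J) (\<Prod>j\<in>J. qvar j)"
  have r: "?r = Suc (length (omega_basis \<Delta> J))" using length_omega_basis[OF Js] card by simp
  have vars: "qvars (f_gen \<Delta> v J i) \<subseteq> {S. card S = ?r}" for i
    using qvars_wedge[of "iota_gen v (top_simplex \<Delta> J) i # annihilator_basis J"]
    unfolding r f_gen_def by simp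
  have hom: "homogeneous 1 (f_gen \<Delta> v J i)" for i unfolding f_gen_def by (rule homogeneous_wedge)
  have "homogeneous (\<Sum>j\<in>J. 1) (\<Prod>j\<in>J. qvar j)" by (rule homogeneous_prod[OF homogeneous_qvar])
  then have homJ: "homogeneous k (\<Prod>j\<in>J. qvar j)" using card by simp
  have "mu \<Delta> v (HT_class \<Delta> p) J = to_fract (plucker ?r ?F) / to_fract (plucker ?r ?G)"
    unfolding mu_def Let_def x_face_def f_hom_HT_class[OF Js] card ..
  moreover have "plucker ?r ?G \<noteq> 0"
    using face_value_self[OF Js] plucker_f_hom[OF Js, of "\<Prod>j\<in>J. qvar j"]
    unfolding f_hom_HT_class[OF Js] card by auto
  moreover have "qvars ?F \<subseteq> {S. card S = ?r}" "qvars ?G \<subseteq> {S. card S = ?r}"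
    by (rule qvars_qsubst, rule vars)+
  moreover have "homogeneous k ?F" "homogeneous k ?G"
    by (rule homogeneous_qsubst[OF p hom], rule homogeneous_qsubst[OF homJ hom])
  ultimately show ?thesis unfolding Rat_Grassmannian_def by blast
qed

lemma rat_const_hom:
  "rat_const (a + b) = rat_const a + rat_const b" "rat_const (a * b) = rat_const a * rat_const b"
  "rat_const 0 = 0" "rat_const (of_int c) = of_int c"
  by (simp_all add: rat_const_def qconst_hom qconst_of_int)

lemma rat_const_sum: "rat_const (\<Sum>a\<in>A. f a) = (\<Sum>a\<in>A. rat_const (f a))"
  by (simp add: rat_const_def qconst_sum)

text \<open>
  The difference of the two sides is a functional of \<open>p\<close> to which \<open>monomials_vanish\<close> applies: it takes the
  relations of forms vanishing on the generic plane to zero because both \<open>exp_push\<close> and the evaluations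
  at the simplices do.
\<close>

lemma exp_push_expansion:
  assumes complete: "complete_multi_fan \<Delta>" and k: "k \<le> CARD('n)"
    and q: "qvars q \<subseteq> vertices \<Delta>" and p: "qvars p \<subseteq> vertices \<Delta>" "homogeneous k p"
  shows "rat_const (exp_push q p) =
    (\<Sum>J\<in>simplices_card \<Delta> k. mu \<Delta> v (HT_class \<Delta> p) J * rat_const (exp_push q (\<Prod>j\<in>J. qvar j)))"
proof -
  note E = exp_push_add[OF complete q] exp_push_scale[OF complete q] exp_push_sum[OF complete q]
  let ?V = "vertices \<Delta>" and ?S = "simplices_card \<Delta> k"
  define \<mu> where "\<mu> J p = face_value J p / face_value J (\<Prod>j\<in>J. qvar j)" for J p
  define \<Psi> where "\<Psi> p = rat_const (exp_push q p) -
    (\<Sum>J\<in>?S. \<mu> J p * rat_const (exp_push q (\<Prod>j\<in>J. qvar j)))" for p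
  have S: "J \<in> simplices \<Delta>" "card J = k" if "J \<in> ?S" for J using that by (auto simp: simplices_card_def)
  have finS: "finite ?S" using finite_simplices by (simp add: simplices_card_def)
  have relation: "(\<Sum>i\<in>?V. (\<Sum>t\<in>UNIV. y t * of_int (vec_nth (v i) t)) * \<Psi> (qvar i * xmono m)) = 0"
    if y: "\<And>b. b \<le> CARD('n) - k \<Longrightarrow> (\<Sum>s\<in>UNIV. y s * to_fract (qvar (Entry b s))) = 0"
      and m: "keys m \<subseteq> ?V" for y m
  proof -
    let ?c = "\<lambda>i. \<Sum>t\<in>UNIV. y t * of_int (vec_nth (v i) t)"
    have vm: "qvars (xmono m) \<subseteq> ?V" using m by (simp add: qvars_xmono)
    have vi: "qvars (qvar i * xmono m) \<subseteq> ?V" if "i \<in> ?V" for i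
      using that vm by (intro qvars_mult) (auto simp: qvars_hom)
    have "(\<Sum>i\<in>?V. ?c i * rat_const (exp_push q (qvar i * xmono m))) =
      (\<Sum>t\<in>UNIV. y t * rat_const (exp_push q (linear_relation t * xmono m)))"
    proof -
      have "exp_push q (linear_relation t * xmono m) =
          (\<Sum>i\<in>?V. of_int (vec_nth (v i) t) * exp_push q (qvar i * xmono m))" for t
      proof -
        have "linear_relation t * xmono m = (\<Sum>i\<in>?V. qconst (of_int (vec_nth (v i) t)) * (qvar i * xmono m))"
          by (simp add: linear_relation_def sum_distrib_right mult.assoc)
        then show ?thesis
          using vi qvars_mult[OF _ vi] by (simp add: E(2,3) qvars_hom)
      qed
      then show ?thesis
        by (simp add: rat_const_sum rat_const_hom sum_distrib_left sum_distrib_right mult.assoc)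
          (rule sum.swap)
    qed
    also have "\<dots> = 0" by (simp add: exp_push_linear_relation[OF complete q vm] rat_const_hom)
    finally have 1: "(\<Sum>i\<in>?V. ?c i * rat_const (exp_push q (qvar i * xmono m))) = 0" .
    have 2: "(\<Sum>i\<in>?V. ?c i * \<mu> J (qvar i * xmono m)) = 0" if J: "J \<in> ?S" for J
    proof -
      have "(\<Sum>i\<in>?V. ?c i * \<mu> J (qvar i * xmono m)) =
        (\<Sum>i\<in>?V. ?c i * face_value J (qvar i)) * (face_value J (xmono m) / face_value J (\<Prod>j\<in>J. qvar j))"
        unfolding sum_distrib_right by (intro sum.cong refl) (simp add: \<mu>_def face_value_hom(2) mult.assoc)
      also have "(\<Sum>i\<in>?V. ?c i * face_value J (qvar i)) = 0"
        by (rule face_value_relation) (use S[OF J] y in auto)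
      finally show ?thesis by simp
    qed
    have "(\<Sum>i\<in>?V. ?c i * \<Psi> (qvar i * xmono m)) =
      (\<Sum>i\<in>?V. ?c i * rat_const (exp_push q (qvar i * xmono m))) -
      (\<Sum>J\<in>?S. (\<Sum>i\<in>?V. ?c i * \<mu> J (qvar i * xmono m)) * rat_const (exp_push q (\<Prod>j\<in>J. qvar j)))"
    proof -
      have "(\<Sum>i\<in>?V. ?c i * (\<Sum>J\<in>?S. \<mu> J (qvar i * xmono m) * rat_const (exp_push q (\<Prod>j\<in>J. qvar j)))) =
        (\<Sum>J\<in>?S. (\<Sum>i\<in>?V. ?c i * \<mu> J (qvar i * xmono m)) * rat_const (exp_push q (\<Prod>j\<in>J. qvar j)))"
        unfolding sum_distrib_left[of "?c _"] sum_distrib_right[of "\<lambda>i. ?c i * _ i"]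
        by (subst sum.swap) (simp only: mult.assoc)
      then show ?thesis by (simp only: \<Psi>_def right_diff_distrib sum_subtractf)
    qed
    then show ?thesis using 1 2 by simp
  qed
  have mono: "\<Psi> (xmono m) = 0" if m: "keys m \<subseteq> ?V" "mdeg m = k" for m
  proof (rule monomials_vanish[OF k _ _ relation m])
    fix m :: "'v \<Rightarrow>\<^sub>0 nat" assume "keys m \<subseteq> ?V" "keys m \<notin> simplices \<Delta>"
    then show "\<Psi> (xmono m) = 0"
      using S(1) by (simp add: \<Psi>_def \<mu>_def exp_push_nonface[OF complete q] face_value_nonface rat_const_hom)
  next
    fix J assume J: "J \<in> ?S"
    have "(\<Sum>J'\<in>?S. \<mu> J' (\<Prod>j\<in>J. qvar j) * rat_const (exp_push q (\<Prod>j\<in>J'. qvar j))) =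
      (\<Sum>J'\<in>?S. if J' = J then rat_const (exp_push q (\<Prod>j\<in>J. qvar j)) else 0)"
      using S J face_value_self face_value_other by (intro sum.cong) (auto simp: \<mu>_def)
    then show "\<Psi> (\<Prod>j\<in>J. qvar j) = 0" using J finS by (simp add: \<Psi>_def)
  qed
  have vmono: "qvars (xmono m) \<subseteq> ?V" if "m \<in> keys p" for m
    using that p(1) by (auto simp: qvars_xmono qvars_def)
  let ?t = "\<lambda>m. qconst (lookup p m) * xmono m"
  have "exp_push q (\<Sum>m\<in>keys p. ?t m) = (\<Sum>m\<in>keys p. exp_push q (?t m))"
    using vmono by (intro E(3) qvars_mult) (auto simp: qvars_hom)
  then have "rat_const (exp_push q p) =
      (\<Sum>m\<in>keys p. rat_const (lookup p m) * rat_const (exp_push q (xmono m)))"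
    unfolding qpoly_expand[of p, symmetric]
    using vmono by (simp add: E(2) rat_const_sum rat_const_hom)
  also have "\<dots> = (\<Sum>m\<in>keys p. rat_const (lookup p m) *
      (\<Sum>J\<in>?S. \<mu> J (xmono m) * rat_const (exp_push q (\<Prod>j\<in>J. qvar j))))"
  proof (rule sum.cong[OF refl])
    fix m assume "m \<in> keys p"
    then have "\<Psi> (xmono m) = 0"
      using p vmono[of m] by (intro mono) (auto simp: qvars_xmono homogeneous_def)
    then show "rat_const (lookup p m) * rat_const (exp_push q (xmono m)) =
      rat_const (lookup p m) *
      (\<Sum>J\<in>?S. \<mu> J (xmono m) * rat_const (exp_push q (\<Prod>j\<in>J. qvar j)))"
      by (simp add: \<Psi>_def)
  qed
  also have "\<dots> = (\<Sum>J\<in>?S. (\<Sum>m\<in>keys p. rat_const (lookup p m) * \<mu> J (xmono m)) *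
      rat_const (exp_push q (\<Prod>j\<in>J. qvar j)))"
    unfolding sum_distrib_left sum_distrib_right by (subst sum.swap) (simp only: mult.assoc)
  also have "\<dots> = (\<Sum>J\<in>?S. \<mu> J p * rat_const (exp_push q (\<Prod>j\<in>J. qvar j)))"
  proof (rule sum.cong[OF refl])
    fix J
    have "face_value J p = (\<Sum>m\<in>keys p. rat_const (lookup p m) * face_value J (xmono m))"
    proof -
      have "face_value J (\<Sum>m\<in>keys p. ?t m) = (\<Sum>m\<in>keys p. face_value J (?t m))"
        by (simp add: face_value_def)
      then show ?thesis
        unfolding qpoly_expand[of p, symmetric] by (simp only: face_value_hom)
    qed
    then show "(\<Sum>m\<in>keys p. rat_const (lookup p m) * \<mu> J (xmono m)) *
        rat_const (exp_push q (\<Prod>j\<in>J. qvar j)) = \<mu> J p * rat_const (exp_push q (\<Prod>j\<in>J. qvar j))"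
      by (simp add: \<mu>_def sum_divide_distrib)
  qed
  also have "\<dots> = (\<Sum>J\<in>?S. mu \<Delta> v (HT_class \<Delta> p) J * rat_const (exp_push q (\<Prod>j\<in>J. qvar j)))"
    using S by (intro sum.cong) (simp_all add: mu_HT_class \<mu>_def)
  finally show ?thesis .
qed

end

theorem theorem5p1:
  fixes \<Delta> :: "('v, 'n::{finite,linorder}) multi_fan_data"
    and v :: "'v \<Rightarrow> (int, 'n) vec"
    and k :: nat
    and x \<xi> :: "'v qpoly set"
  assumes "complete_multi_fan \<Delta>"
    and "edge_vectors \<Delta> v"
    and "1 \<le> k" and "k \<le> CARD('n)"
    and "x \<in> HT_even \<Delta> k"
    and "\<xi> \<in> HT_even \<Delta> 1"
  shows "(\<forall>J\<in>simplices_card \<Delta> k. mu \<Delta> v x J \<in> Rat_Grassmannian (CARD('n) - k + 1)) \<and>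
    rat_const (p_push_exp \<Delta> v \<xi> x) =
      (\<Sum>J\<in>simplices_card \<Delta> k. mu \<Delta> v x J * rat_const (p_push_exp \<Delta> v \<xi> (x_face \<Delta> J)))"
proof -
  interpret multi_fan_with_edges \<Delta> v
    by unfold_locales (use assms(1,2) in \<open>simp_all add: complete_multi_fan_def\<close>)
  obtain p where p: "x = HT_class \<Delta> p" "qvars p \<subseteq> vertices \<Delta>" "homogeneous k p"
    using assms(5) by (auto simp: HT_even_def)
  obtain q where q: "\<xi> = HT_class \<Delta> q" "qvars q \<subseteq> vertices \<Delta>"
    using assms(6) by (auto simp: HT_even_def)
  show ?thesis
    using mu_in_Rat_Grassmannian[OF _ p(3)] exp_push_expansion[OF assms(1,4) q(2) p(2,3)]
    unfolding p(1) q(1) x_face_def by blast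
qed

end
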